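(* Let $\mathbb{A}$ be a 2-category with a strict initial object, and let $\mathcal{H} \colon \mathbb{A} \to \mathsf{CAT}$ be the pseudofunctor (defined on the underlying category of $\mathbb{A}$) sending an object $x$ to the lax comma category $\mathbb{A}\Downarrow x$ and a morphism $p \colon x \to y$ to the functor $p_! \colon \mathbb{A}\Downarrow x \to \mathbb{A}\Downarrow y$ given by composing (whiskering) with $p$ on morphisms (2-cells). Then the op-Grothendieck construction $\int^{\mathbb{A}} \mathcal{H} \to \mathbb{A}$ of $\mathcal{H}$ preserves effective descent morphisms.
   Context: The lax comma category $\mathbb{A} \Downarrow x$ is the (1-)category whose objects are morphisms $f \colon a \to x$ of $\mathbb{A}$ with codomain $x$, and whose morphisms from $f \colon a \to x$ to $g \colon b \to x$ are pairs $(h,\pi)$ with $h \colon a \to b$ a morphism of $\mathbb{A}$ and $\pi \colon f \Rightarrow g \cdot h$ a 2-cell; the composite of $(h,\pi) \colon f \to g$ and $(k,\chi)\colon g \to l$ is $(k\cdot h, (\chi\cdot h)\circ\pi)$. The functor $p_!$ sends $f$ to $p\cdot f$ and $(h,\pi)$ to $(h, p\cdot \pi)$. The op-Grothendieck construction of a pseudofunctor $\mathcal{H} \colon \mathcal{A} \to \mathsf{CAT}$ is the projection $\int^{\mathcal{A}}\mathcal{H} \to \mathcal{A}$, $(a,x)\mapsto a$, where objects are the pairs $(a,x)$ with $a\in\mathcal{A}$, $x \in \mathcal{H}_a$, and morphisms $(a,x)\to(b,y)$ are pairs $(f,\phi)$ with $f \colon a\to b$ in $\mathcal{A}$ and $\phi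 \colon \mathcal{H}_f(x)\to y$ in $\mathcal{H}_b$. Explicitly, here the objects of $\int^{\mathbb{A}} \mathcal{H}$ are the morphisms of $\mathbb{A}$, and a morphism from $f \colon a \to x$ to $g \colon b \to y$ is a triple $(p,h,\pi)$ with $p \colon x \to y$, $h \colon a \to b$ and $\pi \colon p\cdot f \Rightarrow g \cdot h$ a 2-cell; the projection sends $f \colon a \to x$ to $x$ and $(p,h,\pi)$ to $p$. Effective descent in $\mathbb{A}$ refers to its underlying category. A strict initial object of a 2-category $\mathbb{A}$ is an object $\mathsf{0}$ such that $\mathbb{A}(\mathsf{0},x)$ is isomorphic to the terminal category for every $x$, and such that every object $a$ admitting a morphism $a \to \mathsf{0}$ is isomorphic to $\mathsf{0}$. A morphism $p \colon a \to b$ in a category $\mathcal{X}$ is an effective descent morphism if all pullbacks along $p$ exist in $\mathcal{X}$ (equivalently, the functor $p_! \colon \mathcal{X} \downarrow a \to \mathcal{X} \downarrow b$, $f \mapsto p \circ f$, between slice categories has a right adjoint $p^*$) and $p^*$ is monadic (its comparison functor into the Eilenberg-Moore category of the monad induced by $p_! \dashv p^*$ is an equivalence). No existence of other pullbacks in $\mathcal{X}$ is assumed. A functor $F$ preserves effective descent morphisms if $F(p)$ is an effective descent morphism whenever $p$ is. *)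

theory Defs
  imports Main
begin

section \<open>Categories\<close>

text \<open>
  A category is a record with explicit carriers of objects and arrows; the operations are
  meaningful on the carriers only. Composition is written in the classical order.
\<close>

record ('o, 'm) cat =
  Obj :: "'o set"
  Arr :: "'m set"
  Dom :: "'m \<Rightarrow> 'o"
  Cod :: "'m \<Rightarrow> 'o"
  Ident :: "'o \<Rightarrow> 'm"
  Comp :: "'m \<Rightarrow> 'm \<Rightarrow> 'm" (infixr "\<cdot>\<index>" 70)

definition Hom :: "('o, 'm, 'z) cat_scheme \<Rightarrow> 'o \<Rightarrow> 'o \<Rightarrow> 'm set" where
  "Hom C x y = {f \<in> Arr C. Dom C f = x \<and> Cod C f = y}"

locale category =
  fixes C :: "('o, 'm, 'z) cat_scheme" (structure)
  assumes dom_obj: "f \<in> Arr C \<Longrightarrow> Dom C f \<in> Obj C"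
    and cod_obj: "f \<in> Arr C \<Longrightarrow> Cod C f \<in> Obj C"
    and ident_hom: "x \<in> Obj C \<Longrightarrow> Ident C x \<in> Hom C x x"
    and comp_hom: "\<lbrakk>f \<in> Hom C x y; g \<in> Hom C y z\<rbrakk> \<Longrightarrow> g \<cdot> f \<in> Hom C x z"
    and comp_assoc: "\<lbrakk>f \<in> Hom C w x; g \<in> Hom C x y; h \<in> Hom C y z\<rbrakk>
        \<Longrightarrow> (h \<cdot> g) \<cdot> f = h \<cdot> (g \<cdot> f)"
    and comp_ident_right: "f \<in> Hom C x y \<Longrightarrow> f \<cdot> Ident C x = f"
    and comp_ident_left: "f \<in> Hom C x y \<Longrightarrow> Ident C y \<cdot> f = f"

definition is_iso :: "('o, 'm, 'z) cat_scheme \<Rightarrow> 'm \<Rightarrow> bool" where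
  "is_iso C f \<longleftrightarrow> f \<in> Arr C \<and> (\<exists>g \<in> Hom C (Cod C f) (Dom C f).
     g \<cdot>\<^bsub>C\<^esub> f = Ident C (Dom C f) \<and> f \<cdot>\<^bsub>C\<^esub> g = Ident C (Cod C f))"

definition isomorphic_objs :: "('o, 'm, 'z) cat_scheme \<Rightarrow> 'o \<Rightarrow> 'o \<Rightarrow> bool" where
  "isomorphic_objs C x y \<longleftrightarrow> (\<exists>f \<in> Hom C x y. is_iso C f)"

definition one_cat :: "(unit, unit) cat" where
  "one_cat = \<lparr>Obj = UNIV, Arr = UNIV, Dom = (\<lambda>_. ()), Cod = (\<lambda>_. ()),
     Ident = (\<lambda>_. ()), Comp = (\<lambda>_ _. ())\<rparr>"


section \<open>Functors and natural transformations\<close>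

record ('o1, 'm1, 'o2, 'm2) fctr =
  Fo :: "'o1 \<Rightarrow> 'o2"
  Fm :: "'m1 \<Rightarrow> 'm2"

locale cat_functor = dom: category C + cod: category D
  for C :: "('o1, 'm1, 'z1) cat_scheme" and D :: "('o2, 'm2, 'z2) cat_scheme" +
  fixes F :: "('o1, 'm1, 'o2, 'm2) fctr"
  assumes fo_obj: "x \<in> Obj C \<Longrightarrow> Fo F x \<in> Obj D"
    and fm_hom: "f \<in> Hom C x y \<Longrightarrow> Fm F f \<in> Hom D (Fo F x) (Fo F y)"
    and fm_ident: "x \<in> Obj C \<Longrightarrow> Fm F (Ident C x) = Ident D (Fo F x)"
    and fm_comp: "\<lbrakk>f \<in> Hom C x y; g \<in> Hom C y z\<rbrakk>
        \<Longrightarrow> Fm F (g \<cdot>\<^bsub>C\<^esub> f) = Fm F g \<cdot>\<^bsub>D\<^esub> Fm F f"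

definition id_fctr :: "('o, 'm, 'o, 'm) fctr" where
  "id_fctr = \<lparr>Fo = (\<lambda>x. x), Fm = (\<lambda>f. f)\<rparr>"

definition comp_fctr ::
    "('o2, 'm2, 'o3, 'm3) fctr \<Rightarrow> ('o1, 'm1, 'o2, 'm2) fctr \<Rightarrow> ('o1, 'm1, 'o3, 'm3) fctr" where
  "comp_fctr G F = \<lparr>Fo = (\<lambda>x. Fo G (Fo F x)), Fm = (\<lambda>f. Fm G (Fm F f))\<rparr>"

definition isomorphic_cats :: "('o1, 'm1, 'z1) cat_scheme \<Rightarrow> ('o2, 'm2, 'z2) cat_scheme \<Rightarrow> bool" where
  "isomorphic_cats C D \<longleftrightarrow> (\<exists>F G. cat_functor C D F \<and> cat_functor D C G
     \<and> (\<forall>x \<in> Obj C. Fo G (Fo F x) = x) \<and> (\<forall>f \<in> Arr C. Fm G (Fm F f) = f)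
     \<and> (\<forall>y \<in> Obj D. Fo F (Fo G y) = y) \<and> (\<forall>g \<in> Arr D. Fm F (Fm G g) = g))"

definition nat_trans :: "('o1, 'm1, 'z1) cat_scheme \<Rightarrow> ('o2, 'm2, 'z2) cat_scheme
    \<Rightarrow> ('o1, 'm1, 'o2, 'm2) fctr \<Rightarrow> ('o1, 'm1, 'o2, 'm2) fctr \<Rightarrow> ('o1 \<Rightarrow> 'm2) \<Rightarrow> bool" where
  "nat_trans C D F G \<tau> \<longleftrightarrow> (\<forall>x \<in> Obj C. \<tau> x \<in> Hom D (Fo F x) (Fo G x))
     \<and> (\<forall>f \<in> Arr C. \<tau> (Cod C f) \<cdot>\<^bsub>D\<^esub> Fm F f = Fm G f \<cdot>\<^bsub>D\<^esub> \<tau> (Dom C f))"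

definition nat_iso :: "('o1, 'm1, 'z1) cat_scheme \<Rightarrow> ('o2, 'm2, 'z2) cat_scheme
    \<Rightarrow> ('o1, 'm1, 'o2, 'm2) fctr \<Rightarrow> ('o1, 'm1, 'o2, 'm2) fctr \<Rightarrow> ('o1 \<Rightarrow> 'm2) \<Rightarrow> bool" where
  "nat_iso C D F G \<tau> \<longleftrightarrow> nat_trans C D F G \<tau> \<and> (\<forall>x \<in> Obj C. is_iso D (\<tau> x))"

definition cat_equivalence :: "('o1, 'm1, 'z1) cat_scheme \<Rightarrow> ('o2, 'm2, 'z2) cat_scheme
    \<Rightarrow> ('o1, 'm1, 'o2, 'm2) fctr \<Rightarrow> bool" where
  "cat_equivalence C D F \<longleftrightarrow> cat_functor C D F \<and> (\<exists>G \<alpha> \<beta>. cat_functor D C G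
     \<and> nat_iso C C id_fctr (comp_fctr G F) \<alpha> \<and> nat_iso D D (comp_fctr F G) id_fctr \<beta>)"


section \<open>Adjunctions and monadicity\<close>

text \<open>\<open>F : C \<rightarrow> D\<close> is left adjoint to \<open>G : D \<rightarrow> C\<close>, with unit \<open>\<eta>\<close> and counit \<open>\<epsilon>\<close>.\<close>

locale adjunction = left: cat_functor C D F + right: cat_functor D C G
  for C :: "('o1, 'm1, 'z1) cat_scheme" and D :: "('o2, 'm2, 'z2) cat_scheme"
    and F :: "('o1, 'm1, 'o2, 'm2) fctr" and G :: "('o2, 'm2, 'o1, 'm1) fctr" +
  fixes \<eta> :: "'o1 \<Rightarrow> 'm1" and \<epsilon> :: "'o2 \<Rightarrow> 'm2"
  assumes unit: "nat_trans C C id_fctr (comp_fctr G F) \<eta>"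
    and counit: "nat_trans D D (comp_fctr F G) id_fctr \<epsilon>"
    and triangle_left: "x \<in> Obj C \<Longrightarrow> \<epsilon> (Fo F x) \<cdot>\<^bsub>D\<^esub> Fm F (\<eta> x) = Ident D (Fo F x)"
    and triangle_right: "y \<in> Obj D \<Longrightarrow> Fm G (\<epsilon> y) \<cdot>\<^bsub>C\<^esub> \<eta> (Fo G y) = Ident C (Fo G y)"

text \<open>
  The Eilenberg-Moore category of a monad \<open>(T, \<eta>, \<mu>)\<close> on \<open>C\<close>. An algebra is a pair of an
  object and a structure arrow; an arrow is recorded together with its source and target algebra.
\<close>

definition em_algebras :: "('o, 'm, 'z) cat_scheme \<Rightarrow> ('o, 'm, 'o, 'm) fctr
    \<Rightarrow> ('o \<Rightarrow> 'm) \<Rightarrow> ('o \<Rightarrow> 'm) \<Rightarrow> ('o \<times> 'm) set" where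
  "em_algebras C T \<eta> \<mu> = {(x, a). x \<in> Obj C \<and> a \<in> Hom C (Fo T x) x
     \<and> a \<cdot>\<^bsub>C\<^esub> \<eta> x = Ident C x \<and> a \<cdot>\<^bsub>C\<^esub> Fm T a = a \<cdot>\<^bsub>C\<^esub> \<mu> x}"

definition em_category :: "('o, 'm, 'z) cat_scheme \<Rightarrow> ('o, 'm, 'o, 'm) fctr
    \<Rightarrow> ('o \<Rightarrow> 'm) \<Rightarrow> ('o \<Rightarrow> 'm) \<Rightarrow> ('o \<times> 'm, ('o \<times> 'm) \<times> 'm \<times> ('o \<times> 'm)) cat" where
  "em_category C T \<eta> \<mu> = \<lparr>
     Obj = em_algebras C T \<eta> \<mu>,
     Arr = {((x, a), h, (y, b)). (x, a) \<in> em_algebras C T \<eta> \<mu> \<and> (y, b) \<in> em_algebras C T \<eta> \<mu>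
              \<and> h \<in> Hom C x y \<and> h \<cdot>\<^bsub>C\<^esub> a = b \<cdot>\<^bsub>C\<^esub> Fm T h},
     Dom = (\<lambda>(A, h, B). A),
     Cod = (\<lambda>(A, h, B). B),
     Ident = (\<lambda>(x, a). ((x, a), Ident C x, (x, a))),
     Comp = (\<lambda>(B', k, D) (A, h, B). (A, k \<cdot>\<^bsub>C\<^esub> h, D))\<rparr>"

definition induced_mult :: "('o1, 'm1, 'o2, 'm2) fctr \<Rightarrow> ('o2, 'm2, 'o1, 'm1) fctr
    \<Rightarrow> ('o2 \<Rightarrow> 'm2) \<Rightarrow> 'o1 \<Rightarrow> 'm1" where
  "induced_mult F G \<epsilon> = (\<lambda>x. Fm G (\<epsilon> (Fo F x)))"

abbreviation induced_em_category where
  "induced_em_category C F G \<eta> \<epsilon> \<equiv> em_category C (comp_fctr G F) \<eta> (induced_mult F G \<epsilon>)"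

definition comparison :: "('o2, 'm2, 'z2) cat_scheme \<Rightarrow> ('o2, 'm2, 'o1, 'm1) fctr
    \<Rightarrow> ('o2 \<Rightarrow> 'm2) \<Rightarrow> ('o2, 'm2, 'o1 \<times> 'm1, ('o1 \<times> 'm1) \<times> 'm1 \<times> ('o1 \<times> 'm1)) fctr" where
  "comparison D G \<epsilon> = \<lparr>
     Fo = (\<lambda>y. (Fo G y, Fm G (\<epsilon> y))),
     Fm = (\<lambda>g. ((Fo G (Dom D g), Fm G (\<epsilon> (Dom D g))), Fm G g,
                (Fo G (Cod D g), Fm G (\<epsilon> (Cod D g)))))\<rparr>"


section \<open>Effective descent morphisms\<close>

definition slice :: "('o, 'm, 'z) cat_scheme \<Rightarrow> 'o \<Rightarrow> ('m, 'm \<times> 'm \<times> 'm) cat" where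
  "slice X b = \<lparr>
     Obj = {f \<in> Arr X. Cod X f = b},
     Arr = {(f, h, g). f \<in> Arr X \<and> Cod X f = b \<and> g \<in> Arr X \<and> Cod X g = b
              \<and> h \<in> Hom X (Dom X f) (Dom X g) \<and> g \<cdot>\<^bsub>X\<^esub> h = f},
     Dom = (\<lambda>(f, h, g). f),
     Cod = (\<lambda>(f, h, g). g),
     Ident = (\<lambda>f. (f, Ident X (Dom X f), f)),
     Comp = (\<lambda>(g', k, l) (f, h, g). (f, k \<cdot>\<^bsub>X\<^esub> h, l))\<rparr>"

definition slice_push :: "('o, 'm, 'z) cat_scheme \<Rightarrow> 'm \<Rightarrow> ('m, 'm \<times> 'm \<times> 'm, 'm, 'm \<times> 'm \<times> 'm) fctr" where
  "slice_push X p = \<lparr>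
     Fo = (\<lambda>f. p \<cdot>\<^bsub>X\<^esub> f),
     Fm = (\<lambda>(f, h, g). (p \<cdot>\<^bsub>X\<^esub> f, h, p \<cdot>\<^bsub>X\<^esub> g))\<rparr>"

definition is_pullback :: "('o, 'm, 'z) cat_scheme \<Rightarrow> 'm \<Rightarrow> 'm \<Rightarrow> 'm \<Rightarrow> 'm \<Rightarrow> bool" where
  "is_pullback X p g u v \<longleftrightarrow>
     p \<in> Arr X \<and> g \<in> Arr X \<and> u \<in> Arr X \<and> v \<in> Arr X
     \<and> Cod X p = Cod X g \<and> Cod X u = Dom X p \<and> Cod X v = Dom X g \<and> Dom X u = Dom X v
     \<and> p \<cdot>\<^bsub>X\<^esub> u = g \<cdot>\<^bsub>X\<^esub> v
     \<and> (\<forall>u' \<in> Arr X. \<forall>v' \<in> Arr X.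
          Cod X u' = Dom X p \<and> Cod X v' = Dom X g \<and> Dom X u' = Dom X v'
          \<and> p \<cdot>\<^bsub>X\<^esub> u' = g \<cdot>\<^bsub>X\<^esub> v' \<longrightarrow>
          (\<exists>!w. w \<in> Hom X (Dom X u') (Dom X u) \<and> u \<cdot>\<^bsub>X\<^esub> w = u' \<and> v \<cdot>\<^bsub>X\<^esub> w = v'))"

definition has_pullbacks_along :: "('o, 'm, 'z) cat_scheme \<Rightarrow> 'm \<Rightarrow> bool" where
  "has_pullbacks_along X p \<longleftrightarrow>
     (\<forall>g \<in> Arr X. Cod X g = Cod X p \<longrightarrow> (\<exists>u v. is_pullback X p g u v))"

text \<open>
  The functor \<open>p\<^sup>*\<close> is the right adjoint \<open>G\<close> of \<open>slice_push X p\<close>. It is determined up to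
  isomorphism only; monadicity does not depend on the choice.
\<close>

definition effective_descent :: "('o, 'm, 'z) cat_scheme \<Rightarrow> 'm \<Rightarrow> bool" where
  "effective_descent X p \<longleftrightarrow> p \<in> Arr X \<and> has_pullbacks_along X p
     \<and> (\<exists>G \<eta> \<epsilon>.
          adjunction (slice X (Dom X p)) (slice X (Cod X p)) (slice_push X p) G \<eta> \<epsilon>
          \<and> cat_equivalence (slice X (Cod X p))
              (induced_em_category (slice X (Dom X p)) (slice_push X p) G \<eta> \<epsilon>)
              (comparison (slice X (Cod X p)) G \<epsilon>))"

definition preserves_effective_descent :: "('o1, 'm1, 'z1) cat_scheme \<Rightarrow> ('o2, 'm2, 'z2) cat_scheme
    \<Rightarrow> ('o1, 'm1, 'o2, 'm2) fctr \<Rightarrow> bool" where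
  "preserves_effective_descent X Y F \<longleftrightarrow>
     (\<forall>p. effective_descent X p \<longrightarrow> effective_descent Y (Fm F p))"


section \<open>2-categories\<close>

text \<open>
  The record of a (strict) 2-category extends that of its underlying category, so notions defined
  for categories apply to a 2-category through its underlying category.
\<close>

record ('o, 'm, 'c) two_cat = "('o, 'm) cat" +
  Cell :: "'c set"
  Src :: "'c \<Rightarrow> 'm"
  Tgt :: "'c \<Rightarrow> 'm"
  Vid :: "'m \<Rightarrow> 'c"
  Vcomp :: "'c \<Rightarrow> 'c \<Rightarrow> 'c" (infixr "\<bullet>\<index>" 70)
  Hcomp :: "'c \<Rightarrow> 'c \<Rightarrow> 'c" (infixr "\<star>\<index>" 70)

definition Cells :: "('o, 'm, 'c, 'z) two_cat_scheme \<Rightarrow> 'm \<Rightarrow> 'm \<Rightarrow> 'c set" where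
  "Cells A f g = {\<alpha> \<in> Cell A. Src A \<alpha> = f \<and> Tgt A \<alpha> = g}"

definition hom_cat :: "('o, 'm, 'c, 'z) two_cat_scheme \<Rightarrow> 'o \<Rightarrow> 'o \<Rightarrow> ('m, 'c) cat" where
  "hom_cat A x y = \<lparr>
     Obj = Hom A x y,
     Arr = {\<alpha> \<in> Cell A. Src A \<alpha> \<in> Hom A x y \<and> Tgt A \<alpha> \<in> Hom A x y},
     Dom = Src A, Cod = Tgt A, Ident = Vid A, Comp = Vcomp A\<rparr>"

locale two_category = category A
  for A :: "('o, 'm, 'c, 'z) two_cat_scheme" (structure) +
  assumes src_arr: "\<alpha> \<in> Cell A \<Longrightarrow> Src A \<alpha> \<in> Arr A"
    and tgt_arr: "\<alpha> \<in> Cell A \<Longrightarrow> Tgt A \<alpha> \<in> Arr A"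
    and parallel_dom: "\<alpha> \<in> Cell A \<Longrightarrow> Dom A (Src A \<alpha>) = Dom A (Tgt A \<alpha>)"
    and parallel_cod: "\<alpha> \<in> Cell A \<Longrightarrow> Cod A (Src A \<alpha>) = Cod A (Tgt A \<alpha>)"
    and hom_category: "\<lbrakk>x \<in> Obj A; y \<in> Obj A\<rbrakk> \<Longrightarrow> category (hom_cat A x y)"
    and hcomp_cells: "\<lbrakk>\<alpha> \<in> Cells A f f'; \<beta> \<in> Cells A g g'; Cod A f = Dom A g\<rbrakk>
        \<Longrightarrow> \<beta> \<star> \<alpha> \<in> Cells A (g \<cdot> f) (g' \<cdot> f')"
    and hcomp_vid: "\<lbrakk>f \<in> Arr A; g \<in> Arr A; Cod A f = Dom A g\<rbrakk>
        \<Longrightarrow> Vid A g \<star> Vid A f = Vid A (g \<cdot> f)"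
    and interchange: "\<lbrakk>\<alpha> \<in> Cells A f f'; \<alpha>' \<in> Cells A f' f'';
        \<beta> \<in> Cells A g g'; \<beta>' \<in> Cells A g' g''; Cod A f = Dom A g\<rbrakk>
        \<Longrightarrow> (\<beta>' \<bullet> \<beta>) \<star> (\<alpha>' \<bullet> \<alpha>) = (\<beta>' \<star> \<alpha>') \<bullet> (\<beta> \<star> \<alpha>)"
    and hcomp_assoc: "\<lbrakk>\<alpha> \<in> Cells A f f'; \<beta> \<in> Cells A g g'; \<gamma> \<in> Cells A h h';
        Cod A f = Dom A g; Cod A g = Dom A h\<rbrakk>
        \<Longrightarrow> (\<gamma> \<star> \<beta>) \<star> \<alpha> = \<gamma> \<star> (\<beta> \<star> \<alpha>)"
    and hcomp_ident_right: "\<alpha> \<in> Cells A f f' \<Longrightarrow> \<alpha> \<star> Vid A (Ident A (Dom A f)) = \<alpha>"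
    and hcomp_ident_left: "\<alpha> \<in> Cells A f f' \<Longrightarrow> Vid A (Ident A (Cod A f)) \<star> \<alpha> = \<alpha>"

definition strict_initial :: "('o, 'm, 'c, 'z) two_cat_scheme \<Rightarrow> 'o \<Rightarrow> bool" where
  "strict_initial A i \<longleftrightarrow> i \<in> Obj A
     \<and> (\<forall>x \<in> Obj A. isomorphic_cats (hom_cat A i x) one_cat)
     \<and> (\<forall>a \<in> Obj A. Hom A a i \<noteq> {} \<longrightarrow> isomorphic_objs A a i)"


section \<open>Lax comma categories\<close>

definition lax_comma :: "('o, 'm, 'c, 'z) two_cat_scheme \<Rightarrow> 'o \<Rightarrow> ('m, 'm \<times> ('m \<times> 'c) \<times> 'm) cat" where
  "lax_comma A x = \<lparr>
     Obj = {f \<in> Arr A. Cod A f = x},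
     Arr = {(f, (h, \<pi>), g). f \<in> Arr A \<and> Cod A f = x \<and> g \<in> Arr A \<and> Cod A g = x
              \<and> h \<in> Hom A (Dom A f) (Dom A g) \<and> \<pi> \<in> Cells A f (g \<cdot>\<^bsub>A\<^esub> h)},
     Dom = (\<lambda>(f, u, g). f),
     Cod = (\<lambda>(f, u, g). g),
     Ident = (\<lambda>f. (f, (Ident A (Dom A f), Vid A f), f)),
     Comp = (\<lambda>(g', (k, \<chi>), l) (f, (h, \<pi>), g).
       (f, (k \<cdot>\<^bsub>A\<^esub> h, (\<chi> \<star>\<^bsub>A\<^esub> Vid A h) \<bullet>\<^bsub>A\<^esub> \<pi>), l))\<rparr>"

definition lax_comma_push :: "('o, 'm, 'c, 'z) two_cat_scheme \<Rightarrow> 'm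
    \<Rightarrow> ('m, 'm \<times> ('m \<times> 'c) \<times> 'm, 'm, 'm \<times> ('m \<times> 'c) \<times> 'm) fctr" where
  "lax_comma_push A p = \<lparr>
     Fo = (\<lambda>f. p \<cdot>\<^bsub>A\<^esub> f),
     Fm = (\<lambda>(f, (h, \<pi>), g). (p \<cdot>\<^bsub>A\<^esub> f, (h, Vid A p \<star>\<^bsub>A\<^esub> \<pi>), p \<cdot>\<^bsub>A\<^esub> g))\<rparr>"


section \<open>Pseudofunctors to CAT and the op-Grothendieck construction\<close>

text \<open>
  The structure isomorphisms are taken in the direction in which the op-Grothendieck construction
  uses them: \<open>CompIso H g f x\<close> goes from \<open>H\<^bsub>g f\<^esub> x\<close> to \<open>H\<^sub>g (H\<^sub>f x)\<close>, and \<open>UnitIso H a x\<close>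
  goes from \<open>H\<^sub>1 x\<close> to \<open>x\<close> for the identity of \<open>a\<close>.
\<close>

record ('o, 'm, 'u, 'v) pseudofun =
  Fib :: "'o \<Rightarrow> ('u, 'v) cat"
  Trans :: "'m \<Rightarrow> ('u, 'v, 'u, 'v) fctr"
  CompIso :: "'m \<Rightarrow> 'm \<Rightarrow> 'u \<Rightarrow> 'v"
  UnitIso :: "'o \<Rightarrow> 'u \<Rightarrow> 'v"

locale pseudofunctor = category A
  for A :: "('o, 'm, 'z) cat_scheme" (structure) +
  fixes H :: "('o, 'm, 'u, 'v) pseudofun"
  assumes fib_category: "a \<in> Obj A \<Longrightarrow> category (Fib H a)"
    and trans_functor: "f \<in> Hom A a b \<Longrightarrow> cat_functor (Fib H a) (Fib H b) (Trans H f)"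
    and comp_iso: "\<lbrakk>f \<in> Hom A a b; g \<in> Hom A b c\<rbrakk> \<Longrightarrow>
        nat_iso (Fib H a) (Fib H c) (Trans H (g \<cdot> f)) (comp_fctr (Trans H g) (Trans H f))
          (CompIso H g f)"
    and unit_iso: "a \<in> Obj A \<Longrightarrow>
        nat_iso (Fib H a) (Fib H a) (Trans H (Ident A a)) id_fctr (UnitIso H a)"
    and coherence_assoc: "\<lbrakk>f \<in> Hom A a b; g \<in> Hom A b c; h \<in> Hom A c d; x \<in> Obj (Fib H a)\<rbrakk> \<Longrightarrow>
        Fm (Trans H h) (CompIso H g f x) \<cdot>\<^bsub>Fib H d\<^esub> CompIso H h (g \<cdot> f) x
        = CompIso H h g (Fo (Trans H f) x) \<cdot>\<^bsub>Fib H d\<^esub> CompIso H (h \<cdot> g) f x"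
    and coherence_unit_right: "\<lbrakk>f \<in> Hom A a b; x \<in> Obj (Fib H a)\<rbrakk> \<Longrightarrow>
        Fm (Trans H f) (UnitIso H a x) \<cdot>\<^bsub>Fib H b\<^esub> CompIso H f (Ident A a) x
        = Ident (Fib H b) (Fo (Trans H f) x)"
    and coherence_unit_left: "\<lbrakk>f \<in> Hom A a b; x \<in> Obj (Fib H a)\<rbrakk> \<Longrightarrow>
        UnitIso H b (Fo (Trans H f) x) \<cdot>\<^bsub>Fib H b\<^esub> CompIso H (Ident A b) f x
        = Ident (Fib H b) (Fo (Trans H f) x)"

definition op_grothendieck :: "('o, 'm, 'z) cat_scheme \<Rightarrow> ('o, 'm, 'u, 'v) pseudofun
    \<Rightarrow> ('o \<times> 'u, ('o \<times> 'u) \<times> ('m \<times> 'v) \<times> ('o \<times> 'u)) cat" where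
  "op_grothendieck A H = \<lparr>
     Obj = {(a, x). a \<in> Obj A \<and> x \<in> Obj (Fib H a)},
     Arr = {((a, x), (f, \<phi>), (b, y)). a \<in> Obj A \<and> x \<in> Obj (Fib H a) \<and> b \<in> Obj A \<and> y \<in> Obj (Fib H b)
              \<and> f \<in> Hom A a b \<and> \<phi> \<in> Hom (Fib H b) (Fo (Trans H f) x) y},
     Dom = (\<lambda>(X, u, Y). X),
     Cod = (\<lambda>(X, u, Y). Y),
     Ident = (\<lambda>(a, x). ((a, x), (Ident A a, UnitIso H a x), (a, x))),
     Comp = (\<lambda>(Y', (g, \<psi>), (c, z)) ((a, x), (f, \<phi>), Y).
       ((a, x),
        (g \<cdot>\<^bsub>A\<^esub> f, \<psi> \<cdot>\<^bsub>Fib H c\<^esub> (Fm (Trans H g) \<phi> \<cdot>\<^bsub>Fib H c\<^esub> CompIso H g f x)),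
        (c, z)))\<rparr>"

definition op_grothendieck_proj ::
    "('o \<times> 'u, ('o \<times> 'u) \<times> ('m \<times> 'v) \<times> ('o \<times> 'u), 'o, 'm) fctr" where
  "op_grothendieck_proj = \<lparr>Fo = (\<lambda>(a, x). a), Fm = (\<lambda>(X, (f, \<phi>), Y). f)\<rparr>"

text \<open>
  For the lax comma categories of a strict 2-category the structure isomorphisms are identities.
\<close>

definition lax_comma_pseudofun :: "('o, 'm, 'c, 'z) two_cat_scheme
    \<Rightarrow> ('o, 'm, 'm, 'm \<times> ('m \<times> 'c) \<times> 'm) pseudofun" where
  "lax_comma_pseudofun A = \<lparr>
     Fib = lax_comma A,
     Trans = lax_comma_push A,
     CompIso = (\<lambda>q p f. Ident (lax_comma A (Cod A q)) (q \<cdot>\<^bsub>A\<^esub> (p \<cdot>\<^bsub>A\<^esub> f))),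
     UnitIso = (\<lambda>a f. Ident (lax_comma A a) f)\<rparr>"


section \<open>Well-definedness\<close>

lemma hom_iff: "f \<in> Hom C x y \<longleftrightarrow> f \<in> Arr C \<and> Dom C f = x \<and> Cod C f = y"
  by (auto simp: Hom_def)
lemma cells_iff: "\<alpha> \<in> Cells A f g \<longleftrightarrow> \<alpha> \<in> Cell A \<and> Src A \<alpha> = f \<and> Tgt A \<alpha> = g"
  by (auto simp: Cells_def)

context category begin
lemma comp_arr [simp]: assumes "f \<in> Arr C" "g \<in> Arr C" "Cod C f = Dom C g"
  shows "g \<cdot> f \<in> Arr C" "Dom C (g \<cdot> f) = Dom C f" "Cod C (g \<cdot> f) = Cod C g"
  using comp_hom[of f "Dom C f" "Cod C f" g "Cod C g"] assms by (auto simp: hom_iff)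
lemma ident_arr [simp]: assumes "x \<in> Obj C"
  shows "Ident C x \<in> Arr C" "Dom C (Ident C x) = x" "Cod C (Ident C x) = x"
  using ident_hom[OF assms] by (auto simp: hom_iff)
lemma comp_assoc' [simp]: assumes "f \<in> Arr C" "g \<in> Arr C" "h \<in> Arr C" "Cod C f = Dom C g" "Cod C g = Dom C h"
  shows "(h \<cdot> g) \<cdot> f = h \<cdot> (g \<cdot> f)"
  using comp_assoc[of f _ _ g _ h] assms by (auto simp: hom_iff)
lemma ident_right' [simp]: "f \<in> Arr C \<Longrightarrow> x = Dom C f \<Longrightarrow> f \<cdot> Ident C x = f"
  using comp_ident_right by (auto simp: hom_iff)
lemma ident_left' [simp]: "f \<in> Arr C \<Longrightarrow> x = Cod C f \<Longrightarrow> Ident C x \<cdot> f = f"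
  using comp_ident_left by (auto simp: hom_iff)
lemma dom_cod_obj [simp]: "f \<in> Arr C \<Longrightarrow> Dom C f \<in> Obj C" "f \<in> Arr C \<Longrightarrow> Cod C f \<in> Obj C"
  by (auto intro: dom_obj cod_obj)
lemma is_iso_ident: "x \<in> Obj C \<Longrightarrow> is_iso C (Ident C x)"
  unfolding is_iso_def by (auto simp: hom_iff intro!: exI[of _ "Ident C x"] bexI[of _ "Ident C x"])
end

context two_category begin
lemma vcomp_cell [simp]: assumes "\<alpha> \<in> Cell A" "\<beta> \<in> Cell A" "Tgt A \<alpha> = Src A \<beta>"
  shows "\<beta> \<bullet> \<alpha> \<in> Cell A" "Src A (\<beta> \<bullet> \<alpha>) = Src A \<alpha>" "Tgt A (\<beta> \<bullet> \<alpha>) = Tgt A \<beta>"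
proof -
  let ?H = "hom_cat A (Dom A (Src A \<alpha>)) (Cod A (Src A \<alpha>))"
  interpret h: category ?H using assms by (intro hom_category) (auto simp: src_arr)
  have "\<alpha> \<in> Arr ?H" "\<beta> \<in> Arr ?H" "Cod ?H \<alpha> = Dom ?H \<beta>"
    using assms parallel_dom[of \<alpha>] parallel_cod[of \<alpha>] parallel_dom[of \<beta>] parallel_cod[of \<beta>]
    by (auto simp: hom_cat_def hom_iff src_arr tgt_arr)
  from h.comp_arr[OF this] show "\<beta> \<bullet> \<alpha> \<in> Cell A" "Src A (\<beta> \<bullet> \<alpha>) = Src A \<alpha>" "Tgt A (\<beta> \<bullet> \<alpha>) = Tgt A \<beta>"
    by (auto simp: hom_cat_def)
qed
lemma vid_cell [simp]: assumes "f \<in> Arr A"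
  shows "Vid A f \<in> Cell A" "Src A (Vid A f) = f" "Tgt A (Vid A f) = f"
proof -
  let ?H = "hom_cat A (Dom A f) (Cod A f)"
  interpret h: category ?H using assms by (intro hom_category) auto
  have "f \<in> Obj ?H" using assms by (auto simp: hom_cat_def hom_iff)
  from h.ident_arr[OF this] show "Vid A f \<in> Cell A" "Src A (Vid A f) = f" "Tgt A (Vid A f) = f"
    by (auto simp: hom_cat_def)
qed
lemma vcomp_assoc [simp]: assumes "\<alpha> \<in> Cell A" "\<beta> \<in> Cell A" "\<gamma> \<in> Cell A" "Tgt A \<alpha> = Src A \<beta>" "Tgt A \<beta> = Src A \<gamma>"
  shows "(\<gamma> \<bullet> \<beta>) \<bullet> \<alpha> = \<gamma> \<bullet> (\<beta> \<bullet> \<alpha>)"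
proof -
  let ?H = "hom_cat A (Dom A (Src A \<alpha>)) (Cod A (Src A \<alpha>))"
  interpret h: category ?H using assms by (intro hom_category) (auto simp: src_arr)
  have "\<alpha> \<in> Arr ?H" "\<beta> \<in> Arr ?H" "\<gamma> \<in> Arr ?H" "Cod ?H \<alpha> = Dom ?H \<beta>" "Cod ?H \<beta> = Dom ?H \<gamma>"
    using assms parallel_dom[of \<alpha>] parallel_cod[of \<alpha>] parallel_dom[of \<beta>] parallel_cod[of \<beta>]
      parallel_dom[of \<gamma>] parallel_cod[of \<gamma>]
    by (auto simp: hom_cat_def hom_iff src_arr tgt_arr)
  from h.comp_assoc'[OF this] show ?thesis by (simp add: hom_cat_def)
qed
lemma vcomp_vid [simp]: assumes "\<alpha> \<in> Cell A"
  shows "f = Src A \<alpha> \<Longrightarrow> \<alpha> \<bullet> Vid A f = \<alpha>" "f = Tgt A \<alpha> \<Longrightarrow> Vid A f \<bullet> \<alpha> = \<alpha>"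
proof -
  let ?H = "hom_cat A (Dom A (Src A \<alpha>)) (Cod A (Src A \<alpha>))"
  interpret h: category ?H using assms by (intro hom_category) (auto simp: src_arr)
  have a: "\<alpha> \<in> Arr ?H"
    using assms parallel_dom[of \<alpha>] parallel_cod[of \<alpha>] by (auto simp: hom_cat_def hom_iff src_arr tgt_arr)
  from h.ident_right'[OF a] h.ident_left'[OF a]
  show "f = Src A \<alpha> \<Longrightarrow> \<alpha> \<bullet> Vid A f = \<alpha>" "f = Tgt A \<alpha> \<Longrightarrow> Vid A f \<bullet> \<alpha> = \<alpha>"
    by (auto simp: hom_cat_def)
qed
lemma cell_arr [simp]: assumes "\<alpha> \<in> Cell A"
  shows "Src A \<alpha> \<in> Arr A" "Tgt A \<alpha> \<in> Arr A" 
    "Dom A (Tgt A \<alpha>) = Dom A (Src A \<alpha>)" "Cod A (Tgt A \<alpha>) = Cod A (Src A \<alpha>)"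
  using assms src_arr tgt_arr parallel_dom parallel_cod by auto
lemma hcomp_cell [simp]: assumes "\<alpha> \<in> Cell A" "\<beta> \<in> Cell A" "Cod A (Src A \<alpha>) = Dom A (Src A \<beta>)"
  shows "\<beta> \<star> \<alpha> \<in> Cell A" "Src A (\<beta> \<star> \<alpha>) = Src A \<beta> \<cdot> Src A \<alpha>" "Tgt A (\<beta> \<star> \<alpha>) = Tgt A \<beta> \<cdot> Tgt A \<alpha>"
  using hcomp_cells[of \<alpha> "Src A \<alpha>" _ \<beta> "Src A \<beta>"] assms by (auto simp: cells_iff)
lemma hcomp_assoc' [simp]: assumes "\<alpha> \<in> Cell A" "\<beta> \<in> Cell A" "\<gamma> \<in> Cell A"
   "Cod A (Src A \<alpha>) = Dom A (Src A \<beta>)" "Cod A (Src A \<beta>) = Dom A (Src A \<gamma>)"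
  shows "(\<gamma> \<star> \<beta>) \<star> \<alpha> = \<gamma> \<star> (\<beta> \<star> \<alpha>)"
  using hcomp_assoc[of \<alpha> _ _ \<beta> _ _ \<gamma>] assms by (auto simp: cells_iff)
lemma hcomp_ident [simp]: assumes "\<alpha> \<in> Cell A"
  shows "x = Dom A (Src A \<alpha>) \<Longrightarrow> \<alpha> \<star> Vid A (Ident A x) = \<alpha>"
   "x = Cod A (Src A \<alpha>) \<Longrightarrow> Vid A (Ident A x) \<star> \<alpha> = \<alpha>"
  using hcomp_ident_right[of \<alpha>] hcomp_ident_left[of \<alpha>] assms by (auto simp: cells_iff)
lemma whisker_right: assumes "\<alpha> \<in> Cell A" "\<beta> \<in> Cell A" "Tgt A \<alpha> = Src A \<beta>" "h \<in> Arr A" "Cod A h = Dom A (Src A \<alpha>)"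
  shows "(\<beta> \<bullet> \<alpha>) \<star> Vid A h = (\<beta> \<star> Vid A h) \<bullet> (\<alpha> \<star> Vid A h)"
  using interchange[of "Vid A h" h h "Vid A h" h \<alpha> _ _ \<beta>] assms by (auto simp: cells_iff)
lemma whisker_left: assumes "\<alpha> \<in> Cell A" "\<beta> \<in> Cell A" "Tgt A \<alpha> = Src A \<beta>" "h \<in> Arr A" "Dom A h = Cod A (Src A \<alpha>)"
  shows "Vid A h \<star> (\<beta> \<bullet> \<alpha>) = (Vid A h \<star> \<beta>) \<bullet> (Vid A h \<star> \<alpha>)"
  using interchange[of \<alpha> _ _ \<beta> _ "Vid A h" h h "Vid A h" h] assms by (auto simp: cells_iff)
lemma hcomp_vid' [simp]: "\<lbrakk>f \<in> Arr A; g \<in> Arr A; Cod A f = Dom A g\<rbrakk> \<Longrightarrow> Vid A g \<star> Vid A f = Vid A (g \<cdot> f)"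
  by (rule hcomp_vid)
lemma hcomp_vid_assoc: assumes "f \<in> Arr A" "g \<in> Arr A" "\<alpha> \<in> Cell A" "Cod A f = Dom A g" "Cod A (Src A \<alpha>) = Dom A f"
  shows "Vid A g \<star> (Vid A f \<star> \<alpha>) = Vid A (g \<cdot> f) \<star> \<alpha>"
  using assms hcomp_assoc'[of \<alpha> "Vid A f" "Vid A g"] by simp

lemma category_lax_comma: "category (lax_comma A x)"
  apply unfold_locales
  apply (auto simp: lax_comma_def Hom_def Cells_def whisker_right)
  done

lemma lax_comma_push_functor: assumes "p \<in> Hom A x y" 
  shows "cat_functor (lax_comma A x) (lax_comma A y) (lax_comma_push A p)"
proof -
  interpret a: category "lax_comma A x" by (rule category_lax_comma)
  interpret b: category "lax_comma A y" by (rule category_lax_comma)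
  show ?thesis using assms
  apply unfold_locales
  apply (auto simp: lax_comma_def lax_comma_push_def Hom_def Cells_def whisker_left hcomp_vid_assoc)
  done
qed

lemma pseudofunctor_lax_comma: "pseudofunctor A (lax_comma_pseudofun A)"
proof (intro pseudofunctor.intro pseudofunctor_axioms.intro)
  note d = lax_comma_pseudofun_def
  show "category A" ..
  show "category (Fib (lax_comma_pseudofun A) a)" for a
    by (simp add: d category_lax_comma)
  show "cat_functor (Fib (lax_comma_pseudofun A) a) (Fib (lax_comma_pseudofun A) b) (Trans (lax_comma_pseudofun A) f)"
    if "f \<in> Hom A a b" for f a b using that by (simp add: d lax_comma_push_functor)
  show "nat_iso (Fib (lax_comma_pseudofun A) a) (Fib (lax_comma_pseudofun A) c) (Trans (lax_comma_pseudofun A) (g \<cdot> f)) (comp_fctr (Trans (lax_comma_pseudofun A) g) (Trans (lax_comma_pseudofun A) f))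
          (CompIso (lax_comma_pseudofun A) g f)"
    if "f \<in> Hom A a b" "g \<in> Hom A b c" for f g a b c 
  proof -
    interpret category "lax_comma A c" by (rule category_lax_comma)
    have "q \<in> Arr A \<Longrightarrow> Cod A q = c \<Longrightarrow> is_iso (lax_comma A c) (Ident (lax_comma A c) q)" for q
      using that by (intro is_iso_ident) (auto simp: hom_iff lax_comma_def)
    then have "\<forall>x\<in>Obj (lax_comma A a). is_iso (lax_comma A c) (Ident (lax_comma A (Cod A g)) (g \<cdot> (f \<cdot> x)))"
      using that by (auto simp: lax_comma_def[of A a] hom_iff)
    moreover have "nat_trans (lax_comma A a) (lax_comma A c) (lax_comma_push A (g \<cdot> f))
        (comp_fctr (lax_comma_push A g) (lax_comma_push A f))
        (\<lambda>x. Ident (lax_comma A (Cod A g)) (g \<cdot> (f \<cdot> x)))"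
      using that by (auto simp: nat_trans_def comp_fctr_def lax_comma_push_def lax_comma_def
          Hom_def Cells_def hcomp_vid_assoc)
    ultimately show ?thesis by (simp add: d nat_iso_def)
  qed
  show "nat_iso (Fib (lax_comma_pseudofun A) a) (Fib (lax_comma_pseudofun A) a) (Trans (lax_comma_pseudofun A) (Ident A a)) id_fctr (UnitIso (lax_comma_pseudofun A) a)"
    if "a \<in> Obj A" for a
  proof -
    interpret category "lax_comma A a" by (rule category_lax_comma)
    have "q \<in> Arr A \<Longrightarrow> Cod A q = a \<Longrightarrow> is_iso (lax_comma A a) (Ident (lax_comma A a) q)" for q
      using that by (intro is_iso_ident) (auto simp: hom_iff lax_comma_def)
    with that show ?thesis
      by (auto simp: d nat_iso_def nat_trans_def id_fctr_def lax_comma_push_def hom_iff)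
        (auto simp: lax_comma_def Hom_def Cells_def hcomp_vid_assoc)
  qed
qed (auto simp: lax_comma_pseudofun_def lax_comma_push_def lax_comma_def Hom_def hcomp_vid_assoc)
end

context pseudofunctor begin

lemma category_op_grothendieck: "category (op_grothendieck A H)"
proof -
  let ?G = "op_grothendieck A H"
  have cmp: "\<kappa> \<in> Hom (Fib H c) (Fo (Trans H (g \<cdot> f)) x) (Fo (Trans H g) (Fo (Trans H f) x))"
    if "f \<in> Hom A a b" "g \<in> Hom A b c" "x \<in> Obj (Fib H a)" "\<kappa> = CompIso H g f x" for f g x a b c \<kappa>
    using comp_iso[OF that(1,2)] that by (auto simp: nat_iso_def nat_trans_def comp_fctr_def)
  have unt: "UnitIso H a x \<in> Hom (Fib H a) (Fo (Trans H (Ident A a)) x) x"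
    if "a \<in> Obj A" "x \<in> Obj (Fib H a)" for a x
    using unit_iso[OF that(1)] that by (auto simp: nat_iso_def nat_trans_def id_fctr_def)
  have unit_nat: "UnitIso H a y \<cdot>\<^bsub>Fib H a\<^esub> Fm (Trans H (Ident A a)) \<phi> = \<phi> \<cdot>\<^bsub>Fib H a\<^esub> UnitIso H a x"
    if "a \<in> Obj A" "\<phi> \<in> Hom (Fib H a) x y" for a x y \<phi>
    using unit_iso[OF that(1)] that by (auto simp: nat_iso_def nat_trans_def id_fctr_def hom_iff)
  have cmp_nat: "CompIso H g f y \<cdot>\<^bsub>Fib H c\<^esub> Fm (Trans H (g \<cdot> f)) \<phi>
     = Fm (Trans H g) (Fm (Trans H f) \<phi>) \<cdot>\<^bsub>Fib H c\<^esub> CompIso H g f x"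
    if "f \<in> Hom A a b" "g \<in> Hom A b c" "\<phi> \<in> Hom (Fib H a) x y" for f g a b c \<phi> x y
    using comp_iso[OF that(1,2)] that by (auto simp: nat_iso_def nat_trans_def comp_fctr_def hom_iff)
  have ob: "x \<in> Obj (Fib H a)" if "a \<in> Obj A" "\<phi> \<in> Hom (Fib H a) x y" for a x y \<phi>
    using category.dom_obj[OF fib_category[OF that(1)]] that by (auto simp: hom_iff)
  have arr: "((a,x),(f,\<phi>),(b,y)) \<in> Arr ?G \<longleftrightarrow> a \<in> Obj A \<and> x \<in> Obj (Fib H a) \<and> b \<in> Obj A \<and> y \<in> Obj (Fib H b)
              \<and> f \<in> Hom A a b \<and> \<phi> \<in> Hom (Fib H b) (Fo (Trans H f) x) y" for a x f \<phi> b y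
    by (simp add: op_grothendieck_def)
  have hom: "u \<in> Hom ?G X Y \<longleftrightarrow> (\<exists>a x f \<phi> b y. u = ((a,x),(f,\<phi>),(b,y)) \<and> X = (a,x) \<and> Y = (b,y) \<and> u \<in> Arr ?G)" for u X Y
    by (auto simp: op_grothendieck_def hom_iff)
  have comp: "((b',y'),(g,\<psi>),(c,z)) \<cdot>\<^bsub>?G\<^esub> ((a,x),(f,\<phi>),(b,y))
     = ((a,x),(g \<cdot> f, \<psi> \<cdot>\<^bsub>Fib H c\<^esub> (Fm (Trans H g) \<phi> \<cdot>\<^bsub>Fib H c\<^esub> CompIso H g f x)),(c,z))" for a x f \<phi> b y b' y' g \<psi> c z
    by (simp add: op_grothendieck_def)
  have cl: "((a,x),(g \<cdot> f, \<psi> \<cdot>\<^bsub>Fib H c\<^esub> (Fm (Trans H g) \<phi> \<cdot>\<^bsub>Fib H c\<^esub> CompIso H g f x)),(c,z)) \<in> Arr ?G"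
    if 1: "((a,x),(f,\<phi>),(b,y)) \<in> Arr ?G" and 2: "((b,y),(g,\<psi>),(c,z)) \<in> Arr ?G" for a x f \<phi> b y g \<psi> c z
  proof -
    have c: "c \<in> Obj A" using 2 arr by blast
    interpret C: category "Fib H c" using fib_category[OF c] .
    interpret g: cat_functor "Fib H b" "Fib H c" "Trans H g" using trans_functor 2 arr by blast
    have "Fm (Trans H g) \<phi> \<in> Hom (Fib H c) (Fo (Trans H g) (Fo (Trans H f) x)) (Fo (Trans H g) y)"
      using 1 arr g.fm_hom by blast
    moreover note cmp[of f a b g c x, OF _ _ _ refl]
    ultimately show ?thesis using 1 2 unfolding arr by (blast intro: comp_hom C.comp_hom)
  qed
  show ?thesis
  proof
    show "Dom ?G f \<in> Obj ?G" "Cod ?G f \<in> Obj ?G" if "f \<in> Arr ?G" for f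
      using that by (auto simp: op_grothendieck_def)
    show "Ident ?G X \<in> Hom ?G X X" if "X \<in> Obj ?G" for X
      using that unt ident_hom by (auto simp: op_grothendieck_def hom_iff)
    show "v \<cdot>\<^bsub>?G\<^esub> u \<in> Hom ?G X Z" if "u \<in> Hom ?G X Y" "v \<in> Hom ?G Y Z" for u v X Y Z
      using that cl unfolding hom by (fastforce simp: comp)
    show "(w \<cdot>\<^bsub>?G\<^esub> v) \<cdot>\<^bsub>?G\<^esub> u = w \<cdot>\<^bsub>?G\<^esub> (v \<cdot>\<^bsub>?G\<^esub> u)"
      if u: "u \<in> Hom ?G W X" and v: "v \<in> Hom ?G X Y" and w: "w \<in> Hom ?G Y Z" for u v w W X Y Z
    proof -
      from u v w obtain a x f \<phi> b y g \<psi> c z h \<theta> d t where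
        u: "u = ((a,x),(f,\<phi>),(b,y))" "u \<in> Arr ?G" and v: "v = ((b,y),(g,\<psi>),(c,z))" "v \<in> Arr ?G"
        and w: "w = ((c,z),(h,\<theta>),(d,t))" "w \<in> Arr ?G" unfolding hom by blast
      have 1: "a \<in> Obj A" "b \<in> Obj A" "c \<in> Obj A" "d \<in> Obj A" "f \<in> Hom A a b" "g \<in> Hom A b c" "h \<in> Hom A c d"
         "\<phi> \<in> Hom (Fib H b) (Fo (Trans H f) x) y" "\<psi> \<in> Hom (Fib H c) (Fo (Trans H g) y) z" "\<theta> \<in> Hom (Fib H d) (Fo (Trans H h) z) t"
         "x \<in> Obj (Fib H a)" "y \<in> Obj (Fib H b)"
        using u v w arr by auto
      interpret C: category "Fib H c" using fib_category 1 by blast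
      interpret D: category "Fib H d" using fib_category 1 by blast
      interpret f: cat_functor "Fib H a" "Fib H b" "Trans H f" using trans_functor 1 by blast
      interpret g: cat_functor "Fib H b" "Fib H c" "Trans H g" using trans_functor 1 by blast
      interpret h: cat_functor "Fib H c" "Fib H d" "Trans H h" using trans_functor 1 by blast
      let ?h = "Fm (Trans H h)" let ?g = "Fm (Trans H g)"
      have fx: "Fo (Trans H f) x \<in> Obj (Fib H b)" using f.fo_obj 1 by blast
      have gf: "g \<cdot> f \<in> Hom A a c" and hg: "h \<cdot> g \<in> Hom A b d" using 1 comp_hom by blast+
      note k1 = cmp[OF 1(5,6,11) refl] and k2 = cmp[OF gf 1(7,11) refl] and k3 = cmp[OF 1(5) hg 1(11) refl]
        and k4 = cmp[OF 1(6,7) fx refl] and k5 = cmp[OF 1(6,7,12) refl]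
      note g1 = g.fm_hom[OF 1(8)] 
      note gk = C.comp_hom[OF k1 g1]
      note h1 = h.fm_hom[OF g1] and h2 = h.fm_hom[OF 1(9)] and h3 = h.fm_hom[OF k1]
      have hgf: "Fm (Trans H (h \<cdot> g)) \<phi> \<in> Hom (Fib H d) (Fo (Trans H (h \<cdot> g)) (Fo (Trans H f) x)) (Fo (Trans H (h \<cdot> g)) y)"
        using cat_functor.fm_hom[OF trans_functor[OF hg] 1(8)] .
      have e: "?h (\<psi> \<cdot>\<^bsub>Fib H c\<^esub> (?g \<phi> \<cdot>\<^bsub>Fib H c\<^esub> CompIso H g f x)) 
         = ?h \<psi> \<cdot>\<^bsub>Fib H d\<^esub> (?h (?g \<phi>) \<cdot>\<^bsub>Fib H d\<^esub> ?h (CompIso H g f x))"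
        using h.fm_comp[OF gk 1(9)] h.fm_comp[OF k1 g1] by simp
      let ?c = "Comp (Fib H d)"
      have hom_r: "Cod X f = Dom X g" if "f \<in> Hom X a b" "g \<in> Hom X b c" for X :: "('aa,'bb,'cc) cat_scheme" and f g a b c
        using that by (auto simp: hom_iff)
      have "?c \<theta> (?c (?h (\<psi> \<cdot>\<^bsub>Fib H c\<^esub> (?g \<phi> \<cdot>\<^bsub>Fib H c\<^esub> CompIso H g f x))) (CompIso H h (g \<cdot> f) x))
        = ?c \<theta> (?c (?h \<psi>) (?c (?h (?g \<phi>)) (?c (?h (CompIso H g f x)) (CompIso H h (g \<cdot> f) x))))"
        using e k2 h1 h2 h3 D.comp_hom[OF h3 h1] by (simp add: hom_iff)
      also have "\<dots> = ?c \<theta> (?c (?h \<psi>) (?c (?h (?g \<phi>)) (?c (CompIso H h g (Fo (Trans H f) x)) (CompIso H (h \<cdot> g) f x))))"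
        using coherence_assoc[OF 1(5,6,7,11)] by simp
      also have "\<dots> = ?c \<theta> (?c (?h \<psi>) (?c (?c (?h (?g \<phi>)) (CompIso H h g (Fo (Trans H f) x))) (CompIso H (h \<cdot> g) f x)))"
        using k3 k4 h1 by (simp add: hom_iff)
      also have "\<dots> = ?c \<theta> (?c (?h \<psi>) (?c (?c (CompIso H h g y) (Fm (Trans H (h \<cdot> g)) \<phi>)) (CompIso H (h \<cdot> g) f x)))"
        using cmp_nat[OF 1(6,7,8)] by simp
      also have "\<dots> = ?c (?c \<theta> (?c (?h \<psi>) (CompIso H h g y))) (?c (Fm (Trans H (h \<cdot> g)) \<phi>) (CompIso H (h \<cdot> g) f x))"
        using hgf k5 k3 h2 1(10) by (simp add: hom_iff)
      finally show ?thesis using 1 unfolding u v w comp by (simp add: hom_iff)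
    qed
    show "u \<cdot>\<^bsub>?G\<^esub> Ident ?G X = u" if "u \<in> Hom ?G X Y" for u X Y
    proof -
      from that obtain a x f \<phi> b y where
        u: "u = ((a,x),(f,\<phi>),(b,y))" "u \<in> Arr ?G" "X = (a,x)" unfolding hom by blast
      then have 1: "a \<in> Obj A" "b \<in> Obj A" "f \<in> Hom A a b" "x \<in> Obj (Fib H a)" "\<phi> \<in> Hom (Fib H b) (Fo (Trans H f) x) y"
        using arr by auto
      interpret B: category "Fib H b" using fib_category 1 by blast
      show ?thesis using 1 u coherence_unit_right[OF 1(3,4)] by (simp add: op_grothendieck_def hom_iff)
    qed
    show "Ident ?G Y \<cdot>\<^bsub>?G\<^esub> u = u" if "u \<in> Hom ?G X Y" for u X Y
    proof -
      from that obtain a x f \<phi> b y where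
        u: "u = ((a,x),(f,\<phi>),(b,y))" "u \<in> Arr ?G" "Y = (b,y)" unfolding hom by blast
      then have 1: "a \<in> Obj A" "b \<in> Obj A" "f \<in> Hom A a b" "x \<in> Obj (Fib H a)" "\<phi> \<in> Hom (Fib H b) (Fo (Trans H f) x) y" "y \<in> Obj (Fib H b)"
        using arr by auto
      interpret B: category "Fib H b" using fib_category 1 by blast
      have fx: "Fo (Trans H f) x \<in> Obj (Fib H b)" using 1(5) B.dom_obj[of \<phi>] by (simp add: hom_iff)
      note i = cmp[OF 1(3) ident_hom[OF 1(2)] 1(4) refl] unt[OF 1(2,6)] unt[OF 1(2) fx]
        cat_functor.fm_hom[OF trans_functor[OF ident_hom[OF 1(2)]] 1(5)]
      let ?c = "Comp (Fib H b)"
      have "?c (UnitIso H b y) (?c (Fm (Trans H (Ident A b)) \<phi>) (CompIso H (Ident A b) f x))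
        = ?c (?c (UnitIso H b y) (Fm (Trans H (Ident A b)) \<phi>)) (CompIso H (Ident A b) f x)"
        using i(1,2,4) by (simp add: hom_iff)
      also have "\<dots> = ?c \<phi> (?c (UnitIso H b (Fo (Trans H f) x)) (CompIso H (Ident A b) f x))"
        unfolding unit_nat[OF 1(2,5)] using i(1,3) 1(5) by (simp add: hom_iff)
      also have "\<dots> = \<phi>" using coherence_unit_left[OF 1(3,4)] 1 by (simp add: hom_iff)
      finally show ?thesis using 1 u by (simp add: op_grothendieck_def hom_iff)
    qed
  qed
qed

lemma op_grothendieck_proj_functor: "cat_functor (op_grothendieck A H) A op_grothendieck_proj"
proof -
  interpret G: category "op_grothendieck A H" by (rule category_op_grothendieck)
  show ?thesis by unfold_locales
    (auto simp: op_grothendieck_def op_grothendieck_proj_def hom_iff)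
qed
end

context category begin
lemma slice_arr: "(f, h, g) \<in> Arr (slice C b) \<longleftrightarrow> f \<in> Arr C \<and> Cod C f = b \<and> g \<in> Arr C \<and> Cod C g = b
    \<and> h \<in> Arr C \<and> Dom C h = Dom C f \<and> Cod C h = Dom C g \<and> f = g \<cdot> h"
  by (auto simp: slice_def Hom_def)

lemma category_slice: "category (slice C b)"
proof
  let ?S = "slice C b"
  have hom: "u \<in> Hom ?S X Y \<longleftrightarrow> (\<exists>h. u = (X, h, Y) \<and> (X, h, Y) \<in> Arr ?S)" for u X Y
    by (auto simp: slice_def hom_iff)
  have comp: "(g', k, l) \<cdot>\<^bsub>?S\<^esub> (f, h, g) = (f, k \<cdot> h, l)" for g' k l f h g
    by (simp add: slice_def)
  show "Dom ?S u \<in> Obj ?S" "Cod ?S u \<in> Obj ?S" if "u \<in> Arr ?S" for u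
    using that by (auto simp: slice_def)
  show "Ident ?S X \<in> Hom ?S X X" if "X \<in> Obj ?S" for X
    using that by (auto simp: slice_def Hom_def)
  show "v \<cdot>\<^bsub>?S\<^esub> u \<in> Hom ?S X Z" if "u \<in> Hom ?S X Y" "v \<in> Hom ?S Y Z" for u v X Y Z
  proof -
    from that obtain a b where u: "u = (X, a, Y)" "v = (Y, b, Z)" and
      1: "(X, a, Y) \<in> Arr ?S" "(Y, b, Z) \<in> Arr ?S" unfolding hom by blast
    have "(Z \<cdot> b) \<cdot> a = Z \<cdot> (b \<cdot> a)"
      using 1 unfolding slice_arr by (intro comp_assoc') metis+
    moreover have "b \<cdot> a \<in> Arr C" "Dom C (b \<cdot> a) = Dom C a" "Cod C (b \<cdot> a) = Cod C b"
      using 1 unfolding slice_arr by (metis comp_arr)+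
    ultimately have "(X, b \<cdot> a, Z) \<in> Arr ?S"
      using 1 unfolding slice_arr by metis
    then show ?thesis unfolding u comp hom by blast
  qed
  show "(w \<cdot>\<^bsub>?S\<^esub> v) \<cdot>\<^bsub>?S\<^esub> u = w \<cdot>\<^bsub>?S\<^esub> (v \<cdot>\<^bsub>?S\<^esub> u)"
    if "u \<in> Hom ?S W X" "v \<in> Hom ?S X Y" "w \<in> Hom ?S Y Z" for u v w W X Y Z
  proof -
    from that obtain a b c where "u = (W, a, X)" "v = (X, b, Y)" "w = (Y, c, Z)" and
      1: "(W, a, X) \<in> Arr ?S" "(X, b, Y) \<in> Arr ?S" "(Y, c, Z) \<in> Arr ?S"
      unfolding hom by blast
    moreover have "(c \<cdot> b) \<cdot> a = c \<cdot> (b \<cdot> a)"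
      using 1 unfolding slice_arr by (intro comp_assoc') metis+
    ultimately show ?thesis by (simp add: comp)
  qed
  show "u \<cdot>\<^bsub>?S\<^esub> Ident ?S X = u" "Ident ?S Y \<cdot>\<^bsub>?S\<^esub> u = u" if "u \<in> Hom ?S X Y" for u X Y
  proof -
    from that obtain a where "u = (X, a, Y)" and 1: "(X, a, Y) \<in> Arr ?S"
      unfolding hom by blast
    moreover have "a \<cdot> Ident C (Dom C X) = a" "Ident C (Dom C Y) \<cdot> a = a"
      using 1 unfolding slice_arr by (intro ident_right' ident_left'; metis)+
    moreover have "Ident ?S Z = (Z, Ident C (Dom C Z), Z)" for Z by (simp add: slice_def)
    ultimately show "u \<cdot>\<^bsub>?S\<^esub> Ident ?S X = u" "Ident ?S Y \<cdot>\<^bsub>?S\<^esub> u = u" by (simp_all add: comp)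
  qed
qed

lemma slice_push_functor:
  assumes "p \<in> Hom C a b"
  shows "cat_functor (slice C a) (slice C b) (slice_push C p)"
proof -
  interpret S: category "slice C a" by (rule category_slice)
  interpret T: category "slice C b" by (rule category_slice)
  have p: "p \<in> Arr C" "Dom C p = a" "Cod C p = b" using assms by (auto simp: hom_iff)
  have hom: "u \<in> Hom (slice C b) X Y \<longleftrightarrow> (\<exists>h. u = (X, h, Y) \<and> (X, h, Y) \<in> Arr (slice C b))" for u X Y b
    by (auto simp: slice_def hom_iff)
  have fo: "Fo (slice_push C p) x = p \<cdot> x" and fm: "Fm (slice_push C p) (x, h, y) = (p \<cdot> x, h, p \<cdot> y)" for x h y
    by (simp_all add: slice_push_def)
  have comp: "Comp (slice C b) (g', k, l) (f, h, g) = (f, k \<cdot> h, l)" for g' k l f h g b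
    by (simp add: slice_def)
  show ?thesis
  proof
    show "Fo (slice_push C p) x \<in> Obj (slice C b)" if "x \<in> Obj (slice C a)" for x
      using that p by (simp add: slice_def fo)
    show "Fm (slice_push C p) (Ident (slice C a) x) = Ident (slice C b) (Fo (slice_push C p) x)"
      if "x \<in> Obj (slice C a)" for x
      using that p by (simp add: slice_def slice_push_def)
    show "Fm (slice_push C p) u \<in> Hom (slice C b) (Fo (slice_push C p) x) (Fo (slice_push C p) y)"
      if "u \<in> Hom (slice C a) x y" for u x y
    proof -
      from that obtain h where u: "u = (x, h, y)" and 1: "(x, h, y) \<in> Arr (slice C a)"
        unfolding hom by blast
      have "p \<cdot> x = (p \<cdot> y) \<cdot> h" using 1 p unfolding slice_arr by (metis comp_assoc')
      then have "(p \<cdot> x, h, p \<cdot> y) \<in> Arr (slice C b)"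
        using 1 p unfolding slice_arr by (metis comp_arr)
      then show ?thesis unfolding u fo fm hom by blast
    qed
    show "Fm (slice_push C p) (v \<cdot>\<^bsub>slice C a\<^esub> u) = Fm (slice_push C p) v \<cdot>\<^bsub>slice C b\<^esub> Fm (slice_push C p) u"
      if "u \<in> Hom (slice C a) x y" "v \<in> Hom (slice C a) y z" for u v x y z
      using that unfolding hom by (auto simp: comp fm)
  qed
qed
end


lemma category_em_category:
  assumes "cat_functor C C T"
  shows "category (em_category C T \<eta> \<mu>)"
proof -
  interpret T: cat_functor C C T by fact
  let ?E = "em_category C T \<eta> \<mu>" and ?A = "em_algebras C T \<eta> \<mu>"
  have arr: "(X, h, Y) \<in> Arr ?E \<longleftrightarrow> X \<in> ?A \<and> Y \<in> ?A \<and> h \<in> Hom C (fst X) (fst Y)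
      \<and> h \<cdot>\<^bsub>C\<^esub> snd X = snd Y \<cdot>\<^bsub>C\<^esub> Fm T h" for X h Y
    by (auto simp: em_category_def)
  have hom: "u \<in> Hom ?E X Y \<longleftrightarrow> (\<exists>h. u = (X, h, Y) \<and> (X, h, Y) \<in> Arr ?E)" for u X Y
    by (auto simp: em_category_def Hom_def)
  have comp: "(B', k, D) \<cdot>\<^bsub>?E\<^esub> (A, h, B) = (A, k \<cdot>\<^bsub>C\<^esub> h, D)" for A h B B' k D
    by (simp add: em_category_def)
  have ident: "Ident ?E X = (X, Ident C (fst X), X)" for X
    by (simp add: em_category_def split_beta)
  have alg: "fst X \<in> Obj C" "snd X \<in> Hom C (Fo T (fst X)) (fst X)" if "X \<in> ?A" for X
    using that by (auto simp: em_algebras_def)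
  show ?thesis
  proof
    show "Dom ?E u \<in> Obj ?E" "Cod ?E u \<in> Obj ?E" if "u \<in> Arr ?E" for u
      using that by (auto simp: em_category_def)
    show "Ident ?E X \<in> Hom ?E X X" if "X \<in> Obj ?E" for X
    proof -
      have "X \<in> ?A" using that by (simp add: em_category_def)
      with alg[OF this] show ?thesis
        unfolding ident hom arr
        by (auto simp: T.fm_ident T.dom.comp_ident_left T.dom.comp_ident_right intro: T.dom.ident_hom)
    qed
    show "v \<cdot>\<^bsub>?E\<^esub> u \<in> Hom ?E X Z" if "u \<in> Hom ?E X Y" "v \<in> Hom ?E Y Z" for u v X Y Z
    proof -
      from that obtain h k where u: "u = (X, h, Y)" "v = (Y, k, Z)"
        and 1: "(X, h, Y) \<in> Arr ?E" "(Y, k, Z) \<in> Arr ?E" unfolding hom by blast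
      from 1 have X: "X \<in> ?A" and Y: "Y \<in> ?A" and Z: "Z \<in> ?A"
        and h: "h \<in> Hom C (fst X) (fst Y)" and k: "k \<in> Hom C (fst Y) (fst Z)"
        and eh: "h \<cdot>\<^bsub>C\<^esub> snd X = snd Y \<cdot>\<^bsub>C\<^esub> Fm T h" and ek: "k \<cdot>\<^bsub>C\<^esub> snd Y = snd Z \<cdot>\<^bsub>C\<^esub> Fm T k"
        unfolding arr by auto
      note a = alg(2)[OF X] alg(2)[OF Y] alg(2)[OF Z]
      have "(k \<cdot>\<^bsub>C\<^esub> h) \<cdot>\<^bsub>C\<^esub> snd X = k \<cdot>\<^bsub>C\<^esub> (snd Y \<cdot>\<^bsub>C\<^esub> Fm T h)"
        using T.dom.comp_assoc[OF a(1) h k] eh by simp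
      also have "\<dots> = (snd Z \<cdot>\<^bsub>C\<^esub> Fm T k) \<cdot>\<^bsub>C\<^esub> Fm T h"
        using T.dom.comp_assoc[OF T.fm_hom[OF h] a(2) k] ek by simp
      also have "\<dots> = snd Z \<cdot>\<^bsub>C\<^esub> Fm T (k \<cdot>\<^bsub>C\<^esub> h)"
        using T.dom.comp_assoc[OF T.fm_hom[OF h] T.fm_hom[OF k] a(3)] T.fm_comp[OF h k] by simp
      finally show ?thesis
        using X Z T.dom.comp_hom[OF h k] unfolding u comp hom arr by blast
    qed
    show "(w \<cdot>\<^bsub>?E\<^esub> v) \<cdot>\<^bsub>?E\<^esub> u = w \<cdot>\<^bsub>?E\<^esub> (v \<cdot>\<^bsub>?E\<^esub> u)"
      if "u \<in> Hom ?E W X" "v \<in> Hom ?E X Y" "w \<in> Hom ?E Y Z" for u v w W X Y Z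
      using that unfolding hom arr by (auto simp: comp intro: T.dom.comp_assoc)
    show "u \<cdot>\<^bsub>?E\<^esub> Ident ?E X = u" "Ident ?E Y \<cdot>\<^bsub>?E\<^esub> u = u" if "u \<in> Hom ?E X Y" for u X Y
      using that unfolding hom arr ident
      by (auto simp: comp T.dom.comp_ident_left T.dom.comp_ident_right)
  qed
qed

context adjunction begin

lemma induced_functor: "cat_functor C C (comp_fctr G F)"
  by unfold_locales (auto simp: comp_fctr_def left.fm_ident right.fm_ident left.fo_obj
      left.fm_comp right.fm_comp[OF left.fm_hom left.fm_hom] intro: right.fo_obj left.fm_hom right.fm_hom)

lemma comparison_functor:
  "cat_functor D (induced_em_category C F G \<eta> \<epsilon>) (comparison D G \<epsilon>)"
proof -
  interpret E: category "induced_em_category C F G \<eta> \<epsilon>"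
    by (rule category_em_category[OF induced_functor])
  let ?E = "induced_em_category C F G \<eta> \<epsilon>" and ?K = "comparison D G \<epsilon>"
  have eps: "\<epsilon> y \<in> Hom D (Fo F (Fo G y)) y" if "y \<in> Obj D" for y
    using counit that by (auto simp: nat_trans_def comp_fctr_def id_fctr_def)
  have nat: "\<epsilon> z \<cdot>\<^bsub>D\<^esub> Fm F (Fm G g) = g \<cdot>\<^bsub>D\<^esub> \<epsilon> y" if "g \<in> Hom D y z" for g y z
    using counit that by (auto simp: nat_trans_def comp_fctr_def id_fctr_def Hom_def)
  have gnat: "Fm G (\<epsilon> z) \<cdot>\<^bsub>C\<^esub> Fm G (Fm F (Fm G g)) = Fm G g \<cdot>\<^bsub>C\<^esub> Fm G (\<epsilon> y)"
    if g: "g \<in> Hom D y z" for g y z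
  proof -
    have y: "y \<in> Obj D" and z: "z \<in> Obj D"
      using g left.cod.dom_obj left.cod.cod_obj by (auto simp: Hom_def)
    show ?thesis
      using right.fm_comp[OF left.fm_hom[OF right.fm_hom[OF g]] eps[OF z]]
        right.fm_comp[OF eps[OF y] g] nat[OF g] by simp
  qed
  have alg: "(Fo G y, Fm G (\<epsilon> y)) \<in> em_algebras C (comp_fctr G F) \<eta> (induced_mult F G \<epsilon>)"
    if y: "y \<in> Obj D" for y
    using right.fo_obj[OF y] right.fm_hom[OF eps[OF y]] triangle_right[OF y] gnat[OF eps[OF y]]
    by (auto simp: em_algebras_def comp_fctr_def induced_mult_def)
  show ?thesis
  proof
    show "Fo ?K y \<in> Obj ?E" if "y \<in> Obj D" for y
      using alg[OF that] by (simp add: comparison_def em_category_def)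
    show "Fm ?K g \<in> Hom ?E (Fo ?K y) (Fo ?K z)" if g: "g \<in> Hom D y z" for g y z
    proof -
      have y: "y \<in> Obj D" and z: "z \<in> Obj D" and d: "Dom D g = y" "Cod D g = z"
        using g left.cod.dom_obj left.cod.cod_obj by (auto simp: Hom_def)
      show ?thesis
        using alg[OF y] alg[OF z] right.fm_hom[OF g] gnat[OF g]
        by (subst Hom_def) (simp add: comparison_def em_category_def d comp_fctr_def)
    qed
    show "Fm ?K (Ident D y) = Ident ?E (Fo ?K y)" if "y \<in> Obj D" for y
      using that left.cod.ident_hom[OF that]
      by (simp add: comparison_def em_category_def right.fm_ident Hom_def)
    show "Fm ?K (h \<cdot>\<^bsub>D\<^esub> g) = Fm ?K h \<cdot>\<^bsub>?E\<^esub> Fm ?K g"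
      if "g \<in> Hom D x y" "h \<in> Hom D y z" for g h x y z
      using that left.cod.comp_hom[OF that] right.fm_comp[OF that]
      by (simp add: comparison_def em_category_def Hom_def)
  qed
qed

end

lemma lax_comma_grothendieck_arr:
  "((x, f), (p, (f', (h, \<pi>), g')), (y, g)) \<in> Arr (op_grothendieck A (lax_comma_pseudofun A))
    \<longleftrightarrow> x \<in> Obj A \<and> y \<in> Obj A \<and> f \<in> Arr A \<and> Cod A f = x \<and> g \<in> Arr A \<and> Cod A g = y
      \<and> p \<in> Hom A x y \<and> h \<in> Hom A (Dom A f) (Dom A g)
      \<and> \<pi> \<in> Cells A (p \<cdot>\<^bsub>A\<^esub> f) (g \<cdot>\<^bsub>A\<^esub> h) \<and> f' = p \<cdot>\<^bsub>A\<^esub> f \<and> g' = g"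
  if "two_category A"
proof -
  interpret two_category A by fact
  show ?thesis
    by (auto simp: op_grothendieck_def lax_comma_pseudofun_def lax_comma_def lax_comma_push_def Hom_def)
qed

lemma isomorphic_one_cat:
  assumes "isomorphic_cats C one_cat"
  shows "\<exists>!x. x \<in> Obj C" and "\<exists>!f. f \<in> Arr C"
proof -
  from assms obtain F G where FG: "cat_functor C one_cat F" "cat_functor one_cat C G"
    and ob: "\<forall>x \<in> Obj C. Fo G (Fo F x) = x" and ar: "\<forall>f \<in> Arr C. Fm G (Fm F f) = f"
    unfolding isomorphic_cats_def by blast
  have "Fo G () \<in> Obj C" "Fm G () \<in> Arr C"
    using cat_functor.fo_obj[OF FG(2), of "()"] cat_functor.fm_hom[OF FG(2), of "()" "()" "()"]
    by (auto simp: one_cat_def Hom_def)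
  with ob ar show "\<exists>!x. x \<in> Obj C" "\<exists>!f. f \<in> Arr C" by (metis (full_types) old.unit.exhaust)+
qed

lemma isomorphic_one_cat_iff:
  assumes "category C"
  shows "isomorphic_cats C one_cat \<longleftrightarrow> (\<exists>!x. x \<in> Obj C) \<and> (\<exists>!f. f \<in> Arr C)"
proof (intro iffI conjI)
  assume "(\<exists>!x. x \<in> Obj C) \<and> (\<exists>!f. f \<in> Arr C)"
  then obtain x f where x: "\<And>y. y \<in> Obj C \<longleftrightarrow> y = x" and f: "\<And>g. g \<in> Arr C \<longleftrightarrow> g = f" by blast
  interpret category C by fact
  have 1: "Dom C f = x" "Cod C f = x" "Ident C x = f" "Comp C f f = f"
    using x f dom_cod_obj[of f] ident_arr[of x] comp_arr[of f f] by auto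
  interpret one: category one_cat by unfold_locales (auto simp: one_cat_def Hom_def)
  show "isomorphic_cats C one_cat"
    unfolding isomorphic_cats_def
    by (rule exI[of _ "\<lparr>Fo = \<lambda>_. (), Fm = \<lambda>_. ()\<rparr>"], rule exI[of _ "\<lparr>Fo = \<lambda>_. x, Fm = \<lambda>_. f\<rparr>"],
        intro conjI; (unfold_locales)?)
      (auto simp: x f 1 one_cat_def Hom_def)
qed (use isomorphic_one_cat in blast)+


end

theory Submission
  imports Defs
begin

text \<open>
  The objects \<open>0 \<rightarrow> x\<close> of the op-Grothendieck construction play the role of discrete objects: because there is
  exactly one arrow and one cell from \<open>0\<close> to anything, every arrow \<open>x \<rightarrow> y\<close> of the base lifts uniquely to an
  arrow from \<open>0 \<rightarrow> x\<close> to any given object over \<open>y\<close>. Thus the base is a full coreflective subcategory of the total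
  category, with the projection \<open>U\<close> as coreflector. Strictness of \<open>0\<close> adds that every object with an arrow to
  a discrete one is itself discrete.

  These two properties of a functor \<open>U : E \<rightarrow> A\<close> suffice for the preservation of effective descent morphisms (locale
  \<open>discrete_objects\<close>). Let \<open>q : X \<rightarrow> Y\<close> be an effective descent morphism of \<open>E\<close>. The slices of \<open>A\<close> over \<open>U X\<close>
  and \<open>U Y\<close> are equivalent to the full coreflective subcategories of the slices of \<open>E\<close> over \<open>X\<close> and \<open>Y\<close> on the arrows with discrete source.
  Composition with \<open>q\<close> does not change sources and restricts to composition with \<open>U q\<close>. Pulling back along \<open>q\<close>
  also restricts, because the pullback of an arrow with discrete source has a source that maps to a
  discrete object (\<open>slice_lift_restrict\<close>).

  It remains to see that monadicity restricts (locale \<open>coreflective_restriction\<close>). The comparison functor of the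
  restricted adjunction is fully faithful since the original one is. An algebra in the subcategory is the algebra of
  some object \<open>d\<close> of the slice over \<open>Y\<close>; this \<open>d\<close> is the coequalizer of the canonical pair of arrows built from the
  algebra, whose objects lie in the coreflective subcategory, and such a subcategory is closed under colimits.
  Hence \<open>d\<close> lies in it as well (\<open>restricts_descent\<close>).

  Right adjoints and their monads are determined up to isomorphism only, which makes a direct comparison of
  Eilenberg-Moore categories awkward. The argument therefore runs through the predicate \<open>monadic_left\<close>, which expresses the
  monadicity of the right adjoint by means of the left adjoint alone;
  \<open>effective_descent_iff_monadic_left\<close> relates it to effective descent.
\<close>

section \<open>Composition and isomorphisms\<close>

lemma (in category) comp_eq_extend:
  assumes "g \<cdot> f = g' \<cdot> f'" "f \<in> Hom C x y" "g \<in> Hom C y z" "f' \<in> Hom C x y'" "g' \<in> Hom C y' z"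
    "t \<in> Hom C w x"
  shows "g \<cdot> (f \<cdot> t) = g' \<cdot> (f' \<cdot> t)"
  unfolding comp_assoc[OF assms(6,2,3), symmetric] comp_assoc[OF assms(6,4,5), symmetric] assms(1) ..

lemma (in category) comp_ident_extend:
  assumes "g \<cdot> f = Ident C x" "f \<in> Hom C x y" "g \<in> Hom C y x" "t \<in> Hom C w x"
  shows "g \<cdot> (f \<cdot> t) = t"
  unfolding comp_assoc[OF assms(4,2,3), symmetric] assms(1) by (rule comp_ident_left[OF assms(4)])

lemma (in category) is_isoE:
  assumes "is_iso C f" "f \<in> Hom C x y"
  obtains g where "g \<in> Hom C y x" "g \<cdot> f = Ident C x" "f \<cdot> g = Ident C y"
  using assms by (auto simp: is_iso_def hom_iff)

lemma (in category) is_isoI: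
  assumes "f \<in> Hom C x y" "g \<in> Hom C y x" "g \<cdot> f = Ident C x" "f \<cdot> g = Ident C y"
  shows "is_iso C f"
  using assms by (auto simp: is_iso_def hom_iff)

context cat_functor begin

lemmas [simp] = fo_obj fm_ident

lemma fm_arr [simp]:
  assumes "f \<in> Arr C"
  shows "Fm F f \<in> Arr D" "Dom D (Fm F f) = Fo F (Dom C f)" "Cod D (Fm F f) = Fo F (Cod C f)"
  using fm_hom[of f "Dom C f" "Cod C f"] assms by (auto simp: hom_iff)

end

section \<open>Equivalences of categories\<close>

definition fully_faithful :: "('o1, 'm1, 'z1) cat_scheme \<Rightarrow> ('o2, 'm2, 'z2) cat_scheme
    \<Rightarrow> ('o1, 'm1, 'o2, 'm2) fctr \<Rightarrow> bool" where
  "fully_faithful C D F \<longleftrightarrow> (\<forall>x \<in> Obj C. \<forall>y \<in> Obj C. \<forall>h \<in> Hom D (Fo F x) (Fo F y).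
     \<exists>!g. g \<in> Hom C x y \<and> Fm F g = h)"

definition essentially_surjective :: "('o1, 'm1, 'z1) cat_scheme \<Rightarrow> ('o2, 'm2, 'z2) cat_scheme
    \<Rightarrow> ('o1, 'm1, 'o2, 'm2) fctr \<Rightarrow> bool" where
  "essentially_surjective C D F \<longleftrightarrow> (\<forall>d \<in> Obj D. \<exists>c \<in> Obj C. isomorphic_objs D (Fo F c) d)"

lemma fully_faithfulE:
  assumes "fully_faithful C D F" "x \<in> Obj C" "y \<in> Obj C" "h \<in> Hom D (Fo F x) (Fo F y)"
  obtains g where "g \<in> Hom C x y" "Fm F g = h"
  using assms unfolding fully_faithful_def by metis

lemma fully_faithful_cancel:
  assumes "fully_faithful C D F" "cat_functor C D F" "g \<in> Hom C x y" "g' \<in> Hom C x y" "Fm F g = Fm F g'"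
  shows "g = g'"
proof -
  interpret cat_functor C D F by fact
  have "x \<in> Obj C" "y \<in> Obj C" using assms by (auto simp: hom_iff)
  then show ?thesis using assms fm_hom unfolding fully_faithful_def by metis
qed

text \<open>
  Naturality of the unit makes \<open>F\<close> faithful, and naturality of the counit makes the inverse functor \<open>G\<close> faithful.
  The latter gives fullness: the arrow built from \<open>h\<close> by means of the unit has an image under \<open>F\<close> that agrees with \<open>h\<close>
  after applying \<open>G\<close>.
\<close>

lemma equivalence_fully_faithful:
  assumes "cat_equivalence C D F"
  shows "fully_faithful C D F"
proof -
  obtain G \<alpha> \<beta> where F: "cat_functor C D F" and G: "cat_functor D C G"
    and \<alpha>: "nat_iso C C id_fctr (comp_fctr G F) \<alpha>" and \<beta>: "nat_iso D D (comp_fctr F G) id_fctr \<beta>"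
    using assms unfolding cat_equivalence_def by blast
  interpret F: cat_functor C D F by fact
  interpret G: cat_functor D C G by fact
  have al: "\<alpha> x \<in> Hom C x (Fo G (Fo F x))" "is_iso C (\<alpha> x)" if "x \<in> Obj C" for x
    using \<alpha> that by (auto simp: nat_iso_def nat_trans_def id_fctr_def comp_fctr_def)
  have al_nat: "\<alpha> y \<cdot>\<^bsub>C\<^esub> f = Fm G (Fm F f) \<cdot>\<^bsub>C\<^esub> \<alpha> x" if "f \<in> Hom C x y" for f x y
    using \<alpha> that by (auto simp: nat_iso_def nat_trans_def id_fctr_def comp_fctr_def hom_iff)
  have be: "\<beta> x \<in> Hom D (Fo F (Fo G x)) x" "is_iso D (\<beta> x)" if "x \<in> Obj D" for x
    using \<beta> that by (auto simp: nat_iso_def nat_trans_def id_fctr_def comp_fctr_def)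
  have be_nat: "\<beta> y \<cdot>\<^bsub>D\<^esub> Fm F (Fm G f) = f \<cdot>\<^bsub>D\<^esub> \<beta> x" if "f \<in> Hom D x y" for f x y
    using \<beta> that by (auto simp: nat_iso_def nat_trans_def id_fctr_def comp_fctr_def hom_iff)
  have F_inj: "g = g'" if g: "g \<in> Hom C x y" "g' \<in> Hom C x y" and e: "Fm F g = Fm F g'" for g g' x y
  proof -
    have y: "y \<in> Obj C" using g by (auto simp: hom_iff)
    obtain k where k: "k \<in> Hom C (Fo G (Fo F y)) y" "k \<cdot>\<^bsub>C\<^esub> \<alpha> y = Ident C y"
      using F.dom.is_isoE[OF al(2,1)[OF y]] by metis
    have "k \<cdot>\<^bsub>C\<^esub> (\<alpha> y \<cdot>\<^bsub>C\<^esub> g) = k \<cdot>\<^bsub>C\<^esub> (\<alpha> y \<cdot>\<^bsub>C\<^esub> g')"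
      unfolding al_nat[OF g(1)] al_nat[OF g(2)] e ..
    then show ?thesis
      using F.dom.comp_ident_extend[OF k(2) al(1)[OF y] k(1) g(1)]
        F.dom.comp_ident_extend[OF k(2) al(1)[OF y] k(1) g(2)] by simp
  qed
  have G_inj: "h = h'" if h: "h \<in> Hom D x y" "h' \<in> Hom D x y" and e: "Fm G h = Fm G h'" for h h' x y
  proof -
    have x: "x \<in> Obj D" using h by (auto simp: hom_iff)
    obtain k where k: "k \<in> Hom D x (Fo F (Fo G x))" "\<beta> x \<cdot>\<^bsub>D\<^esub> k = Ident D x"
      using F.cod.is_isoE[OF be(2,1)[OF x]] by metis
    have "(h \<cdot>\<^bsub>D\<^esub> \<beta> x) \<cdot>\<^bsub>D\<^esub> k = (h' \<cdot>\<^bsub>D\<^esub> \<beta> x) \<cdot>\<^bsub>D\<^esub> k"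
      unfolding be_nat[OF h(1), symmetric] be_nat[OF h(2), symmetric] e ..
    then show ?thesis using k h be(1)[OF x] by (simp add: hom_iff)
  qed
  show ?thesis unfolding fully_faithful_def
  proof (intro ballI ex_ex1I)
    fix x y h assume x: "x \<in> Obj C" and y: "y \<in> Obj C" and h: "h \<in> Hom D (Fo F x) (Fo F y)"
    obtain k where k: "k \<in> Hom C (Fo G (Fo F y)) y" "\<alpha> y \<cdot>\<^bsub>C\<^esub> k = Ident C (Fo G (Fo F y))"
      using F.dom.is_isoE[OF al(2,1)[OF y]] by metis
    obtain l where l: "l \<in> Hom C (Fo G (Fo F x)) x" "\<alpha> x \<cdot>\<^bsub>C\<^esub> l = Ident C (Fo G (Fo F x))"
      using F.dom.is_isoE[OF al(2,1)[OF x]] by metis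
    define g where "g = k \<cdot>\<^bsub>C\<^esub> (Fm G h \<cdot>\<^bsub>C\<^esub> \<alpha> x)"
    have Gh: "Fm G h \<in> Hom C (Fo G (Fo F x)) (Fo G (Fo F y))" by (rule G.fm_hom[OF h])
    have g: "g \<in> Hom C x y"
      unfolding g_def by (rule F.dom.comp_hom[OF F.dom.comp_hom[OF al(1)[OF x] Gh] k(1)])
    have "Fm G (Fm F g) \<cdot>\<^bsub>C\<^esub> \<alpha> x = \<alpha> y \<cdot>\<^bsub>C\<^esub> g" by (rule al_nat[OF g, symmetric])
    also have "\<dots> = Fm G h \<cdot>\<^bsub>C\<^esub> \<alpha> x"
      unfolding g_def
      by (rule F.dom.comp_ident_extend[OF k(2,1) al(1)[OF y] F.dom.comp_hom[OF al(1)[OF x] Gh]])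
    finally have "(Fm G (Fm F g) \<cdot>\<^bsub>C\<^esub> \<alpha> x) \<cdot>\<^bsub>C\<^esub> l = (Fm G h \<cdot>\<^bsub>C\<^esub> \<alpha> x) \<cdot>\<^bsub>C\<^esub> l" by simp
    then have "Fm G (Fm F g) = Fm G h"
      using l g h al(1)[OF x] by (simp add: hom_iff)
    then have "Fm F g = h" using G_inj F.fm_hom[OF g] h by blast
    with g show "\<exists>g. g \<in> Hom C x y \<and> Fm F g = h" by blast
  qed (use F_inj in blast)
qed

lemma equivalence_essentially_surjective:
  assumes "cat_equivalence C D F"
  shows "essentially_surjective C D F"
proof -
  obtain G \<alpha> \<beta> where F: "cat_functor C D F" and G: "cat_functor D C G"
    and \<beta>: "nat_iso D D (comp_fctr F G) id_fctr \<beta>"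
    using assms unfolding cat_equivalence_def by blast
  have "\<beta> d \<in> Hom D (Fo F (Fo G d)) d \<and> is_iso D (\<beta> d)" "Fo G d \<in> Obj C" if "d \<in> Obj D" for d
    using \<beta> that cat_functor.fo_obj[OF G that]
    by (auto simp: nat_iso_def nat_trans_def id_fctr_def comp_fctr_def)
  then show ?thesis unfolding essentially_surjective_def isomorphic_objs_def by blast
qed

lemma fully_faithful_reflects_iso:
  assumes ff: "fully_faithful C D F" and fnc: "cat_functor C D F"
    and f: "f \<in> Hom C x y" and iso: "is_iso D (Fm F f)"
  shows "is_iso C f"
proof -
  interpret F: cat_functor C D F by fact
  have x: "x \<in> Obj C" and y: "y \<in> Obj C" using f by (auto simp: hom_iff)
  obtain h where h: "h \<in> Hom D (Fo F y) (Fo F x)"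
    "h \<cdot>\<^bsub>D\<^esub> Fm F f = Ident D (Fo F x)" "Fm F f \<cdot>\<^bsub>D\<^esub> h = Ident D (Fo F y)"
    using F.cod.is_isoE[OF iso F.fm_hom[OF f]] by blast
  obtain g where g: "g \<in> Hom C y x" "Fm F g = h" using fully_faithfulE[OF ff y x h(1)] by blast
  have "g \<cdot>\<^bsub>C\<^esub> f = Ident C x"
    by (rule fully_faithful_cancel[OF ff fnc F.dom.comp_hom[OF f g(1)] F.dom.ident_hom[OF x]])
      (use g f h x in \<open>simp add: F.fm_comp[OF f g(1)]\<close>)
  moreover have "f \<cdot>\<^bsub>C\<^esub> g = Ident C y"
    by (rule fully_faithful_cancel[OF ff fnc F.dom.comp_hom[OF g(1) f] F.dom.ident_hom[OF y]])
      (use g f h y in \<open>simp add: F.fm_comp[OF g(1) f]\<close>)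
  ultimately show ?thesis by (rule F.dom.is_isoI[OF f g(1)])
qed

text \<open>
  The inverse functor picks a preimage of every object up to isomorphism and transports arrows
  along the chosen isomorphisms. Its action on arrows is well defined, functorial and natural because
  postcomposition with a chosen isomorphism is injective.
\<close>

lemma equivalenceI:
  assumes fnc: "cat_functor C D F" and ff: "fully_faithful C D F" and es: "essentially_surjective C D F"
  shows "cat_equivalence C D F"
proof -
  interpret F: cat_functor C D F by fact
  have "\<exists>c b. d \<in> Obj D \<longrightarrow> c \<in> Obj C \<and> b \<in> Hom D (Fo F c) d \<and> is_iso D b" for d
    using es unfolding essentially_surjective_def isomorphic_objs_def by blast
  then obtain g\<^sub>0 \<beta> where g0: "\<And>d. d \<in> Obj D \<Longrightarrow> g\<^sub>0 d \<in> Obj C"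
    and be: "\<And>d. d \<in> Obj D \<Longrightarrow> \<beta> d \<in> Hom D (Fo F (g\<^sub>0 d)) d"
    and be_iso: "\<And>d. d \<in> Obj D \<Longrightarrow> is_iso D (\<beta> d)" by metis
  have "\<exists>b'. d \<in> Obj D \<longrightarrow> b' \<in> Hom D d (Fo F (g\<^sub>0 d)) \<and> b' \<cdot>\<^bsub>D\<^esub> \<beta> d = Ident D (Fo F (g\<^sub>0 d))
      \<and> \<beta> d \<cdot>\<^bsub>D\<^esub> b' = Ident D d" for d
    using F.cod.is_isoE[OF be_iso be] by metis
  then obtain \<gamma> where ga: "\<And>d. d \<in> Obj D \<Longrightarrow> \<gamma> d \<in> Hom D d (Fo F (g\<^sub>0 d))"
    and gb: "\<And>d. d \<in> Obj D \<Longrightarrow> \<gamma> d \<cdot>\<^bsub>D\<^esub> \<beta> d = Ident D (Fo F (g\<^sub>0 d))"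
    and bg: "\<And>d. d \<in> Obj D \<Longrightarrow> \<beta> d \<cdot>\<^bsub>D\<^esub> \<gamma> d = Ident D d" by metis
  have ga_iso: "is_iso D (\<gamma> d)" if "d \<in> Obj D" for d
    by (rule F.cod.is_isoI[OF ga[OF that] be[OF that] bg[OF that] gb[OF that]])
  have cancel: "x = x'" if eq: "\<beta> d \<cdot>\<^bsub>D\<^esub> x = \<beta> d \<cdot>\<^bsub>D\<^esub> x'" and d: "d \<in> Obj D"
    and x: "x \<in> Hom D y (Fo F (g\<^sub>0 d))" "x' \<in> Hom D y (Fo F (g\<^sub>0 d))" for x x' d y
  proof -
    have *: "\<gamma> d \<cdot>\<^bsub>D\<^esub> (\<beta> d \<cdot>\<^bsub>D\<^esub> z) = z" if z: "z \<in> Hom D y (Fo F (g\<^sub>0 d))" for z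
      by (rule F.cod.comp_ident_extend[OF gb[OF d] be[OF d] ga[OF d] z])
    show ?thesis using *[OF x(1)] *[OF x(2)] eq by metis
  qed
  have "\<exists>k. h \<in> Arr D \<longrightarrow> k \<in> Hom C (g\<^sub>0 (Dom D h)) (g\<^sub>0 (Cod D h))
      \<and> Fm F k = \<gamma> (Cod D h) \<cdot>\<^bsub>D\<^esub> (h \<cdot>\<^bsub>D\<^esub> \<beta> (Dom D h))" for h
  proof (cases "h \<in> Arr D")
    case True
    then have "\<gamma> (Cod D h) \<cdot>\<^bsub>D\<^esub> (h \<cdot>\<^bsub>D\<^esub> \<beta> (Dom D h)) \<in> Hom D (Fo F (g\<^sub>0 (Dom D h))) (Fo F (g\<^sub>0 (Cod D h)))"
      using ga[of "Cod D h"] be[of "Dom D h"] by (simp add: hom_iff)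
    from fully_faithfulE[OF ff g0 g0 this] True show ?thesis by (metis F.cod.dom_cod_obj)
  qed simp
  then obtain g\<^sub>1 where g1: "\<And>h. h \<in> Arr D \<Longrightarrow> g\<^sub>1 h \<in> Hom C (g\<^sub>0 (Dom D h)) (g\<^sub>0 (Cod D h))"
    and Fg1: "\<And>h. h \<in> Arr D \<Longrightarrow> Fm F (g\<^sub>1 h) = \<gamma> (Cod D h) \<cdot>\<^bsub>D\<^esub> (h \<cdot>\<^bsub>D\<^esub> \<beta> (Dom D h))" by metis
  define G where "G = \<lparr>Fo = g\<^sub>0, Fm = g\<^sub>1\<rparr>"
  have be_nat: "\<beta> y \<cdot>\<^bsub>D\<^esub> Fm F (g\<^sub>1 h) = h \<cdot>\<^bsub>D\<^esub> \<beta> x" if h: "h \<in> Hom D x y" for h x y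
  proof -
    have x: "x \<in> Obj D" and y: "y \<in> Obj D" using h by (auto simp: hom_iff)
    from h Fg1[of h] F.cod.comp_ident_extend[OF bg[OF y] ga[OF y] be[OF y] F.cod.comp_hom[OF be[OF x] h]]
    show ?thesis by (simp add: hom_iff)
  qed
  have G: "cat_functor D C G"
  proof
    show "Fo G d \<in> Obj C" if "d \<in> Obj D" for d using that g0 by (simp add: G_def)
    show "Fm G h \<in> Hom C (Fo G x) (Fo G y)" if "h \<in> Hom D x y" for h x y
      using that g1[of h] by (auto simp: G_def hom_iff)
    show "Fm G (Ident D x) = Ident C (Fo G x)" if x: "x \<in> Obj D" for x
    proof -
      have "Fm F (g\<^sub>1 (Ident D x)) = Fm F (Ident C (g\<^sub>0 x))"
        using x Fg1[of "Ident D x"] be[OF x] gb[OF x] g0[OF x] by (simp add: hom_iff)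
      with g1[of "Ident D x"] x show ?thesis
        using fully_faithful_cancel[OF ff fnc _ F.dom.ident_hom[OF g0[OF x]]] by (simp add: G_def)
    qed
    show "Fm G (h' \<cdot>\<^bsub>D\<^esub> h) = Fm G h' \<cdot>\<^bsub>C\<^esub> Fm G h" if h: "h \<in> Hom D x y" "h' \<in> Hom D y z" for h h' x y z
    proof -
      have hh: "h' \<cdot>\<^bsub>D\<^esub> h \<in> Hom D x z" by (rule F.cod.comp_hom[OF h])
      have ob: "x \<in> Obj D" "y \<in> Obj D" "z \<in> Obj D" using h by (auto simp: hom_iff)
      have k: "g\<^sub>1 h \<in> Hom C (g\<^sub>0 x) (g\<^sub>0 y)" "g\<^sub>1 h' \<in> Hom C (g\<^sub>0 y) (g\<^sub>0 z)" "g\<^sub>1 (h' \<cdot>\<^bsub>D\<^esub> h) \<in> Hom C (g\<^sub>0 x) (g\<^sub>0 z)"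
        using g1 h hh by (auto simp: hom_iff)
      have "\<beta> z \<cdot>\<^bsub>D\<^esub> (Fm F (g\<^sub>1 h') \<cdot>\<^bsub>D\<^esub> Fm F (g\<^sub>1 h)) = h' \<cdot>\<^bsub>D\<^esub> (\<beta> y \<cdot>\<^bsub>D\<^esub> Fm F (g\<^sub>1 h))"
        by (rule F.cod.comp_eq_extend[OF be_nat[OF h(2)] F.fm_hom[OF k(2)] be[OF ob(3)] be[OF ob(2)] h(2) F.fm_hom[OF k(1)]])
      also have "\<dots> = \<beta> z \<cdot>\<^bsub>D\<^esub> Fm F (g\<^sub>1 (h' \<cdot>\<^bsub>D\<^esub> h))"
        unfolding be_nat[OF h(1)] be_nat[OF hh] using F.cod.comp_assoc[OF be[OF ob(1)] h] by simp
      finally have "Fm F (g\<^sub>1 (h' \<cdot>\<^bsub>D\<^esub> h)) = Fm F (g\<^sub>1 h' \<cdot>\<^bsub>C\<^esub> g\<^sub>1 h)"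
        unfolding F.fm_comp[OF k(1,2)]
        by (intro cancel[OF _ ob(3) F.fm_hom[OF k(3)] F.cod.comp_hom[OF F.fm_hom[OF k(1)] F.fm_hom[OF k(2)]]]) simp
      then show ?thesis
        using fully_faithful_cancel[OF ff fnc k(3) F.dom.comp_hom[OF k(1,2)]] by (simp add: G_def)
    qed
  qed
  interpret G: cat_functor D C G by fact
  have beta: "nat_iso D D (comp_fctr F G) id_fctr \<beta>"
    using be be_iso be_nat
    by (auto simp: nat_iso_def nat_trans_def comp_fctr_def id_fctr_def G_def hom_iff)
  have "\<exists>a. c \<in> Obj C \<longrightarrow> a \<in> Hom C c (g\<^sub>0 (Fo F c)) \<and> Fm F a = \<gamma> (Fo F c)" for c
    using fully_faithfulE[OF ff _ g0 ga] F.fo_obj by metis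
  then obtain \<alpha> where al: "\<And>c. c \<in> Obj C \<Longrightarrow> \<alpha> c \<in> Hom C c (g\<^sub>0 (Fo F c))"
    and Fal: "\<And>c. c \<in> Obj C \<Longrightarrow> Fm F (\<alpha> c) = \<gamma> (Fo F c)" by metis
  have al_iso: "is_iso C (\<alpha> c)" if "c \<in> Obj C" for c
    using fully_faithful_reflects_iso[OF ff fnc al[OF that]] Fal[OF that] ga_iso that by simp
  have al_nat: "\<alpha> y \<cdot>\<^bsub>C\<^esub> f = g\<^sub>1 (Fm F f) \<cdot>\<^bsub>C\<^esub> \<alpha> x" if f: "f \<in> Hom C x y" for f x y
  proof -
    have ob: "x \<in> Obj C" "y \<in> Obj C" using f by (auto simp: hom_iff)
    have Fob: "Fo F x \<in> Obj D" "Fo F y \<in> Obj D" using ob by auto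
    have k: "g\<^sub>1 (Fm F f) \<in> Hom C (g\<^sub>0 (Fo F x)) (g\<^sub>0 (Fo F y))"
      using g1[of "Fm F f"] f by (auto simp: hom_iff)
    have Ff: "Fm F f \<in> Hom D (Fo F x) (Fo F y)" by (rule F.fm_hom[OF f])
    have "\<beta> (Fo F y) \<cdot>\<^bsub>D\<^esub> (Fm F (g\<^sub>1 (Fm F f)) \<cdot>\<^bsub>D\<^esub> \<gamma> (Fo F x)) = Fm F f \<cdot>\<^bsub>D\<^esub> (\<beta> (Fo F x) \<cdot>\<^bsub>D\<^esub> \<gamma> (Fo F x))"
      by (rule F.cod.comp_eq_extend[OF be_nat[OF Ff] F.fm_hom[OF k] be[OF Fob(2)] be[OF Fob(1)] Ff ga[OF Fob(1)]])
    also have "\<dots> = \<beta> (Fo F y) \<cdot>\<^bsub>D\<^esub> (\<gamma> (Fo F y) \<cdot>\<^bsub>D\<^esub> Fm F f)"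
      using F.cod.comp_ident_extend[OF bg[OF Fob(2)] ga[OF Fob(2)] be[OF Fob(2)] Ff] bg[OF Fob(1)] F.cod.comp_ident_right[OF Ff]
      by simp
    finally have "Fm F (g\<^sub>1 (Fm F f)) \<cdot>\<^bsub>D\<^esub> \<gamma> (Fo F x) = \<gamma> (Fo F y) \<cdot>\<^bsub>D\<^esub> Fm F f"
      by (rule cancel) (use ob k Ff ga in \<open>auto intro: F.cod.comp_hom[OF ga F.fm_hom[OF k]] F.cod.comp_hom[OF Ff ga]\<close>)
    then show ?thesis
      using fully_faithful_cancel[OF ff fnc F.dom.comp_hom[OF f al[OF ob(2)]] F.dom.comp_hom[OF al[OF ob(1)] k]]
      by (simp add: F.fm_comp[OF f al[OF ob(2)]] F.fm_comp[OF al[OF ob(1)] k] Fal ob)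
  qed
  have "nat_iso C C id_fctr (comp_fctr G F) \<alpha>"
    using al al_iso al_nat
    by (auto simp: nat_iso_def nat_trans_def comp_fctr_def id_fctr_def G_def hom_iff)
  with fnc G beta show ?thesis unfolding cat_equivalence_def by blast
qed

section \<open>Couniversal arrows and a criterion for monadicity\<close>

definition couniversal :: "('o1, 'm1, 'z1) cat_scheme \<Rightarrow> ('o2, 'm2, 'z2) cat_scheme
    \<Rightarrow> ('o1, 'm1, 'o2, 'm2) fctr \<Rightarrow> 'o2 \<Rightarrow> 'o1 \<Rightarrow> 'm2 \<Rightarrow> bool" where
  "couniversal C D F d c e \<longleftrightarrow> c \<in> Obj C \<and> d \<in> Obj D \<and> e \<in> Hom D (Fo F c) d
     \<and> (\<forall>c' \<in> Obj C. \<forall>t \<in> Hom D (Fo F c') d. \<exists>!s. s \<in> Hom C c' c \<and> e \<cdot>\<^bsub>D\<^esub> Fm F s = t)"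

text \<open>
  If \<open>e\<close> is couniversal, it suffices to test a single pair, the kernel pair of \<open>e\<close> as far as \<open>F\<close> can see
  it: any couniversal arrow \<open>e2 : F c2 \<rightarrow> F c\<close>, and \<open>F a\<close> for the unique \<open>a\<close> with \<open>e \<cdot> F a = e \<cdot> e2\<close>. Quantifying
  over all pairs avoids choosing \<open>e2\<close>.
\<close>

definition kernel_compatible :: "('o1, 'm1, 'z1) cat_scheme \<Rightarrow> ('o2, 'm2, 'z2) cat_scheme
    \<Rightarrow> ('o1, 'm1, 'o2, 'm2) fctr \<Rightarrow> 'o1 \<Rightarrow> 'm2 \<Rightarrow> 'm2 \<Rightarrow> bool" where
  "kernel_compatible C D F c e t \<longleftrightarrow> (\<forall>c' \<in> Obj C. \<forall>s \<in> Hom C c' c. \<forall>r \<in> Hom D (Fo F c') (Fo F c).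
     e \<cdot>\<^bsub>D\<^esub> Fm F s = e \<cdot>\<^bsub>D\<^esub> r \<longrightarrow> t \<cdot>\<^bsub>D\<^esub> Fm F s = t \<cdot>\<^bsub>D\<^esub> r)"

text \<open>
  For the counit \<open>e\<close> at \<open>d\<close> of an adjunction \<open>F \<stileturn> G\<close>, this says that \<open>e\<close> is the coequalizer of the
  two canonical arrows from \<open>F G F G d\<close> to \<open>F G d\<close>.
\<close>

definition quotient_arrow :: "('o1, 'm1, 'z1) cat_scheme \<Rightarrow> ('o2, 'm2, 'z2) cat_scheme
    \<Rightarrow> ('o1, 'm1, 'o2, 'm2) fctr \<Rightarrow> 'o2 \<Rightarrow> 'o1 \<Rightarrow> 'm2 \<Rightarrow> bool" where
  "quotient_arrow C D F d c e \<longleftrightarrow> (\<forall>v \<in> Obj D. \<forall>t \<in> Hom D (Fo F c) v.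
     kernel_compatible C D F c e t \<longrightarrow> (\<exists>!g. g \<in> Hom D d v \<and> g \<cdot>\<^bsub>D\<^esub> e = t))"

text \<open>
  An algebra \<open>a : G F c \<rightarrow> c\<close> for the monad of an adjunction \<open>F \<stileturn> G\<close> turns an arrow \<open>r : F c' \<rightarrow> F c\<close>,
  through its transpose \<open>c' \<rightarrow> G F c\<close>, into an arrow \<open>c' \<rightarrow> c\<close>. The operation \<open>\<alpha>\<close> is this assignment, and
  the equations say what the unit law and the associativity law of \<open>a\<close> become. Naturality in \<open>c'\<close> follows
  from them. The object \<open>c'\<close> is an argument because \<open>r\<close> determines only \<open>F c'\<close>.
\<close>

definition descent_datum :: "('o1, 'm1, 'z1) cat_scheme \<Rightarrow> ('o2, 'm2, 'z2) cat_scheme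
    \<Rightarrow> ('o1, 'm1, 'o2, 'm2) fctr \<Rightarrow> 'o1 \<Rightarrow> ('o1 \<Rightarrow> 'm2 \<Rightarrow> 'm1) \<Rightarrow> bool" where
  "descent_datum C D F c \<alpha> \<longleftrightarrow> c \<in> Obj C
     \<and> (\<forall>c' \<in> Obj C. \<forall>r \<in> Hom D (Fo F c') (Fo F c). \<alpha> c' r \<in> Hom C c' c)
     \<and> (\<forall>c' \<in> Obj C. \<forall>k \<in> Hom C c' c. \<alpha> c' (Fm F k) = k)
     \<and> (\<forall>c' \<in> Obj C. \<forall>c'' \<in> Obj C. \<forall>r \<in> Hom D (Fo F c') (Fo F c''). \<forall>s \<in> Hom D (Fo F c'') (Fo F c).
          \<alpha> c' (Fm F (\<alpha> c'' s) \<cdot>\<^bsub>D\<^esub> r) = \<alpha> c' (s \<cdot>\<^bsub>D\<^esub> r))"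

text \<open>
  The functor \<open>F\<close> has a right adjoint, and that right adjoint is monadic: the quotient condition is full
  faithfulness of the comparison functor, the condition on descent data its essential surjectivity.
  Neither a right adjoint nor a monad is chosen, so the criterion can be compared along functors.
\<close>

definition monadic_left :: "('o1, 'm1, 'z1) cat_scheme \<Rightarrow> ('o2, 'm2, 'z2) cat_scheme
    \<Rightarrow> ('o1, 'm1, 'o2, 'm2) fctr \<Rightarrow> bool" where
  "monadic_left C D F \<longleftrightarrow>
     (\<forall>d \<in> Obj D. \<exists>c e. couniversal C D F d c e \<and> quotient_arrow C D F d c e)
     \<and> (\<forall>c \<alpha>. descent_datum C D F c \<alpha> \<longrightarrow> (\<exists>d e. couniversal C D F d c e
          \<and> (\<forall>c' \<in> Obj C. \<forall>r \<in> Hom D (Fo F c') (Fo F c). e \<cdot>\<^bsub>D\<^esub> Fm F (\<alpha> c' r) = e \<cdot>\<^bsub>D\<^esub> r)))"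

lemma couniversalD:
  assumes "couniversal C D F d c e"
  shows "c \<in> Obj C" "d \<in> Obj D" "e \<in> Hom D (Fo F c) d"
  using assms by (auto simp: couniversal_def)

lemma couniversal_factor:
  assumes "couniversal C D F d c e" "c' \<in> Obj C" "t \<in> Hom D (Fo F c') d"
  obtains s where "s \<in> Hom C c' c" "e \<cdot>\<^bsub>D\<^esub> Fm F s = t"
  using assms unfolding couniversal_def by metis

lemma descent_datumD:
  assumes "descent_datum C D F c \<alpha>"
  shows "c \<in> Obj C"
    and "\<lbrakk>c' \<in> Obj C; r \<in> Hom D (Fo F c') (Fo F c)\<rbrakk> \<Longrightarrow> \<alpha> c' r \<in> Hom C c' c"
    and "\<lbrakk>c' \<in> Obj C; k \<in> Hom C c' c\<rbrakk> \<Longrightarrow> \<alpha> c' (Fm F k) = k"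
    and "\<lbrakk>c' \<in> Obj C; c'' \<in> Obj C; r \<in> Hom D (Fo F c') (Fo F c''); s \<in> Hom D (Fo F c'') (Fo F c)\<rbrakk>
      \<Longrightarrow> \<alpha> c' (Fm F (\<alpha> c'' s) \<cdot>\<^bsub>D\<^esub> r) = \<alpha> c' (s \<cdot>\<^bsub>D\<^esub> r)"
  using assms unfolding descent_datum_def by blast+

lemma (in category) hom_obj:
  assumes "f \<in> Hom C x y"
  shows "x \<in> Obj C" "y \<in> Obj C"
  using assms by (auto simp: hom_iff)

context cat_functor begin

lemma couniversal_cancel:
  assumes "couniversal C D F d c e" "s \<in> Hom C c' c" "s' \<in> Hom C c' c"
    "e \<cdot>\<^bsub>D\<^esub> Fm F s = e \<cdot>\<^bsub>D\<^esub> Fm F s'"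
  shows "s = s'"
proof -
  have "c' \<in> Obj C" by (rule dom.hom_obj[OF assms(2)])
  moreover have "e \<cdot>\<^bsub>D\<^esub> Fm F s \<in> Hom D (Fo F c') d"
    using assms(1,2) by (auto simp: couniversal_def intro: cod.comp_hom fm_hom)
  ultimately show ?thesis using assms unfolding couniversal_def by metis
qed

lemma couniversalI:
  assumes "c \<in> Obj C" "d \<in> Obj D" "e \<in> Hom D (Fo F c) d"
    and "\<And>c' t. \<lbrakk>c' \<in> Obj C; t \<in> Hom D (Fo F c') d\<rbrakk> \<Longrightarrow> \<exists>s. s \<in> Hom C c' c \<and> e \<cdot>\<^bsub>D\<^esub> Fm F s = t"
    and "\<And>c' s s'. \<lbrakk>s \<in> Hom C c' c; s' \<in> Hom C c' c; e \<cdot>\<^bsub>D\<^esub> Fm F s = e \<cdot>\<^bsub>D\<^esub> Fm F s'\<rbrakk> \<Longrightarrow> s = s'"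
  shows "couniversal C D F d c e"
  unfolding couniversal_def using assms by blast

lemma couniversal_precomp_iso:
  assumes e: "couniversal C D F d c e" and i: "i \<in> Hom C c' c" and j: "j \<in> Hom C c c'"
    and ij: "i \<cdot>\<^bsub>C\<^esub> j = Ident C c" and ji: "j \<cdot>\<^bsub>C\<^esub> i = Ident C c'"
  shows "couniversal C D F d c' (e \<cdot>\<^bsub>D\<^esub> Fm F i)"
proof (rule couniversalI)
  note e' = couniversalD[OF e]
  have comp: "(e \<cdot>\<^bsub>D\<^esub> Fm F i) \<cdot>\<^bsub>D\<^esub> Fm F s = e \<cdot>\<^bsub>D\<^esub> Fm F (i \<cdot>\<^bsub>C\<^esub> s)" if "s \<in> Hom C b c'" for s b
    using cod.comp_assoc[OF fm_hom[OF that] fm_hom[OF i] e'(3)] fm_comp[OF that i] by simp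
  show "c' \<in> Obj C" by (rule dom.hom_obj[OF i])
  show "d \<in> Obj D" by (rule e')
  show "e \<cdot>\<^bsub>D\<^esub> Fm F i \<in> Hom D (Fo F c') d" by (rule cod.comp_hom[OF fm_hom[OF i] e'(3)])
  show "\<exists>s. s \<in> Hom C b c' \<and> (e \<cdot>\<^bsub>D\<^esub> Fm F i) \<cdot>\<^bsub>D\<^esub> Fm F s = t"
    if bt: "b \<in> Obj C" "t \<in> Hom D (Fo F b) d" for b t
  proof -
    obtain s where s: "s \<in> Hom C b c" "e \<cdot>\<^bsub>D\<^esub> Fm F s = t" using couniversal_factor[OF e bt] by blast
    have "(e \<cdot>\<^bsub>D\<^esub> Fm F i) \<cdot>\<^bsub>D\<^esub> Fm F (j \<cdot>\<^bsub>C\<^esub> s) = t"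
      unfolding comp[OF dom.comp_hom[OF s(1) j]] dom.comp_ident_extend[OF ij j i s(1)] by (rule s)
    then show ?thesis using dom.comp_hom[OF s(1) j] by blast
  qed
  show "s = s'" if s: "s \<in> Hom C b c'" "s' \<in> Hom C b c'"
    and eq: "(e \<cdot>\<^bsub>D\<^esub> Fm F i) \<cdot>\<^bsub>D\<^esub> Fm F s = (e \<cdot>\<^bsub>D\<^esub> Fm F i) \<cdot>\<^bsub>D\<^esub> Fm F s'" for b s s'
  proof -
    have "i \<cdot>\<^bsub>C\<^esub> s = i \<cdot>\<^bsub>C\<^esub> s'"
      using couniversal_cancel[OF e dom.comp_hom[OF s(1) i] dom.comp_hom[OF s(2) i]] eq
      by (simp only: comp[OF s(1)] comp[OF s(2)])
    then show ?thesis
      using dom.comp_ident_extend[OF ji i j s(1)] dom.comp_ident_extend[OF ji i j s(2)] by metis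
  qed
qed

lemma couniversal_unique:
  assumes e: "couniversal C D F d c e" and e': "couniversal C D F d c' e'"
  obtains k l where "k \<in> Hom C c c'" "l \<in> Hom C c' c" "e' \<cdot>\<^bsub>D\<^esub> Fm F k = e" "e \<cdot>\<^bsub>D\<^esub> Fm F l = e'"
    "l \<cdot>\<^bsub>C\<^esub> k = Ident C c" "k \<cdot>\<^bsub>C\<^esub> l = Ident C c'"
proof -
  note E = couniversalD[OF e] and E' = couniversalD[OF e']
  obtain k where k: "k \<in> Hom C c c'" "e' \<cdot>\<^bsub>D\<^esub> Fm F k = e" using couniversal_factor[OF e' E(1,3)] .
  obtain l where l: "l \<in> Hom C c' c" "e \<cdot>\<^bsub>D\<^esub> Fm F l = e'" using couniversal_factor[OF e E'(1,3)] .
  have "e \<cdot>\<^bsub>D\<^esub> Fm F (l \<cdot>\<^bsub>C\<^esub> k) = e \<cdot>\<^bsub>D\<^esub> Fm F (Ident C c)"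
    using cod.comp_assoc[OF fm_hom[OF k(1)] fm_hom[OF l(1)] E(3)] fm_comp[OF k(1) l(1)] k l
      cod.comp_ident_right[OF E(3)] fm_ident[OF E(1)] by simp
  then have lk: "l \<cdot>\<^bsub>C\<^esub> k = Ident C c"
    by (rule couniversal_cancel[OF e dom.comp_hom[OF k(1) l(1)] dom.ident_hom[OF E(1)]])
  have "e' \<cdot>\<^bsub>D\<^esub> Fm F (k \<cdot>\<^bsub>C\<^esub> l) = e' \<cdot>\<^bsub>D\<^esub> Fm F (Ident C c')"
    using cod.comp_assoc[OF fm_hom[OF l(1)] fm_hom[OF k(1)] E'(3)] fm_comp[OF l(1) k(1)] k l
      cod.comp_ident_right[OF E'(3)] fm_ident[OF E'(1)] by simp
  then have "k \<cdot>\<^bsub>C\<^esub> l = Ident C c'"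
    by (rule couniversal_cancel[OF e' dom.comp_hom[OF l(1) k(1)] dom.ident_hom[OF E'(1)]])
  with that k l lk show ?thesis by blast
qed

text \<open>
  Couniversal arrows to the same object differ by an isomorphism of their sources, along which
  compatibility with the kernel is transported.
\<close>

lemma quotient_arrow_cong:
  assumes e: "couniversal C D F d c e" and e': "couniversal C D F d c' e'"
    and q: "quotient_arrow C D F d c e"
  shows "quotient_arrow C D F d c' e'"
  unfolding quotient_arrow_def
proof (intro ballI impI)
  fix v t assume v: "v \<in> Obj D" and t: "t \<in> Hom D (Fo F c') v" and comp: "kernel_compatible C D F c' e' t"
  obtain k l where k: "k \<in> Hom C c c'" "e' \<cdot>\<^bsub>D\<^esub> Fm F k = e" and l: "l \<in> Hom C c' c" "e \<cdot>\<^bsub>D\<^esub> Fm F l = e'"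
    and kl: "k \<cdot>\<^bsub>C\<^esub> l = Ident C c'" using couniversal_unique[OF e e'] by metis
  note E = couniversalD(3)[OF e] and E' = couniversalD(3)[OF e'] and ob = couniversalD(1)[OF e']
  note Fk = fm_hom[OF k(1)] and Fl = fm_hom[OF l(1)]
  have Fkl: "Fm F k \<cdot>\<^bsub>D\<^esub> Fm F l = Ident D (Fo F c')"
    using fm_comp[OF l(1) k(1)] fm_ident[OF ob] kl by simp
  have tk: "t \<cdot>\<^bsub>D\<^esub> Fm F k \<in> Hom D (Fo F c) v" by (rule cod.comp_hom[OF Fk t])
  have "kernel_compatible C D F c e (t \<cdot>\<^bsub>D\<^esub> Fm F k)"
    unfolding kernel_compatible_def
  proof (intro ballI impI)
    fix b s r assume b: "b \<in> Obj C" and s: "s \<in> Hom C b c" and r: "r \<in> Hom D (Fo F b) (Fo F c)"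
      and eq: "e \<cdot>\<^bsub>D\<^esub> Fm F s = e \<cdot>\<^bsub>D\<^esub> r"
    have 1: "(x \<cdot>\<^bsub>D\<^esub> Fm F k) \<cdot>\<^bsub>D\<^esub> Fm F s = x \<cdot>\<^bsub>D\<^esub> Fm F (k \<cdot>\<^bsub>C\<^esub> s)"
      "(x \<cdot>\<^bsub>D\<^esub> Fm F k) \<cdot>\<^bsub>D\<^esub> r = x \<cdot>\<^bsub>D\<^esub> (Fm F k \<cdot>\<^bsub>D\<^esub> r)" if "x \<in> Hom D (Fo F c') y" for x y
      using cod.comp_assoc[OF fm_hom[OF s] Fk that] cod.comp_assoc[OF r Fk that] fm_comp[OF s k(1)] by auto
    have "e' \<cdot>\<^bsub>D\<^esub> Fm F (k \<cdot>\<^bsub>C\<^esub> s) = e' \<cdot>\<^bsub>D\<^esub> (Fm F k \<cdot>\<^bsub>D\<^esub> r)"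
      using eq unfolding k(2)[symmetric] 1[OF E'] .
    then show "(t \<cdot>\<^bsub>D\<^esub> Fm F k) \<cdot>\<^bsub>D\<^esub> Fm F s = (t \<cdot>\<^bsub>D\<^esub> Fm F k) \<cdot>\<^bsub>D\<^esub> r"
      unfolding 1[OF t] using comp b dom.comp_hom[OF s k(1)] cod.comp_hom[OF r Fk]
      unfolding kernel_compatible_def by blast
  qed
  then obtain g where g: "g \<in> Hom D d v" "g \<cdot>\<^bsub>D\<^esub> e = t \<cdot>\<^bsub>D\<^esub> Fm F k"
    and uniq: "\<And>g'. g' \<in> Hom D d v \<Longrightarrow> g' \<cdot>\<^bsub>D\<^esub> e = t \<cdot>\<^bsub>D\<^esub> Fm F k \<Longrightarrow> g' = g"
    using q v tk unfolding quotient_arrow_def by metis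
  show "\<exists>!g. g \<in> Hom D d v \<and> g \<cdot>\<^bsub>D\<^esub> e' = t"
  proof (rule ex1I[of _ g])
    have "g \<cdot>\<^bsub>D\<^esub> e' = (g \<cdot>\<^bsub>D\<^esub> e) \<cdot>\<^bsub>D\<^esub> Fm F l"
      using cod.comp_assoc[OF Fl E g(1)] l(2) by simp
    also have "\<dots> = t"
      using cod.comp_assoc[OF Fl Fk t] Fkl cod.comp_ident_right[OF t] by (simp add: g(2))
    finally show "g \<in> Hom D d v \<and> g \<cdot>\<^bsub>D\<^esub> e' = t" using g(1) by blast
    fix g' assume g': "g' \<in> Hom D d v \<and> g' \<cdot>\<^bsub>D\<^esub> e' = t"
    then have "g' \<cdot>\<^bsub>D\<^esub> e = t \<cdot>\<^bsub>D\<^esub> Fm F k"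
      using cod.comp_assoc[OF Fk E', of g' v] k(2) by simp
    with uniq g' show "g' = g" by blast
  qed
qed

lemma monadic_leftD:
  assumes m: "monadic_left C D F"
  shows "d \<in> Obj D \<Longrightarrow> \<exists>c e. couniversal C D F d c e"
    and "couniversal C D F d c e \<Longrightarrow> quotient_arrow C D F d c e"
proof -
  show ex: "\<exists>c e. couniversal C D F d c e" if "d \<in> Obj D"
    using m that unfolding monadic_left_def by blast
  assume e: "couniversal C D F d c e"
  obtain c' e' where e': "couniversal C D F d c' e'" "quotient_arrow C D F d c' e'"
    using m couniversalD(2)[OF e] unfolding monadic_left_def by blast
  show "quotient_arrow C D F d c e" by (rule quotient_arrow_cong[OF e'(1) e e'(2)])
qed

lemma adjunction_of_couniversal:
  assumes "\<And>d. d \<in> Obj D \<Longrightarrow> \<exists>c e. couniversal C D F d c e"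
  shows "\<exists>G \<eta> \<epsilon>. adjunction C D F G \<eta> \<epsilon>"
proof -
  obtain g\<^sub>0 \<epsilon> where cu: "\<And>d. d \<in> Obj D \<Longrightarrow> couniversal C D F d (g\<^sub>0 d) (\<epsilon> d)"
    using assms by metis
  note g0 = couniversalD(1)[OF cu] and eps = couniversalD(3)[OF cu]
  have "\<exists>k. h \<in> Arr D \<longrightarrow> k \<in> Hom C (g\<^sub>0 (Dom D h)) (g\<^sub>0 (Cod D h))
      \<and> \<epsilon> (Cod D h) \<cdot>\<^bsub>D\<^esub> Fm F k = h \<cdot>\<^bsub>D\<^esub> \<epsilon> (Dom D h)" for h
  proof (cases "h \<in> Arr D")
    case True
    then have h: "h \<in> Hom D (Dom D h) (Cod D h)" and ob: "Dom D h \<in> Obj D" "Cod D h \<in> Obj D"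
      by (auto simp: hom_iff)
    show ?thesis
      using couniversal_factor[OF cu[OF ob(2)] g0[OF ob(1)] cod.comp_hom[OF eps[OF ob(1)] h]] by blast
  qed simp
  then obtain g\<^sub>1 where
    "\<And>h. h \<in> Arr D \<Longrightarrow> g\<^sub>1 h \<in> Hom C (g\<^sub>0 (Dom D h)) (g\<^sub>0 (Cod D h))
      \<and> \<epsilon> (Cod D h) \<cdot>\<^bsub>D\<^esub> Fm F (g\<^sub>1 h) = h \<cdot>\<^bsub>D\<^esub> \<epsilon> (Dom D h)" by metis
  then have g1: "g\<^sub>1 h \<in> Hom C (g\<^sub>0 x) (g\<^sub>0 y)" and nat: "\<epsilon> y \<cdot>\<^bsub>D\<^esub> Fm F (g\<^sub>1 h) = h \<cdot>\<^bsub>D\<^esub> \<epsilon> x"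
    if "h \<in> Hom D x y" for h x y using that by (auto simp: hom_iff)
  have "\<exists>k. c \<in> Obj C \<longrightarrow> k \<in> Hom C c (g\<^sub>0 (Fo F c)) \<and> \<epsilon> (Fo F c) \<cdot>\<^bsub>D\<^esub> Fm F k = Ident D (Fo F c)" for c
    using couniversal_factor[OF cu[OF fo_obj] _ cod.ident_hom[OF fo_obj]] by metis
  then obtain \<eta> where eta: "\<And>c. c \<in> Obj C \<Longrightarrow> \<eta> c \<in> Hom C c (g\<^sub>0 (Fo F c))"
    and eps_eta: "\<And>c. c \<in> Obj C \<Longrightarrow> \<epsilon> (Fo F c) \<cdot>\<^bsub>D\<^esub> Fm F (\<eta> c) = Ident D (Fo F c)" by metis
  define G where "G = \<lparr>Fo = g\<^sub>0, Fm = g\<^sub>1\<rparr>"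
  have G: "cat_functor D C G"
  proof
    show "Fo G d \<in> Obj C" if "d \<in> Obj D" for d using that g0 by (simp add: G_def)
    show "Fm G h \<in> Hom C (Fo G x) (Fo G y)" if "h \<in> Hom D x y" for h x y
      using g1[OF that] by (simp add: G_def)
    show "Fm G (Ident D x) = Ident C (Fo G x)" if x: "x \<in> Obj D" for x
    proof -
      note i = cod.ident_hom[OF x] and gi = dom.ident_hom[OF g0[OF x]]
      have "\<epsilon> x \<cdot>\<^bsub>D\<^esub> Fm F (g\<^sub>1 (Ident D x)) = \<epsilon> x \<cdot>\<^bsub>D\<^esub> Fm F (Ident C (g\<^sub>0 x))"
        unfolding nat[OF i] fm_ident[OF g0[OF x]] cod.comp_ident_right[OF eps[OF x]]
          cod.comp_ident_left[OF eps[OF x]] ..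
      then show ?thesis using couniversal_cancel[OF cu[OF x] g1[OF i] gi] by (simp add: G_def)
    qed
    show "Fm G (h' \<cdot>\<^bsub>D\<^esub> h) = Fm G h' \<cdot>\<^bsub>C\<^esub> Fm G h" if h: "h \<in> Hom D x y" "h' \<in> Hom D y z" for h h' x y z
    proof -
      have ob: "x \<in> Obj D" "y \<in> Obj D" "z \<in> Obj D" using h by (auto simp: hom_iff)
      note hh = cod.comp_hom[OF h] and gg = dom.comp_hom[OF g1[OF h(1)] g1[OF h(2)]]
      note Fg = fm_hom[OF g1[OF h(1)]] fm_hom[OF g1[OF h(2)]]
      have "\<epsilon> z \<cdot>\<^bsub>D\<^esub> Fm F (g\<^sub>1 h' \<cdot>\<^bsub>C\<^esub> g\<^sub>1 h) = h' \<cdot>\<^bsub>D\<^esub> (\<epsilon> y \<cdot>\<^bsub>D\<^esub> Fm F (g\<^sub>1 h))"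
        unfolding fm_comp[OF g1[OF h(1)] g1[OF h(2)]]
        by (rule cod.comp_eq_extend[OF nat[OF h(2)] Fg(2) eps[OF ob(3)] eps[OF ob(2)] h(2) Fg(1)])
      also have "\<dots> = \<epsilon> z \<cdot>\<^bsub>D\<^esub> Fm F (g\<^sub>1 (h' \<cdot>\<^bsub>D\<^esub> h))"
        unfolding nat[OF h(1)] nat[OF hh] cod.comp_assoc[OF eps[OF ob(1)] h] ..
      finally show ?thesis using couniversal_cancel[OF cu[OF ob(3)] gg g1[OF hh]] by (simp add: G_def)
    qed
  qed
  interpret G: cat_functor D C G by fact
  have G_simps: "Fo G = g\<^sub>0" "Fm G = g\<^sub>1" by (simp_all add: G_def)
  have eta_nat: "\<eta> y \<cdot>\<^bsub>C\<^esub> f = g\<^sub>1 (Fm F f) \<cdot>\<^bsub>C\<^esub> \<eta> x" if f: "f \<in> Hom C x y" for f x y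
  proof -
    note ob = dom.hom_obj[OF f]
    note Fob = fo_obj[OF ob(1)] fo_obj[OF ob(2)] and Ff = fm_hom[OF f]
    have "\<epsilon> (Fo F y) \<cdot>\<^bsub>D\<^esub> Fm F (\<eta> y \<cdot>\<^bsub>C\<^esub> f) = Fm F f"
      unfolding fm_comp[OF f eta[OF ob(2)]]
      by (rule cod.comp_ident_extend[OF eps_eta[OF ob(2)] fm_hom[OF eta[OF ob(2)]] eps[OF Fob(2)] Ff])
    also have "\<dots> = Fm F f \<cdot>\<^bsub>D\<^esub> (\<epsilon> (Fo F x) \<cdot>\<^bsub>D\<^esub> Fm F (\<eta> x))"
      unfolding eps_eta[OF ob(1)] by (rule cod.comp_ident_right[OF Ff, symmetric])
    also have "\<dots> = \<epsilon> (Fo F y) \<cdot>\<^bsub>D\<^esub> Fm F (g\<^sub>1 (Fm F f) \<cdot>\<^bsub>C\<^esub> \<eta> x)"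
      unfolding fm_comp[OF eta[OF ob(1)] g1[OF Ff]]
      by (rule cod.comp_eq_extend[OF nat[OF Ff] fm_hom[OF g1[OF Ff]] eps[OF Fob(2)] eps[OF Fob(1)] Ff
            fm_hom[OF eta[OF ob(1)]], symmetric])
    finally show ?thesis
      by (rule couniversal_cancel[OF cu[OF Fob(2)] dom.comp_hom[OF f eta[OF ob(2)]] dom.comp_hom[OF eta[OF ob(1)] g1[OF Ff]]])
  qed
  have tri: "g\<^sub>1 (\<epsilon> d) \<cdot>\<^bsub>C\<^esub> \<eta> (g\<^sub>0 d) = Ident C (g\<^sub>0 d)" if d: "d \<in> Obj D" for d
  proof -
    note e = eps[OF d] and c = g0[OF d]
    note Fc = fo_obj[OF c]
    have "\<epsilon> d \<cdot>\<^bsub>D\<^esub> Fm F (g\<^sub>1 (\<epsilon> d) \<cdot>\<^bsub>C\<^esub> \<eta> (g\<^sub>0 d)) = \<epsilon> d \<cdot>\<^bsub>D\<^esub> (\<epsilon> (Fo F (g\<^sub>0 d)) \<cdot>\<^bsub>D\<^esub> Fm F (\<eta> (g\<^sub>0 d)))"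
      unfolding fm_comp[OF eta[OF c] g1[OF e]]
      by (rule cod.comp_eq_extend[OF nat[OF e] fm_hom[OF g1[OF e]] e eps[OF Fc] e fm_hom[OF eta[OF c]]])
    also have "\<dots> = \<epsilon> d \<cdot>\<^bsub>D\<^esub> Fm F (Ident C (g\<^sub>0 d))"
      unfolding eps_eta[OF c] fm_ident[OF c] ..
    finally show ?thesis
      by (rule couniversal_cancel[OF cu[OF d] dom.comp_hom[OF eta[OF c] g1[OF e]] dom.ident_hom[OF c]])
  qed
  have "adjunction C D F G \<eta> \<epsilon>"
  proof
    show "nat_trans C C id_fctr (comp_fctr G F) \<eta>"
      using eta eta_nat by (auto simp: nat_trans_def id_fctr_def comp_fctr_def G_simps hom_iff)
    show "nat_trans D D (comp_fctr F G) id_fctr \<epsilon>"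
      using eps nat by (auto simp: nat_trans_def id_fctr_def comp_fctr_def G_simps hom_iff)
  qed (simp_all add: G_simps eps_eta tri)
  then show ?thesis by blast
qed

end

section \<open>Monadicity of an adjunction in terms of its left adjoint\<close>

context adjunction begin

abbreviation EM where "EM \<equiv> induced_em_category C F G \<eta> \<epsilon>"
abbreviation K where "K \<equiv> comparison D G \<epsilon>"

lemma counit_hom: "d \<in> Obj D \<Longrightarrow> \<epsilon> d \<in> Hom D (Fo F (Fo G d)) d"
  using counit by (auto simp: nat_trans_def comp_fctr_def id_fctr_def)

lemma counit_nat: "g \<in> Hom D x y \<Longrightarrow> \<epsilon> y \<cdot>\<^bsub>D\<^esub> Fm F (Fm G g) = g \<cdot>\<^bsub>D\<^esub> \<epsilon> x"
  using counit by (auto simp: nat_trans_def comp_fctr_def id_fctr_def hom_iff)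

lemma unit_hom: "c \<in> Obj C \<Longrightarrow> \<eta> c \<in> Hom C c (Fo G (Fo F c))"
  using unit by (auto simp: nat_trans_def comp_fctr_def id_fctr_def)

lemma unit_nat: "f \<in> Hom C x y \<Longrightarrow> Fm G (Fm F f) \<cdot>\<^bsub>C\<^esub> \<eta> x = \<eta> y \<cdot>\<^bsub>C\<^esub> f"
  using unit by (auto simp: nat_trans_def comp_fctr_def id_fctr_def hom_iff)

definition transpose :: "'o1 \<Rightarrow> 'm2 \<Rightarrow> 'm1" where
  "transpose c t = Fm G t \<cdot>\<^bsub>C\<^esub> \<eta> c"

lemma transpose_hom: "\<lbrakk>c \<in> Obj C; t \<in> Hom D (Fo F c) d\<rbrakk> \<Longrightarrow> transpose c t \<in> Hom C c (Fo G d)"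
  unfolding transpose_def by (rule left.dom.comp_hom[OF unit_hom right.fm_hom])

lemma counit_transpose:
  assumes c: "c \<in> Obj C" and t: "t \<in> Hom D (Fo F c) d"
  shows "\<epsilon> d \<cdot>\<^bsub>D\<^esub> Fm F (transpose c t) = t"
proof -
  note d = left.cod.hom_obj(2)[OF t] and Fc = left.fo_obj[OF c]
  have "\<epsilon> d \<cdot>\<^bsub>D\<^esub> Fm F (transpose c t) = t \<cdot>\<^bsub>D\<^esub> (\<epsilon> (Fo F c) \<cdot>\<^bsub>D\<^esub> Fm F (\<eta> c))"
    unfolding transpose_def left.fm_comp[OF unit_hom[OF c] right.fm_hom[OF t]]
    by (rule left.cod.comp_eq_extend[OF counit_nat[OF t] left.fm_hom[OF right.fm_hom[OF t]]
        counit_hom[OF d] counit_hom[OF Fc] t left.fm_hom[OF unit_hom[OF c]]])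
  then show ?thesis unfolding triangle_left[OF c] left.cod.comp_ident_right[OF t] .
qed

lemma transpose_counit:
  assumes s: "s \<in> Hom C c (Fo G d)" and d: "d \<in> Obj D"
  shows "transpose c (\<epsilon> d \<cdot>\<^bsub>D\<^esub> Fm F s) = s"
proof -
  note c = left.dom.hom_obj(1)[OF s] and Gd = right.fo_obj[OF d] and e = counit_hom[OF d]
  have "transpose c (\<epsilon> d \<cdot>\<^bsub>D\<^esub> Fm F s) = Fm G (\<epsilon> d) \<cdot>\<^bsub>C\<^esub> (Fm G (Fm F s) \<cdot>\<^bsub>C\<^esub> \<eta> c)"
    unfolding transpose_def right.fm_comp[OF left.fm_hom[OF s] e]
    by (rule left.dom.comp_assoc[OF unit_hom[OF c] right.fm_hom[OF left.fm_hom[OF s]] right.fm_hom[OF e]])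
  also have "\<dots> = s"
    unfolding unit_nat[OF s]
    by (rule left.dom.comp_ident_extend[OF triangle_right[OF d] unit_hom[OF Gd] right.fm_hom[OF e] s])
  finally show ?thesis .
qed

lemma counit_cancel:
  assumes "d \<in> Obj D" "s \<in> Hom C c (Fo G d)" "s' \<in> Hom C c (Fo G d)" "\<epsilon> d \<cdot>\<^bsub>D\<^esub> Fm F s = \<epsilon> d \<cdot>\<^bsub>D\<^esub> Fm F s'"
  shows "s = s'"
  using transpose_counit assms by metis

lemma couniversal_counit:
  assumes d: "d \<in> Obj D"
  shows "couniversal C D F d (Fo G d) (\<epsilon> d)"
  using left.couniversalI[OF right.fo_obj[OF d] d counit_hom[OF d]] transpose_hom counit_transpose counit_cancel[OF d]
  by metis

lemma counit_whisker:
  assumes d: "d \<in> Obj D" and s: "s \<in> Hom C c (Fo G d)" and k: "k \<in> Hom C c' c"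
  shows "\<epsilon> d \<cdot>\<^bsub>D\<^esub> Fm F (s \<cdot>\<^bsub>C\<^esub> k) = (\<epsilon> d \<cdot>\<^bsub>D\<^esub> Fm F s) \<cdot>\<^bsub>D\<^esub> Fm F k"
  unfolding left.fm_comp[OF k s]
  by (rule left.cod.comp_assoc[OF left.fm_hom[OF k] left.fm_hom[OF s] counit_hom[OF d], symmetric])

lemma EM_hom_iff: "u \<in> Hom EM X Y \<longleftrightarrow> (\<exists>h. u = (X, h, Y) \<and> X \<in> Obj EM \<and> Y \<in> Obj EM
    \<and> h \<in> Hom C (fst X) (fst Y) \<and> h \<cdot>\<^bsub>C\<^esub> snd X = snd Y \<cdot>\<^bsub>C\<^esub> Fm G (Fm F h))"
  by (auto simp: em_category_def comp_fctr_def Hom_def)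

lemma EM_obj_iff: "(c, a) \<in> Obj EM \<longleftrightarrow> c \<in> Obj C \<and> a \<in> Hom C (Fo G (Fo F c)) c
    \<and> a \<cdot>\<^bsub>C\<^esub> \<eta> c = Ident C c \<and> a \<cdot>\<^bsub>C\<^esub> Fm G (Fm F a) = a \<cdot>\<^bsub>C\<^esub> Fm G (\<epsilon> (Fo F c))"
  by (auto simp: em_category_def em_algebras_def comp_fctr_def induced_mult_def)

lemma K_obj: "d \<in> Obj D \<Longrightarrow> Fo K d \<in> Obj EM"
  by (rule cat_functor.fo_obj[OF comparison_functor])

lemma K_simps: "Fo K d = (Fo G d, Fm G (\<epsilon> d))" "g \<in> Hom D d v \<Longrightarrow> Fm K g = (Fo K d, Fm G g, Fo K v)"
  by (auto simp: comparison_def hom_iff)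

text \<open>
  Under transposition both composites of the algebra square of \<open>h\<close> become composites of
  \<open>t = \<epsilon> v \<cdot> F h\<close> with the two arrows \<open>F G \<epsilon> d\<close> and \<open>\<epsilon> (F G d)\<close> of the standard presentation of \<open>d\<close>.
  Every pair identified by \<open>\<epsilon> d\<close> factors through this one.
\<close>

lemma algebra_map_iff_kernel_compatible:
  assumes d: "d \<in> Obj D" and v: "v \<in> Obj D" and h: "h \<in> Hom C (Fo G d) (Fo G v)"
  shows "h \<cdot>\<^bsub>C\<^esub> Fm G (\<epsilon> d) = Fm G (\<epsilon> v) \<cdot>\<^bsub>C\<^esub> Fm G (Fm F h)
    \<longleftrightarrow> kernel_compatible C D F (Fo G d) (\<epsilon> d) (\<epsilon> v \<cdot>\<^bsub>D\<^esub> Fm F h)" (is "?L = ?R \<longleftrightarrow> _")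
proof -
  define t where "t = \<epsilon> v \<cdot>\<^bsub>D\<^esub> Fm F h"
  note Gd = right.fo_obj[OF d]
  note FGd = left.fo_obj[OF Gd]
  note e = counit_hom[OF d] and Fh = left.fm_hom[OF h]
  have t: "t \<in> Hom D (Fo F (Fo G d)) v" unfolding t_def by (rule left.cod.comp_hom[OF Fh counit_hom[OF v]])
  have Gt: "?R = Fm G t" unfolding t_def by (rule right.fm_comp[OF Fh counit_hom[OF v], symmetric])
  note Ge = right.fm_hom[OF e]
  have L: "\<epsilon> v \<cdot>\<^bsub>D\<^esub> Fm F ?L = t \<cdot>\<^bsub>D\<^esub> Fm F (Fm G (\<epsilon> d))"
    unfolding t_def by (rule counit_whisker[OF v h Ge])
  have R: "\<epsilon> v \<cdot>\<^bsub>D\<^esub> Fm F ?R = t \<cdot>\<^bsub>D\<^esub> \<epsilon> (Fo F (Fo G d))"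
    unfolding Gt by (rule counit_nat[OF t])
  have iff: "?L = ?R \<longleftrightarrow> t \<cdot>\<^bsub>D\<^esub> Fm F (Fm G (\<epsilon> d)) = t \<cdot>\<^bsub>D\<^esub> \<epsilon> (Fo F (Fo G d))"
    using counit_cancel[OF v left.dom.comp_hom[OF Ge h] right.fm_hom[OF t]] L R unfolding Gt by metis
  show ?thesis unfolding iff t_def[symmetric]
  proof
    assume eq: "t \<cdot>\<^bsub>D\<^esub> Fm F (Fm G (\<epsilon> d)) = t \<cdot>\<^bsub>D\<^esub> \<epsilon> (Fo F (Fo G d))"
    show "kernel_compatible C D F (Fo G d) (\<epsilon> d) t"
      unfolding kernel_compatible_def
    proof (intro ballI impI)
      fix c s r assume c: "c \<in> Obj C" and s: "s \<in> Hom C c (Fo G d)" and r: "r \<in> Hom D (Fo F c) (Fo F (Fo G d))"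
        and es: "\<epsilon> d \<cdot>\<^bsub>D\<^esub> Fm F s = \<epsilon> d \<cdot>\<^bsub>D\<^esub> r"
      define r' where "r' = transpose c r"
      have r': "r' \<in> Hom C c (Fo G (Fo F (Fo G d)))" "\<epsilon> (Fo F (Fo G d)) \<cdot>\<^bsub>D\<^esub> Fm F r' = r"
        unfolding r'_def using transpose_hom[OF c r] counit_transpose[OF c r] by auto
      have *: "x \<cdot>\<^bsub>D\<^esub> r = (x \<cdot>\<^bsub>D\<^esub> \<epsilon> (Fo F (Fo G d))) \<cdot>\<^bsub>D\<^esub> Fm F r'" if "x \<in> Hom D (Fo F (Fo G d)) y" for x y
        using left.cod.comp_assoc[OF left.fm_hom[OF r'(1)] counit_hom[OF FGd] that] by (simp only: r'(2))
      have "\<epsilon> d \<cdot>\<^bsub>D\<^esub> Fm F (Fm G (\<epsilon> d) \<cdot>\<^bsub>C\<^esub> r') = \<epsilon> d \<cdot>\<^bsub>D\<^esub> Fm F s"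
        unfolding counit_whisker[OF d Ge r'(1)] counit_nat[OF e] es *[OF e] ..
      then have "s = Fm G (\<epsilon> d) \<cdot>\<^bsub>C\<^esub> r'"
        by (rule counit_cancel[OF d left.dom.comp_hom[OF r'(1) Ge] s, symmetric])
      then have "t \<cdot>\<^bsub>D\<^esub> Fm F s = (t \<cdot>\<^bsub>D\<^esub> Fm F (Fm G (\<epsilon> d))) \<cdot>\<^bsub>D\<^esub> Fm F r'"
        using left.cod.comp_assoc[OF left.fm_hom[OF r'(1)] left.fm_hom[OF Ge] t] left.fm_comp[OF r'(1) Ge] by simp
      then show "t \<cdot>\<^bsub>D\<^esub> Fm F s = t \<cdot>\<^bsub>D\<^esub> r" unfolding eq *[OF t] .
    qed
  next
    assume "kernel_compatible C D F (Fo G d) (\<epsilon> d) t"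
    moreover have "\<epsilon> d \<cdot>\<^bsub>D\<^esub> Fm F (Fm G (\<epsilon> d)) = \<epsilon> d \<cdot>\<^bsub>D\<^esub> \<epsilon> (Fo F (Fo G d))" by (rule counit_nat[OF e])
    ultimately show "t \<cdot>\<^bsub>D\<^esub> Fm F (Fm G (\<epsilon> d)) = t \<cdot>\<^bsub>D\<^esub> \<epsilon> (Fo F (Fo G d))"
      using Ge counit_hom[OF FGd] right.fo_obj[OF FGd] unfolding kernel_compatible_def by blast
  qed
qed

lemma map_eq_iff:
  assumes g: "g \<in> Hom D d v" and h: "h \<in> Hom C (Fo G d) (Fo G v)"
  shows "Fm G g = h \<longleftrightarrow> g \<cdot>\<^bsub>D\<^esub> \<epsilon> d = \<epsilon> v \<cdot>\<^bsub>D\<^esub> Fm F h"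
  using counit_nat[OF g] counit_cancel[OF left.cod.hom_obj(2)[OF g] right.fm_hom[OF g] h] by metis

lemma fully_faithful_comparison_iff:
  "fully_faithful D EM K \<longleftrightarrow> (\<forall>d \<in> Obj D. quotient_arrow C D F d (Fo G d) (\<epsilon> d))"
proof -
  have 1: "(\<exists>!g. g \<in> Hom D d v \<and> Fm K g = (Fo K d, h, Fo K v))
      \<longleftrightarrow> (\<exists>!g. g \<in> Hom D d v \<and> g \<cdot>\<^bsub>D\<^esub> \<epsilon> d = \<epsilon> v \<cdot>\<^bsub>D\<^esub> Fm F h)"
    if h: "h \<in> Hom C (Fo G d) (Fo G v)" for d v h
  proof -
    have "(g \<in> Hom D d v \<and> Fm K g = (Fo K d, h, Fo K v))
      \<longleftrightarrow> (g \<in> Hom D d v \<and> g \<cdot>\<^bsub>D\<^esub> \<epsilon> d = \<epsilon> v \<cdot>\<^bsub>D\<^esub> Fm F h)" for g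
      using K_simps(2) map_eq_iff[OF _ h] by auto
    then show ?thesis by simp
  qed
  have 2: "(Fo K d, h, Fo K v) \<in> Hom EM (Fo K d) (Fo K v) \<longleftrightarrow> h \<in> Hom C (Fo G d) (Fo G v)
      \<and> kernel_compatible C D F (Fo G d) (\<epsilon> d) (\<epsilon> v \<cdot>\<^bsub>D\<^esub> Fm F h)"
    if "d \<in> Obj D" "v \<in> Obj D" for d v h
    using algebra_map_iff_kernel_compatible[OF that] K_obj[OF that(1)] K_obj[OF that(2)]
    unfolding EM_hom_iff by (auto simp: K_simps(1))
  show ?thesis
  proof
    assume ff: "fully_faithful D EM K"
    show "\<forall>d \<in> Obj D. quotient_arrow C D F d (Fo G d) (\<epsilon> d)"
      unfolding quotient_arrow_def
    proof (intro ballI impI)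
      fix d v t assume d: "d \<in> Obj D" and v: "v \<in> Obj D" and t: "t \<in> Hom D (Fo F (Fo G d)) v"
        and comp: "kernel_compatible C D F (Fo G d) (\<epsilon> d) t"
      define h where "h = transpose (Fo G d) t"
      have h: "h \<in> Hom C (Fo G d) (Fo G v)" "\<epsilon> v \<cdot>\<^bsub>D\<^esub> Fm F h = t"
        unfolding h_def using transpose_hom[OF right.fo_obj[OF d] t] counit_transpose[OF right.fo_obj[OF d] t] by auto
      then have "(Fo K d, h, Fo K v) \<in> Hom EM (Fo K d) (Fo K v)" using 2[OF d v] comp by simp
      then have "\<exists>!g. g \<in> Hom D d v \<and> Fm K g = (Fo K d, h, Fo K v)"
        using ff d v unfolding fully_faithful_def by blast
      then show "\<exists>!g. g \<in> Hom D d v \<and> g \<cdot>\<^bsub>D\<^esub> \<epsilon> d = t" unfolding 1[OF h(1)] h(2) .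
    qed
  next
    assume q: "\<forall>d \<in> Obj D. quotient_arrow C D F d (Fo G d) (\<epsilon> d)"
    show "fully_faithful D EM K"
      unfolding fully_faithful_def
    proof (intro ballI)
      fix d v u assume d: "d \<in> Obj D" and v: "v \<in> Obj D" and u: "u \<in> Hom EM (Fo K d) (Fo K v)"
      then obtain h where uh: "u = (Fo K d, h, Fo K v)" unfolding EM_hom_iff by blast
      have h: "h \<in> Hom C (Fo G d) (Fo G v)"
        and comp: "kernel_compatible C D F (Fo G d) (\<epsilon> d) (\<epsilon> v \<cdot>\<^bsub>D\<^esub> Fm F h)"
        using 2[OF d v] u unfolding uh by auto
      have "\<epsilon> v \<cdot>\<^bsub>D\<^esub> Fm F h \<in> Hom D (Fo F (Fo G d)) v"
        by (rule left.cod.comp_hom[OF left.fm_hom[OF h] counit_hom[OF v]])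
      with q d v comp have "\<exists>!g. g \<in> Hom D d v \<and> g \<cdot>\<^bsub>D\<^esub> \<epsilon> d = \<epsilon> v \<cdot>\<^bsub>D\<^esub> Fm F h"
        unfolding quotient_arrow_def by blast
      then show "\<exists>!g. g \<in> Hom D d v \<and> Fm K g = u" unfolding uh 1[OF h] .
    qed
  qed
qed

text \<open>
  The composite \<open>a \<cdot> G (F (a \<cdot> s') \<cdot> r) \<cdot> \<eta>\<close>, for \<open>s'\<close> the transpose of \<open>s\<close>, contains \<open>a \<cdot> G F a\<close>; replacing
  it by \<open>a \<cdot> G \<epsilon>\<close> undoes the transposition of \<open>s\<close>.
\<close>

lemma algebra_descent_datum:
  assumes "(c, a) \<in> Obj EM"
  shows "descent_datum C D F c (\<lambda>c' r. a \<cdot>\<^bsub>C\<^esub> transpose c' r)"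
proof -
  from assms have c: "c \<in> Obj C" and a: "a \<in> Hom C (Fo G (Fo F c)) c" and
    a_unit: "a \<cdot>\<^bsub>C\<^esub> \<eta> c = Ident C c" and a_mult: "a \<cdot>\<^bsub>C\<^esub> Fm G (Fm F a) = a \<cdot>\<^bsub>C\<^esub> Fm G (\<epsilon> (Fo F c))"
    by (auto simp: EM_obj_iff)
  note Fc = left.fo_obj[OF c]
  note e = counit_hom[OF Fc] and Fa = left.fm_hom[OF a]
  show ?thesis unfolding descent_datum_def
  proof (intro conjI ballI)
    show "c \<in> Obj C" by (rule c)
    show "a \<cdot>\<^bsub>C\<^esub> transpose c' r \<in> Hom C c' c" if "c' \<in> Obj C" "r \<in> Hom D (Fo F c') (Fo F c)" for c' r
      by (rule left.dom.comp_hom[OF transpose_hom[OF that] a])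
    show "a \<cdot>\<^bsub>C\<^esub> transpose c' (Fm F k) = k" if "k \<in> Hom C c' c" for c' k
      unfolding transpose_def unit_nat[OF that]
      by (rule left.dom.comp_ident_extend[OF a_unit unit_hom[OF c] a that])
    fix c' c'' r s assume c': "c' \<in> Obj C" and c'': "c'' \<in> Obj C"
      and r: "r \<in> Hom D (Fo F c') (Fo F c'')" and s: "s \<in> Hom D (Fo F c'') (Fo F c)"
    note ts = transpose_hom[OF c'' s] and Fts = left.fm_hom[OF transpose_hom[OF c'' s]]
    define q where "q = Fm F (transpose c'' s) \<cdot>\<^bsub>D\<^esub> r"
    have q: "q \<in> Hom D (Fo F c') (Fo F (Fo G (Fo F c)))"
      unfolding q_def by (rule left.cod.comp_hom[OF r Fts])
    have trans: "a \<cdot>\<^bsub>C\<^esub> transpose c' (x \<cdot>\<^bsub>D\<^esub> q) = (a \<cdot>\<^bsub>C\<^esub> Fm G x) \<cdot>\<^bsub>C\<^esub> transpose c' q"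
      if x: "x \<in> Hom D (Fo F (Fo G (Fo F c))) (Fo F c)" for x
    proof -
      have "transpose c' (x \<cdot>\<^bsub>D\<^esub> q) = Fm G x \<cdot>\<^bsub>C\<^esub> transpose c' q"
        unfolding transpose_def right.fm_comp[OF q x]
        by (rule left.dom.comp_assoc[OF unit_hom[OF c'] right.fm_hom[OF q] right.fm_hom[OF x]])
      then show ?thesis
        using left.dom.comp_assoc[OF transpose_hom[OF c' q] right.fm_hom[OF x] a] by simp
    qed
    have "Fm F (a \<cdot>\<^bsub>C\<^esub> transpose c'' s) \<cdot>\<^bsub>D\<^esub> r = Fm F a \<cdot>\<^bsub>D\<^esub> q"
      unfolding q_def left.fm_comp[OF ts a] by (rule left.cod.comp_assoc[OF r Fts Fa])
    moreover have "s \<cdot>\<^bsub>D\<^esub> r = \<epsilon> (Fo F c) \<cdot>\<^bsub>D\<^esub> q"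
      unfolding q_def using left.cod.comp_assoc[OF r Fts e] counit_transpose[OF c'' s] by simp
    ultimately show "a \<cdot>\<^bsub>C\<^esub> transpose c' (Fm F (a \<cdot>\<^bsub>C\<^esub> transpose c'' s) \<cdot>\<^bsub>D\<^esub> r) = a \<cdot>\<^bsub>C\<^esub> transpose c' (s \<cdot>\<^bsub>D\<^esub> r)"
      using trans[OF Fa] trans[OF e] a_mult by simp
  qed
qed

text \<open>
  The structure arrow is the value of \<open>\<alpha>\<close> at the counit, through which all arrows \<open>F c' \<rightarrow> F c\<close> factor.
\<close>

lemma descent_datum_algebra:
  assumes "descent_datum C D F c \<alpha>"
  defines "a \<equiv> \<alpha> (Fo G (Fo F c)) (\<epsilon> (Fo F c))"
  shows "(c, a) \<in> Obj EM"
    and "\<lbrakk>c' \<in> Obj C; r \<in> Hom D (Fo F c') (Fo F c)\<rbrakk> \<Longrightarrow> a \<cdot>\<^bsub>C\<^esub> transpose c' r = \<alpha> c' r"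
proof -
  note dd = descent_datumD[OF assms(1)]
  note c = dd(1)
  note Fc = left.fo_obj[OF c]
  note GFc = right.fo_obj[OF Fc]
  note FGFc = left.fo_obj[OF GFc]
  note GFGFc = right.fo_obj[OF FGFc]
  note e = counit_hom[OF Fc]
  have a: "a \<in> Hom C (Fo G (Fo F c)) c" unfolding a_def by (rule dd(2)[OF GFc e])
  have nat: "\<alpha> c'' (s \<cdot>\<^bsub>D\<^esub> Fm F k) = \<alpha> c' s \<cdot>\<^bsub>C\<^esub> k"
    if k: "k \<in> Hom C c'' c'" and s: "s \<in> Hom D (Fo F c') (Fo F c)" for k s c' c''
  proof -
    note ob = left.dom.hom_obj[OF k]
    note as = dd(2)[OF ob(2) s]
    have "\<alpha> c'' (s \<cdot>\<^bsub>D\<^esub> Fm F k) = \<alpha> c'' (Fm F (\<alpha> c' s) \<cdot>\<^bsub>D\<^esub> Fm F k)"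
      by (rule dd(4)[OF ob left.fm_hom[OF k] s, symmetric])
    also have "\<dots> = \<alpha> c' s \<cdot>\<^bsub>C\<^esub> k"
      unfolding left.fm_comp[OF k as, symmetric] by (rule dd(3)[OF ob(1) left.dom.comp_hom[OF k as]])
    finally show ?thesis .
  qed
  show \<alpha>: "a \<cdot>\<^bsub>C\<^esub> transpose c' r = \<alpha> c' r" if c': "c' \<in> Obj C" and r: "r \<in> Hom D (Fo F c') (Fo F c)" for c' r
    using nat[OF transpose_hom[OF c' r] e] unfolding counit_transpose[OF c' r] a_def by simp
  have "a \<cdot>\<^bsub>C\<^esub> \<eta> c = \<alpha> c (Fm F (Ident C c))"
    using nat[OF unit_hom[OF c] e] unfolding triangle_left[OF c] a_def left.fm_ident[OF c] by simp
  then have a_unit: "a \<cdot>\<^bsub>C\<^esub> \<eta> c = Ident C c" using dd(3)[OF c left.dom.ident_hom[OF c]] by simp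
  let ?m = "\<epsilon> (Fo F (Fo G (Fo F c)))"
  note m = counit_hom[OF FGFc] and Fa = left.fm_hom[OF a]
  have "a \<cdot>\<^bsub>C\<^esub> Fm G (Fm F a) = \<alpha> (Fo G (Fo F (Fo G (Fo F c)))) (Fm F a \<cdot>\<^bsub>D\<^esub> ?m)"
    using nat[OF right.fm_hom[OF Fa] e, folded a_def] counit_nat[OF Fa] by simp
  also have "\<dots> = \<alpha> (Fo G (Fo F (Fo G (Fo F c)))) (\<epsilon> (Fo F c) \<cdot>\<^bsub>D\<^esub> ?m)"
    unfolding a_def by (rule dd(4)[OF GFGFc GFc m e])
  also have "\<dots> = a \<cdot>\<^bsub>C\<^esub> Fm G (\<epsilon> (Fo F c))"
    using nat[OF right.fm_hom[OF e] e, folded a_def] counit_nat[OF e] by simp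
  finally show "(c, a) \<in> Obj EM" using c a a_unit by (simp add: EM_obj_iff)
qed

text \<open>
  Of the two inverse arrows only one needs to be known as a map of algebras: the other is then one too.
\<close>

lemma algebra_isoD:
  assumes iso: "isomorphic_objs EM X Y"
  obtains k l where "k \<in> Hom C (fst X) (fst Y)" "l \<in> Hom C (fst Y) (fst X)"
    "l \<cdot>\<^bsub>C\<^esub> snd Y = snd X \<cdot>\<^bsub>C\<^esub> Fm G (Fm F l)"
    "k \<cdot>\<^bsub>C\<^esub> l = Ident C (fst Y)" "l \<cdot>\<^bsub>C\<^esub> k = Ident C (fst X)"
proof -
  interpret EM: category EM by (rule category_em_category[OF induced_functor])
  obtain u where u: "u \<in> Hom EM X Y" "is_iso EM u"
    using iso unfolding isomorphic_objs_def by blast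
  obtain v where v: "v \<in> Hom EM Y X" "v \<cdot>\<^bsub>EM\<^esub> u = Ident EM X" "u \<cdot>\<^bsub>EM\<^esub> v = Ident EM Y"
    using EM.is_isoE[OF u(2,1)] by blast
  obtain k where k: "u = (X, k, Y)" "k \<in> Hom C (fst X) (fst Y)" using u(1) unfolding EM_hom_iff by blast
  obtain l where l: "v = (Y, l, X)" "l \<in> Hom C (fst Y) (fst X)"
    "l \<cdot>\<^bsub>C\<^esub> snd Y = snd X \<cdot>\<^bsub>C\<^esub> Fm G (Fm F l)" using v(1) unfolding EM_hom_iff by blast
  have "k \<cdot>\<^bsub>C\<^esub> l = Ident C (fst Y)" "l \<cdot>\<^bsub>C\<^esub> k = Ident C (fst X)"
    using v(2,3) unfolding k(1) l(1) by (auto simp: em_category_def split_beta)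
  with that k l show ?thesis by blast
qed

lemma algebra_isoI:
  assumes X: "X \<in> Obj EM" and Y: "Y \<in> Obj EM"
    and k: "k \<in> Hom C (fst X) (fst Y)" and l: "l \<in> Hom C (fst Y) (fst X)"
    and alg: "l \<cdot>\<^bsub>C\<^esub> snd Y = snd X \<cdot>\<^bsub>C\<^esub> Fm G (Fm F l)"
    and kl: "k \<cdot>\<^bsub>C\<^esub> l = Ident C (fst Y)" and lk: "l \<cdot>\<^bsub>C\<^esub> k = Ident C (fst X)"
  shows "isomorphic_objs EM X Y"
proof -
  interpret EM: category EM by (rule category_em_category[OF induced_functor])
  obtain x a where Xx: "X = (x, a)" by fastforce
  obtain y b where Yy: "Y = (y, b)" by fastforce
  have x: "x \<in> Obj C" and a: "a \<in> Hom C (Fo G (Fo F x)) x" using X by (auto simp: Xx EM_obj_iff)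
  have y: "y \<in> Obj C" and b: "b \<in> Hom C (Fo G (Fo F y)) y" using Y by (auto simp: Yy EM_obj_iff)
  have k: "k \<in> Hom C x y" and l: "l \<in> Hom C y x" using k l by (auto simp: Xx Yy)
  have alg: "l \<cdot>\<^bsub>C\<^esub> b = a \<cdot>\<^bsub>C\<^esub> Fm G (Fm F l)" and kl: "k \<cdot>\<^bsub>C\<^esub> l = Ident C y" and lk: "l \<cdot>\<^bsub>C\<^esub> k = Ident C x"
    using alg kl lk by (auto simp: Xx Yy)
  note Tk = right.fm_hom[OF left.fm_hom[OF k]] and Tl = right.fm_hom[OF left.fm_hom[OF l]]
  have Tlk: "Fm G (Fm F l) \<cdot>\<^bsub>C\<^esub> Fm G (Fm F k) = Ident C (Fo G (Fo F x))"
    using right.fm_comp[OF left.fm_hom[OF k] left.fm_hom[OF l]] left.fm_comp[OF k l]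
      left.fm_ident[OF x] right.fm_ident[OF left.fo_obj[OF x]] lk by simp
  have "k \<cdot>\<^bsub>C\<^esub> a = k \<cdot>\<^bsub>C\<^esub> ((a \<cdot>\<^bsub>C\<^esub> Fm G (Fm F l)) \<cdot>\<^bsub>C\<^esub> Fm G (Fm F k))"
    using left.dom.comp_assoc[OF Tk Tl a] Tlk left.dom.comp_ident_right[OF a] by simp
  also have "\<dots> = k \<cdot>\<^bsub>C\<^esub> (l \<cdot>\<^bsub>C\<^esub> (b \<cdot>\<^bsub>C\<^esub> Fm G (Fm F k)))"
    unfolding alg[symmetric] left.dom.comp_assoc[OF Tk b l] ..
  also have "\<dots> = b \<cdot>\<^bsub>C\<^esub> Fm G (Fm F k)"
    by (rule left.dom.comp_ident_extend[OF kl l k left.dom.comp_hom[OF Tk b]])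
  finally have u: "(X, k, Y) \<in> Hom EM X Y" using X Y k by (auto simp: EM_hom_iff Xx Yy)
  have v: "(Y, l, X) \<in> Hom EM Y X" using X Y l alg by (auto simp: EM_hom_iff Xx Yy)
  have "is_iso EM (X, k, Y)"
    by (rule EM.is_isoI[OF u v]) (simp_all add: em_category_def Xx Yy kl lk)
  with u show ?thesis unfolding isomorphic_objs_def by blast
qed

text \<open>
  If the algebra of a descent datum on \<open>c\<close> is isomorphic to the algebra of \<open>d\<close> by \<open>l : c \<rightarrow> G d\<close>, then the
  transpose \<open>\<epsilon> d \<cdot> F l\<close> is couniversal because \<open>l\<close> is invertible, and it coequalizes the datum because \<open>l\<close> is
  a map of algebras.
\<close>

lemma monadic_left_of_comparison:
  assumes eq: "cat_equivalence D EM K"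
  shows "monadic_left C D F"
  unfolding monadic_left_def
proof (intro conjI ballI allI impI)
  fix d assume d: "d \<in> Obj D"
  show "\<exists>c e. couniversal C D F d c e \<and> quotient_arrow C D F d c e"
    using couniversal_counit[OF d] equivalence_fully_faithful[OF eq] d
    unfolding fully_faithful_comparison_iff by blast
next
  fix c \<alpha> assume dd: "descent_datum C D F c \<alpha>"
  define a where "a = \<alpha> (Fo G (Fo F c)) (\<epsilon> (Fo F c))"
  note ca = descent_datum_algebra[OF dd, folded a_def]
  have c: "c \<in> Obj C" and a: "a \<in> Hom C (Fo G (Fo F c)) c" using ca(1) by (auto simp: EM_obj_iff)
  obtain d where d: "d \<in> Obj D" "isomorphic_objs EM (Fo K d) (c, a)"
    using equivalence_essentially_surjective[OF eq] ca(1) unfolding essentially_surjective_def by blast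
  obtain k l where k: "k \<in> Hom C (Fo G d) c" and l: "l \<in> Hom C c (Fo G d)"
    and alg: "l \<cdot>\<^bsub>C\<^esub> a = Fm G (\<epsilon> d) \<cdot>\<^bsub>C\<^esub> Fm G (Fm F l)"
    and kl: "k \<cdot>\<^bsub>C\<^esub> l = Ident C c" "l \<cdot>\<^bsub>C\<^esub> k = Ident C (Fo G d)"
    by (rule algebra_isoD[OF d(2)]) (simp add: K_simps)
  define e where "e = \<epsilon> d \<cdot>\<^bsub>D\<^esub> Fm F l"
  have e: "e \<in> Hom D (Fo F c) d" unfolding e_def by (rule left.cod.comp_hom[OF left.fm_hom[OF l] counit_hom[OF d(1)]])
  have cu: "couniversal C D F d c e"
    unfolding e_def by (rule left.couniversal_precomp_iso[OF couniversal_counit[OF d(1)] l k kl(2,1)])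
  have ea: "e \<cdot>\<^bsub>D\<^esub> Fm F a = e \<cdot>\<^bsub>D\<^esub> \<epsilon> (Fo F c)"
  proof -
    have "e \<cdot>\<^bsub>D\<^esub> Fm F a = \<epsilon> d \<cdot>\<^bsub>D\<^esub> Fm F (Fm G e)"
      unfolding e_def counit_whisker[OF d(1) l a, symmetric] alg
        right.fm_comp[OF left.fm_hom[OF l] counit_hom[OF d(1)]] ..
    then show ?thesis unfolding counit_nat[OF e] .
  qed
  have "e \<cdot>\<^bsub>D\<^esub> Fm F (\<alpha> c' r) = e \<cdot>\<^bsub>D\<^esub> r" if c': "c' \<in> Obj C" and r: "r \<in> Hom D (Fo F c') (Fo F c)" for c' r
  proof -
    note tr = transpose_hom[OF c' r] and eF = counit_hom[OF left.fo_obj[OF c]]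
    have "e \<cdot>\<^bsub>D\<^esub> Fm F (\<alpha> c' r) = e \<cdot>\<^bsub>D\<^esub> (Fm F a \<cdot>\<^bsub>D\<^esub> Fm F (transpose c' r))"
      unfolding ca(2)[OF c' r, symmetric] left.fm_comp[OF tr a] ..
    also have "\<dots> = e \<cdot>\<^bsub>D\<^esub> (\<epsilon> (Fo F c) \<cdot>\<^bsub>D\<^esub> Fm F (transpose c' r))"
      by (rule left.cod.comp_eq_extend[OF ea left.fm_hom[OF a] e eF e left.fm_hom[OF tr]])
    finally show ?thesis unfolding counit_transpose[OF c' r] .
  qed
  with cu show "\<exists>d e. couniversal C D F d c e \<and>
       (\<forall>c'\<in>Obj C. \<forall>r\<in>Hom D (Fo F c') (Fo F c). e \<cdot>\<^bsub>D\<^esub> Fm F (\<alpha> c' r) = e \<cdot>\<^bsub>D\<^esub> r)"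
    by blast
qed

lemma comparison_of_monadic_left:
  assumes m: "monadic_left C D F"
  shows "cat_equivalence D EM K"
proof (rule equivalenceI[OF comparison_functor])
  show "fully_faithful D EM K"
    unfolding fully_faithful_comparison_iff using left.monadic_leftD(2)[OF m] couniversal_counit by blast
  show "essentially_surjective D EM K"
    unfolding essentially_surjective_def
  proof
    fix X assume X: "X \<in> Obj EM"
    obtain c a where Xca: "X = (c, a)" by fastforce
    have c: "c \<in> Obj C" and a: "a \<in> Hom C (Fo G (Fo F c)) c" using X by (auto simp: Xca EM_obj_iff)
    note Fc = left.fo_obj[OF c]
    note eF = counit_hom[OF Fc] and GFc = right.fo_obj[OF Fc]
    let ?\<alpha> = "\<lambda>c' r. a \<cdot>\<^bsub>C\<^esub> transpose c' r"
    obtain d e where cu: "couniversal C D F d c e"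
      and ea: "\<forall>c'\<in>Obj C. \<forall>r\<in>Hom D (Fo F c') (Fo F c). e \<cdot>\<^bsub>D\<^esub> Fm F (?\<alpha> c' r) = e \<cdot>\<^bsub>D\<^esub> r"
      using m algebra_descent_datum[OF X[unfolded Xca]] unfolding monadic_left_def by blast
    note d = couniversalD(2)[OF cu] and e = couniversalD(3)[OF cu]
    have "transpose (Fo G (Fo F c)) (\<epsilon> (Fo F c)) = Ident C (Fo G (Fo F c))"
      unfolding transpose_def by (rule triangle_right[OF Fc])
    then have ea: "e \<cdot>\<^bsub>D\<^esub> Fm F a = e \<cdot>\<^bsub>D\<^esub> \<epsilon> (Fo F c)"
      using ea GFc eF left.dom.comp_ident_right[OF a] by force
    obtain l k where l: "l \<in> Hom C c (Fo G d)" "k \<in> Hom C (Fo G d) c" "\<epsilon> d \<cdot>\<^bsub>D\<^esub> Fm F l = e"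
      and lk: "k \<cdot>\<^bsub>C\<^esub> l = Ident C c" "l \<cdot>\<^bsub>C\<^esub> k = Ident C (Fo G d)"
      using left.couniversal_unique[OF cu couniversal_counit[OF d]] by metis
    have "Fm G (\<epsilon> d) \<cdot>\<^bsub>C\<^esub> Fm G (Fm F l) = Fm G e"
      using right.fm_comp[OF left.fm_hom[OF l(1)] counit_hom[OF d]] l(3) by simp
    then have "\<epsilon> d \<cdot>\<^bsub>D\<^esub> Fm F (l \<cdot>\<^bsub>C\<^esub> a) = \<epsilon> d \<cdot>\<^bsub>D\<^esub> Fm F (Fm G (\<epsilon> d) \<cdot>\<^bsub>C\<^esub> Fm G (Fm F l))"
      unfolding counit_whisker[OF d l(1) a] l(3) by (simp add: ea counit_nat[OF e])
    then have "l \<cdot>\<^bsub>C\<^esub> a = Fm G (\<epsilon> d) \<cdot>\<^bsub>C\<^esub> Fm G (Fm F l)"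
      by (rule counit_cancel[OF d left.dom.comp_hom[OF a l(1)]
            left.dom.comp_hom[OF right.fm_hom[OF left.fm_hom[OF l(1)]] right.fm_hom[OF counit_hom[OF d]]]])
    then have "isomorphic_objs EM (Fo K d) X"
      by (intro algebra_isoI[OF K_obj[OF d] X, of k l]) (simp_all add: K_simps Xca l lk)
    with d show "\<exists>d\<in>Obj D. isomorphic_objs EM (Fo K d) X" by blast
  qed
qed

end

section \<open>Restricting monadicity to coreflective subcategories\<close>

text \<open>
  The functors \<open>I\<close> and \<open>J\<close> exhibit \<open>C'\<close> and \<open>D'\<close> as full subcategories of \<open>C\<close> and \<open>D\<close> between which \<open>F\<close>
  restricts to \<open>F'\<close>. The last assumption says that the right adjoint of \<open>F\<close> restricts too.
\<close>

locale coreflective_restriction =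
  F: cat_functor C D F + F': cat_functor C' D' F' + I: cat_functor C' C I + J: cat_functor D' D J
  for C :: "('o1, 'm1, 'z1) cat_scheme" and D :: "('o2, 'm2, 'z2) cat_scheme" and F
    and C' :: "('o3, 'm3, 'z3) cat_scheme" and D' :: "('o4, 'm4, 'z4) cat_scheme" and F' and I and J +
  assumes I_ff: "fully_faithful C' C I"
    and J_ff: "fully_faithful D' D J"
    and square_obj: "c \<in> Obj C' \<Longrightarrow> Fo F (Fo I c) = Fo J (Fo F' c)"
    and square_arr: "f \<in> Arr C' \<Longrightarrow> Fm F (Fm I f) = Fm J (Fm F' f)"
    and J_coreflective: "d \<in> Obj D \<Longrightarrow> \<exists>u \<kappa>. couniversal D' D J d u \<kappa>"
    and restrict: "u \<in> Obj D' \<Longrightarrow>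
      \<exists>w e. w \<in> Obj C' \<and> e \<in> Hom D' (Fo F' w) u \<and> couniversal C D F (Fo J u) (Fo I w) (Fm J e)"
begin

lemma square_hom: "f \<in> Hom C' x y \<Longrightarrow> Fm F (Fm I f) = Fm J (Fm F' f)"
  by (rule square_arr) (simp add: hom_iff)

lemma J_lift:
  assumes "u \<in> Obj D'" "v \<in> Obj D'" "h \<in> Hom D (Fo J u) (Fo J v)"
  obtains g where "g \<in> Hom D' u v" "Fm J g = h"
  using fully_faithfulE[OF J_ff assms] .

lemma I_lift:
  assumes "u \<in> Obj C'" "v \<in> Obj C'" "h \<in> Hom C (Fo I u) (Fo I v)"
  obtains g where "g \<in> Hom C' u v" "Fm I g = h"
  using fully_faithfulE[OF I_ff assms] .

lemmas J_cancel = fully_faithful_cancel[OF J_ff J.cat_functor_axioms]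
lemmas I_cancel = fully_faithful_cancel[OF I_ff I.cat_functor_axioms]

lemma reflects_couniversal:
  assumes w: "w \<in> Obj C'" and u: "u \<in> Obj D'" and e: "e \<in> Hom D' (Fo F' w) u"
    and cu: "couniversal C D F (Fo J u) (Fo I w) (Fm J e)"
  shows "couniversal C' D' F' u w e"
proof (rule F'.couniversalI[OF w u e])
  have comp: "Fm J (e \<cdot>\<^bsub>D'\<^esub> Fm F' s) = Fm J e \<cdot>\<^bsub>D\<^esub> Fm F (Fm I s)" if s: "s \<in> Hom C' b w" for s b
    unfolding J.fm_comp[OF F'.fm_hom[OF s] e] square_hom[OF s] ..
  show "\<exists>s. s \<in> Hom C' b w \<and> e \<cdot>\<^bsub>D'\<^esub> Fm F' s = t" if b: "b \<in> Obj C'" and t: "t \<in> Hom D' (Fo F' b) u" for b t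
  proof -
    have Jt: "Fm J t \<in> Hom D (Fo F (Fo I b)) (Fo J u)" using J.fm_hom[OF t] square_obj[OF b] by simp
    obtain s' where s': "s' \<in> Hom C (Fo I b) (Fo I w)" "Fm J e \<cdot>\<^bsub>D\<^esub> Fm F s' = Fm J t"
      using couniversal_factor[OF cu I.fo_obj[OF b] Jt] .
    obtain s where s: "s \<in> Hom C' b w" "Fm I s = s'" using I_lift[OF b w s'(1)] .
    have "Fm J (e \<cdot>\<^bsub>D'\<^esub> Fm F' s) = Fm J t" unfolding comp[OF s(1)] s(2) s'(2) ..
    then have "e \<cdot>\<^bsub>D'\<^esub> Fm F' s = t" by (rule J_cancel[OF F'.cod.comp_hom[OF F'.fm_hom[OF s(1)] e] t])
    with s(1) show ?thesis by blast
  qed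
  show "s = s'" if s: "s \<in> Hom C' b w" "s' \<in> Hom C' b w" and eq: "e \<cdot>\<^bsub>D'\<^esub> Fm F' s = e \<cdot>\<^bsub>D'\<^esub> Fm F' s'" for b s s'
  proof -
    have "Fm I s = Fm I s'"
      using F.couniversal_cancel[OF cu I.fm_hom[OF s(1)] I.fm_hom[OF s(2)]]
      unfolding comp[OF s(1), symmetric] comp[OF s(2), symmetric] eq by blast
    then show ?thesis by (rule I_cancel[OF s])
  qed
qed

lemma restricts_couniversal:
  assumes u: "u \<in> Obj D'"
  obtains w e where "w \<in> Obj C'" "e \<in> Hom D' (Fo F' w) u"
    "couniversal C D F (Fo J u) (Fo I w) (Fm J e)" "couniversal C' D' F' u w e"
  using restrict[OF u] reflects_couniversal[OF _ u] by blast

text \<open>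
  Since \<open>F' w\<close> lies in the subcategory, the arrow couniversal to it has its source in the subcategory, and
  all pairs identified by \<open>J e\<close> factor through a single pair that comes from \<open>C'\<close> and \<open>D'\<close>. So compatibility
  with \<open>e\<close> in the subcategories implies compatibility with \<open>J e\<close>.
\<close>

lemma restricts_quotient_arrow:
  assumes m: "monadic_left C D F" and w: "w \<in> Obj C'" and u: "u \<in> Obj D'" and e: "e \<in> Hom D' (Fo F' w) u"
    and cu: "couniversal C D F (Fo J u) (Fo I w) (Fm J e)"
  shows "quotient_arrow C' D' F' u w e"
  unfolding quotient_arrow_def
proof (intro ballI impI)
  fix v t assume v: "v \<in> Obj D'" and t: "t \<in> Hom D' (Fo F' w) v" and comp: "kernel_compatible C' D' F' w e t"
  note cu' = reflects_couniversal[OF w u e cu]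
  note F'w = F'.fo_obj[OF w]
  note sqw = square_obj[OF w]
  obtain w2 e2 where w2: "w2 \<in> Obj C'" and e2: "e2 \<in> Hom D' (Fo F' w2) (Fo F' w)"
    and cu2: "couniversal C D F (Fo J (Fo F' w)) (Fo I w2) (Fm J e2)" using restricts_couniversal[OF F'w] by metis
  obtain a where a: "a \<in> Hom C' w2 w" "e \<cdot>\<^bsub>D'\<^esub> Fm F' a = e \<cdot>\<^bsub>D'\<^esub> e2"
    using couniversal_factor[OF cu' w2 F'.cod.comp_hom[OF e2 e]] .
  have ta: "t \<cdot>\<^bsub>D'\<^esub> Fm F' a = t \<cdot>\<^bsub>D'\<^esub> e2"
    using comp w2 a e2 unfolding kernel_compatible_def by blast
  have Je: "Fm J e \<in> Hom D (Fo F (Fo I w)) (Fo J u)" and Jt: "Fm J t \<in> Hom D (Fo F (Fo I w)) (Fo J v)"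
    using J.fm_hom[OF e] J.fm_hom[OF t] sqw by auto
  have Je2: "Fm J e2 \<in> Hom D (Fo F (Fo I w2)) (Fo F (Fo I w))"
    using J.fm_hom[OF e2] square_obj[OF w2] sqw by auto
  note Ia = I.fm_hom[OF a(1)]
  have J_eq: "Fm J x \<cdot>\<^bsub>D\<^esub> Fm F (Fm I a) = Fm J x \<cdot>\<^bsub>D\<^esub> Fm J e2"
    if x: "x \<in> Hom D' (Fo F' w) y" and eq: "x \<cdot>\<^bsub>D'\<^esub> Fm F' a = x \<cdot>\<^bsub>D'\<^esub> e2" for x y
    unfolding square_hom[OF a(1)] J.fm_comp[OF F'.fm_hom[OF a(1)] x, symmetric] J.fm_comp[OF e2 x, symmetric] eq ..
  have "kernel_compatible C D F (Fo I w) (Fm J e) (Fm J t)"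
    unfolding kernel_compatible_def
  proof (intro ballI impI)
    fix c s r assume c: "c \<in> Obj C" and s: "s \<in> Hom C c (Fo I w)" and r: "r \<in> Hom D (Fo F c) (Fo F (Fo I w))"
      and eq: "Fm J e \<cdot>\<^bsub>D\<^esub> Fm F s = Fm J e \<cdot>\<^bsub>D\<^esub> r"
    obtain r' where r': "r' \<in> Hom C c (Fo I w2)" "Fm J e2 \<cdot>\<^bsub>D\<^esub> Fm F r' = r"
      using couniversal_factor[OF cu2 c r[unfolded sqw]] .
    note Fr' = F.fm_hom[OF r'(1)] and FIa = F.fm_hom[OF Ia]
    have *: "x \<cdot>\<^bsub>D\<^esub> Fm F (Fm I a \<cdot>\<^bsub>C\<^esub> r') = x \<cdot>\<^bsub>D\<^esub> r"
      if x: "x \<in> Hom D (Fo F (Fo I w)) y" and "x \<cdot>\<^bsub>D\<^esub> Fm F (Fm I a) = x \<cdot>\<^bsub>D\<^esub> Fm J e2" for x y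
      unfolding F.fm_comp[OF r'(1) Ia] r'(2)[symmetric]
      by (rule F.cod.comp_eq_extend[OF that(2) FIa x Je2 x Fr'])
    have "s = Fm I a \<cdot>\<^bsub>C\<^esub> r'"
      by (rule F.couniversal_cancel[OF cu s F.dom.comp_hom[OF r'(1) Ia]])
        (simp only: eq *[OF Je J_eq[OF e a(2)]])
    then show "Fm J t \<cdot>\<^bsub>D\<^esub> Fm F s = Fm J t \<cdot>\<^bsub>D\<^esub> r" by (simp only: *[OF Jt J_eq[OF t ta]])
  qed
  then have ex: "\<exists>!g. g \<in> Hom D (Fo J u) (Fo J v) \<and> g \<cdot>\<^bsub>D\<^esub> Fm J e = Fm J t"
    using F.monadic_leftD(2)[OF m cu] J.fo_obj[OF v] Jt unfolding quotient_arrow_def by blast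
  show "\<exists>!g. g \<in> Hom D' u v \<and> g \<cdot>\<^bsub>D'\<^esub> e = t"
  proof (rule ex_ex1I)
    obtain g' where g': "g' \<in> Hom D (Fo J u) (Fo J v)" "g' \<cdot>\<^bsub>D\<^esub> Fm J e = Fm J t" using ex by blast
    obtain g where g: "g \<in> Hom D' u v" "Fm J g = g'" using J_lift[OF u v g'(1)] .
    have "Fm J (g \<cdot>\<^bsub>D'\<^esub> e) = Fm J t" unfolding J.fm_comp[OF e g(1)] g(2) by (rule g'(2))
    then have "g \<cdot>\<^bsub>D'\<^esub> e = t" by (rule J_cancel[OF F'.cod.comp_hom[OF e g(1)] t])
    with g(1) show "\<exists>g. g \<in> Hom D' u v \<and> g \<cdot>\<^bsub>D'\<^esub> e = t" by blast
  next
    fix g1 g2 assume g: "g1 \<in> Hom D' u v \<and> g1 \<cdot>\<^bsub>D'\<^esub> e = t" "g2 \<in> Hom D' u v \<and> g2 \<cdot>\<^bsub>D'\<^esub> e = t"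
    then have "Fm J g1 \<cdot>\<^bsub>D\<^esub> Fm J e = Fm J t" "Fm J g2 \<cdot>\<^bsub>D\<^esub> Fm J e = Fm J t"
      using J.fm_comp[OF e, of g1 v] J.fm_comp[OF e, of g2 v] by auto
    then have "Fm J g1 = Fm J g2" using ex J.fm_hom g by blast
    then show "g1 = g2" using J_cancel g by blast
  qed
qed

text \<open>
  A descent datum on \<open>w\<close> extends to one on \<open>I w\<close>, because arrows \<open>F c \<rightarrow> F (I w)\<close> factor through the
  couniversal arrow \<open>J e2\<close> with source over \<open>I w2\<close>. Monadicity of \<open>F\<close> yields \<open>e : F (I w) \<rightarrow> d\<close>, the coequalizer of a pair
  of arrows of \<open>D'\<close>. A coreflective subcategory is closed under colimits: \<open>e\<close> factors through the coreflection
  \<open>\<kappa> : J u \<rightarrow> d\<close>, the factorization \<open>J n\<close> coequalizes the same pair and induces \<open>g : d \<rightarrow> J u\<close>, and \<open>g\<close> is inverse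
  to \<open>\<kappa>\<close>. So \<open>d\<close> may be replaced by \<open>J u\<close>.
\<close>

lemma restricts_descent:
  assumes m: "monadic_left C D F" and dd': "descent_datum C' D' F' w \<alpha>'"
  shows "\<exists>u e. couniversal C' D' F' u w e
    \<and> (\<forall>w' \<in> Obj C'. \<forall>x \<in> Hom D' (Fo F' w') (Fo F' w). e \<cdot>\<^bsub>D'\<^esub> Fm F' (\<alpha>' w' x) = e \<cdot>\<^bsub>D'\<^esub> x)"
proof -
  note A = descent_datumD[OF dd']
  note w = A(1)
  note F'w = F'.fo_obj[OF w] and Iw = I.fo_obj[OF w] and sqw = square_obj[OF w]
  obtain w2 e2 where w2: "w2 \<in> Obj C'" and e2: "e2 \<in> Hom D' (Fo F' w2) (Fo F' w)"
    and cu2: "couniversal C D F (Fo J (Fo F' w)) (Fo I w2) (Fm J e2)"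
    and cu2': "couniversal C' D' F' (Fo F' w) w2 e2" using restricts_couniversal[OF F'w] .
  have Je2: "Fm J e2 \<in> Hom D (Fo F (Fo I w2)) (Fo F (Fo I w))"
    using J.fm_hom[OF e2] square_obj[OF w2] sqw by auto
  define a where "a = \<alpha>' w2 e2"
  have a: "a \<in> Hom C' w2 w" unfolding a_def by (rule A(2)[OF w2 e2])
  note Ia = I.fm_hom[OF a]
  have cu2: "couniversal C D F (Fo F (Fo I w)) (Fo I w2) (Fm J e2)" using cu2 sqw by simp
  have "\<exists>k. c \<in> Obj C \<and> r \<in> Hom D (Fo F c) (Fo F (Fo I w)) \<longrightarrow> k \<in> Hom C c (Fo I w2) \<and> Fm J e2 \<cdot>\<^bsub>D\<^esub> Fm F k = r" for c r
    using couniversal_factor[OF cu2] by metis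
  then obtain \<phi> where phi: "\<And>c r. c \<in> Obj C \<Longrightarrow> r \<in> Hom D (Fo F c) (Fo F (Fo I w)) \<Longrightarrow> \<phi> c r \<in> Hom C c (Fo I w2)"
    and e_phi: "\<And>c r. c \<in> Obj C \<Longrightarrow> r \<in> Hom D (Fo F c) (Fo F (Fo I w)) \<Longrightarrow> Fm J e2 \<cdot>\<^bsub>D\<^esub> Fm F (\<phi> c r) = r"
    by metis
  \<comment> \<open>The extended datum factors \<open>r\<close> through \<open>J e2\<close> and applies the given datum to \<open>e2\<close>.\<close>
  define \<alpha> where "\<alpha> = (\<lambda>c r. Fm I a \<cdot>\<^bsub>C\<^esub> \<phi> c r)"
  have JF': "Fm J x \<in> Hom D (Fo F (Fo I w')) (Fo F (Fo I w''))"
    if "x \<in> Hom D' (Fo F' w') (Fo F' w'')" "w' \<in> Obj C'" "w'' \<in> Obj C'" for x w' w''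
    using J.fm_hom[OF that(1)] square_obj that by simp
  \<comment> \<open>This formula determines \<open>\<alpha>\<close> and reduces its equations to those of \<open>\<alpha>'\<close>.\<close>
  have alpha_ext: "\<alpha> c (Fm J x \<cdot>\<^bsub>D\<^esub> Fm F l) = Fm I (\<alpha>' w' x) \<cdot>\<^bsub>C\<^esub> l"
    if x: "x \<in> Hom D' (Fo F' w') (Fo F' w)" and l: "l \<in> Hom C c (Fo I w')" and w': "w' \<in> Obj C'" for x l w' c
  proof -
    note c = F.dom.hom_obj(1)[OF l]
    obtain n where n: "n \<in> Hom C' w' w2" "e2 \<cdot>\<^bsub>D'\<^esub> Fm F' n = x" using couniversal_factor[OF cu2' w' x] .
    note In = I.fm_hom[OF n(1)]
    have r: "Fm J x \<cdot>\<^bsub>D\<^esub> Fm F l \<in> Hom D (Fo F c) (Fo F (Fo I w))"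
      by (rule F.cod.comp_hom[OF F.fm_hom[OF l] JF'[OF x w' w]])
    have "Fm J x = Fm J e2 \<cdot>\<^bsub>D\<^esub> Fm F (Fm I n)"
      unfolding n(2)[symmetric] J.fm_comp[OF F'.fm_hom[OF n(1)] e2] square_hom[OF n(1)] ..
    then have "Fm J e2 \<cdot>\<^bsub>D\<^esub> Fm F (\<phi> c (Fm J x \<cdot>\<^bsub>D\<^esub> Fm F l)) = Fm J e2 \<cdot>\<^bsub>D\<^esub> Fm F (Fm I n \<cdot>\<^bsub>C\<^esub> l)"
      unfolding e_phi[OF c r] F.fm_comp[OF l In]
      using F.cod.comp_assoc[OF F.fm_hom[OF l] F.fm_hom[OF In] Je2] by simp
    then have "\<phi> c (Fm J x \<cdot>\<^bsub>D\<^esub> Fm F l) = Fm I n \<cdot>\<^bsub>C\<^esub> l"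
      by (rule F.couniversal_cancel[OF cu2 phi[OF c r] F.dom.comp_hom[OF l In]])
    then have 1: "\<alpha> c (Fm J x \<cdot>\<^bsub>D\<^esub> Fm F l) = Fm I (a \<cdot>\<^bsub>C'\<^esub> n) \<cdot>\<^bsub>C\<^esub> l"
      unfolding \<alpha>_def I.fm_comp[OF n(1) a] F.dom.comp_assoc[OF l In Ia] by simp
    note an = F'.dom.comp_hom[OF n(1) a]
    have "a \<cdot>\<^bsub>C'\<^esub> n = \<alpha>' w' (Fm F' (a \<cdot>\<^bsub>C'\<^esub> n))" by (rule A(3)[OF w' an, symmetric])
    also have "\<dots> = \<alpha>' w' x"
      using A(4)[OF w' w2 F'.fm_hom[OF n(1)] e2] F'.fm_comp[OF n(1) a] n(2) by (simp add: a_def)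
    finally show ?thesis using 1 by simp
  qed
  have alpha_J: "\<alpha> (Fo I w') (Fm J x) = Fm I (\<alpha>' w' x)"
    if x: "x \<in> Hom D' (Fo F' w') (Fo F' w)" and w': "w' \<in> Obj C'" for x w'
  proof -
    note i = F.dom.ident_hom[OF I.fo_obj[OF w']]
    have "Fm J x \<cdot>\<^bsub>D\<^esub> Fm F (Ident C (Fo I w')) = Fm J x"
      using F.cod.comp_ident_right[OF JF'[OF x w' w]] F.fm_ident[OF I.fo_obj[OF w']] by simp
    then show ?thesis
      using alpha_ext[OF x i w'] F.dom.comp_ident_right[OF I.fm_hom[OF A(2)[OF w' x]]] by simp
  qed
  have dd: "descent_datum C D F (Fo I w) \<alpha>"
    unfolding descent_datum_def
  proof (intro conjI ballI)
    show "Fo I w \<in> Obj C" by (rule Iw)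
    show al: "\<alpha> c r \<in> Hom C c (Fo I w)" if "c \<in> Obj C" "r \<in> Hom D (Fo F c) (Fo F (Fo I w))" for c r
      unfolding \<alpha>_def by (rule F.dom.comp_hom[OF phi[OF that] Ia])
    show "\<alpha> c (Fm F k) = k" if k: "k \<in> Hom C c (Fo I w)" for c k
    proof -
      note i = F'.cod.ident_hom[OF F'w]
      have "Fm J (Ident D' (Fo F' w)) \<cdot>\<^bsub>D\<^esub> Fm F k = Fm F k"
        unfolding J.fm_ident[OF F'w] sqw[symmetric] by (rule F.cod.comp_ident_left[OF F.fm_hom[OF k]])
      moreover have "\<alpha>' w (Ident D' (Fo F' w)) = Ident C' w"
        using A(3)[OF w F'.dom.ident_hom[OF w]] F'.fm_ident[OF w] by simp
      ultimately show ?thesis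
        using alpha_ext[OF i k w] I.fm_ident[OF w] F.dom.comp_ident_left[OF k] by simp
    qed
    fix c' c'' r s assume c': "c' \<in> Obj C" and c'': "c'' \<in> Obj C" and r: "r \<in> Hom D (Fo F c') (Fo F c'')"
      and s: "s \<in> Hom D (Fo F c'') (Fo F (Fo I w))"
    note k = phi[OF c'' s]
    note Fk = F.fm_hom[OF k]
    note F'w2 = F'.fo_obj[OF w2]
    \<comment> \<open>The source of \<open>r\<close> is arbitrary, but its composite into \<open>J (F' w2)\<close> factors through an arrow of \<open>D'\<close>.\<close>
    obtain w3 e3 where w3: "w3 \<in> Obj C'" and e3: "e3 \<in> Hom D' (Fo F' w3) (Fo F' w2)"
      and cu3: "couniversal C D F (Fo J (Fo F' w2)) (Fo I w3) (Fm J e3)" using restricts_couniversal[OF F'w2] .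
    have kr: "Fm F (\<phi> c'' s) \<cdot>\<^bsub>D\<^esub> r \<in> Hom D (Fo F c') (Fo J (Fo F' w2))"
      using F.cod.comp_hom[OF r Fk] square_obj[OF w2] by simp
    obtain l where l: "l \<in> Hom C c' (Fo I w3)" "Fm J e3 \<cdot>\<^bsub>D\<^esub> Fm F l = Fm F (\<phi> c'' s) \<cdot>\<^bsub>D\<^esub> r"
      using couniversal_factor[OF cu3 c' kr] .
    note Je3 = JF'[OF e3 w3 w2] and Fl = F.fm_hom[OF l(1)]
    have eq: "(Fm J x \<cdot>\<^bsub>D\<^esub> Fm F (\<phi> c'' s)) \<cdot>\<^bsub>D\<^esub> r = Fm J (x \<cdot>\<^bsub>D'\<^esub> e3) \<cdot>\<^bsub>D\<^esub> Fm F l"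
      if x: "x \<in> Hom D' (Fo F' w2) (Fo F' w)" for x
      unfolding J.fm_comp[OF e3 x] F.cod.comp_assoc[OF r Fk JF'[OF x w2 w]] l(2)[symmetric]
      by (rule F.cod.comp_assoc[OF Fl Je3 JF'[OF x w2 w], symmetric])
    have "Fm F (\<alpha> c'' s) = Fm J (Fm F' a) \<cdot>\<^bsub>D\<^esub> Fm F (\<phi> c'' s)"
      unfolding \<alpha>_def F.fm_comp[OF k Ia] square_hom[OF a] ..
    then have "\<alpha> c' (Fm F (\<alpha> c'' s) \<cdot>\<^bsub>D\<^esub> r) = \<alpha> c' (Fm J (Fm F' a \<cdot>\<^bsub>D'\<^esub> e3) \<cdot>\<^bsub>D\<^esub> Fm F l)"
      by (simp only: eq[OF F'.fm_hom[OF a]])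
    also have "\<dots> = Fm I (\<alpha>' w3 (Fm F' a \<cdot>\<^bsub>D'\<^esub> e3)) \<cdot>\<^bsub>C\<^esub> l"
      by (rule alpha_ext[OF F'.cod.comp_hom[OF e3 F'.fm_hom[OF a]] l(1) w3])
    also have "\<dots> = Fm I (\<alpha>' w3 (e2 \<cdot>\<^bsub>D'\<^esub> e3)) \<cdot>\<^bsub>C\<^esub> l"
      unfolding a_def A(4)[OF w3 w2 e3 e2] ..
    also have "\<dots> = \<alpha> c' (Fm J (e2 \<cdot>\<^bsub>D'\<^esub> e3) \<cdot>\<^bsub>D\<^esub> Fm F l)"
      by (rule alpha_ext[OF F'.cod.comp_hom[OF e3 e2] l(1) w3, symmetric])
    also have "\<dots> = \<alpha> c' (s \<cdot>\<^bsub>D\<^esub> r)"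
      unfolding eq[OF e2, symmetric] e_phi[OF c'' s] ..
    finally show "\<alpha> c' (Fm F (\<alpha> c'' s) \<cdot>\<^bsub>D\<^esub> r) = \<alpha> c' (s \<cdot>\<^bsub>D\<^esub> r)" .
  qed
  obtain d e where cu: "couniversal C D F d (Fo I w) e"
    and e_alpha: "\<And>c r. \<lbrakk>c \<in> Obj C; r \<in> Hom D (Fo F c) (Fo F (Fo I w))\<rbrakk> \<Longrightarrow> e \<cdot>\<^bsub>D\<^esub> Fm F (\<alpha> c r) = e \<cdot>\<^bsub>D\<^esub> r"
    using m dd unfolding monadic_left_def by meson
  note d = couniversalD(2)[OF cu] and e = couniversalD(3)[OF cu]
  obtain u \<kappa> where co: "couniversal D' D J d u \<kappa>" using J_coreflective[OF d] by blast
  note u = couniversalD(1)[OF co] and kap = couniversalD(3)[OF co]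
  obtain n where n: "n \<in> Hom D' (Fo F' w) u" "\<kappa> \<cdot>\<^bsub>D\<^esub> Fm J n = e"
    using couniversal_factor[OF co F'w e[unfolded sqw]] .
  have Jn: "Fm J n \<in> Hom D (Fo F (Fo I w)) (Fo J u)" using J.fm_hom[OF n(1)] sqw by simp
  have e_comp: "\<kappa> \<cdot>\<^bsub>D\<^esub> (Fm J n \<cdot>\<^bsub>D\<^esub> x) = e \<cdot>\<^bsub>D\<^esub> x" if "x \<in> Hom D y (Fo F (Fo I w))" for x y
    using F.cod.comp_assoc[OF that Jn kap] n(2) by simp
  have F'a: "Fm F' a \<in> Hom D' (Fo F' w2) (Fo F' w)" by (rule F'.fm_hom[OF a])
  \<comment> \<open>Both sides have source in \<open>D'\<close>, where the coreflection \<open>\<kappa>\<close> may be cancelled.\<close>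
  have na: "n \<cdot>\<^bsub>D'\<^esub> Fm F' a = n \<cdot>\<^bsub>D'\<^esub> e2"
  proof (rule J.couniversal_cancel[OF co F'.cod.comp_hom[OF F'a n(1)] F'.cod.comp_hom[OF e2 n(1)]])
    have "Fm I a = \<alpha> (Fo I w2) (Fm J e2)" unfolding alpha_J[OF e2 w2] a_def ..
    then show "\<kappa> \<cdot>\<^bsub>D\<^esub> Fm J (n \<cdot>\<^bsub>D'\<^esub> Fm F' a) = \<kappa> \<cdot>\<^bsub>D\<^esub> Fm J (n \<cdot>\<^bsub>D'\<^esub> e2)"
      unfolding J.fm_comp[OF F'a n(1)] J.fm_comp[OF e2 n(1)] square_hom[OF a, symmetric]
        e_comp[OF F.fm_hom[OF Ia]] e_comp[OF Je2]
      using e_alpha[OF I.fo_obj[OF w2] Je2] by simp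
  qed
  have J_na: "Fm J n \<cdot>\<^bsub>D\<^esub> Fm F (Fm I a) = Fm J n \<cdot>\<^bsub>D\<^esub> Fm J e2"
    unfolding square_hom[OF a] J.fm_comp[OF F'a n(1), symmetric] J.fm_comp[OF e2 n(1), symmetric] na ..
  have n_alpha: "Fm J n \<cdot>\<^bsub>D\<^esub> Fm F (\<alpha> c r) = Fm J n \<cdot>\<^bsub>D\<^esub> r"
    if c: "c \<in> Obj C" and r: "r \<in> Hom D (Fo F c) (Fo F (Fo I w))" for c r
  proof -
    note k = phi[OF c r]
    have "Fm J n \<cdot>\<^bsub>D\<^esub> Fm F (\<alpha> c r) = Fm J n \<cdot>\<^bsub>D\<^esub> (Fm J e2 \<cdot>\<^bsub>D\<^esub> Fm F (\<phi> c r))"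
      unfolding \<alpha>_def F.fm_comp[OF k Ia]
      by (rule F.cod.comp_eq_extend[OF J_na F.fm_hom[OF Ia] Jn Je2 Jn F.fm_hom[OF k]])
    then show ?thesis unfolding e_phi[OF c r] .
  qed
  have "kernel_compatible C D F (Fo I w) e (Fm J n)"
    unfolding kernel_compatible_def
  proof (intro ballI impI)
    fix c s r assume c: "c \<in> Obj C" and s: "s \<in> Hom C c (Fo I w)" and r: "r \<in> Hom D (Fo F c) (Fo F (Fo I w))"
      and eq: "e \<cdot>\<^bsub>D\<^esub> Fm F s = e \<cdot>\<^bsub>D\<^esub> r"
    have "s = \<alpha> c r"
      by (rule F.couniversal_cancel[OF cu s descent_datumD(2)[OF dd c r]]) (simp only: eq e_alpha[OF c r])
    then show "Fm J n \<cdot>\<^bsub>D\<^esub> Fm F s = Fm J n \<cdot>\<^bsub>D\<^esub> r" by (simp only: n_alpha[OF c r])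
  qed
  then obtain g where g: "g \<in> Hom D d (Fo J u)" "g \<cdot>\<^bsub>D\<^esub> e = Fm J n"
    using F.monadic_leftD(2)[OF m cu] J.fo_obj[OF u] Jn unfolding quotient_arrow_def by blast
  note gk = F.cod.comp_hom[OF kap g(1)]
  have kg: "\<kappa> \<cdot>\<^bsub>D\<^esub> g = Ident D d"
  proof -
    have "kernel_compatible C D F (Fo I w) e e" by (simp add: kernel_compatible_def)
    then have "\<exists>!h. h \<in> Hom D d d \<and> h \<cdot>\<^bsub>D\<^esub> e = e"
      using F.monadic_leftD(2)[OF m cu] d e unfolding quotient_arrow_def by blast
    moreover have "(\<kappa> \<cdot>\<^bsub>D\<^esub> g) \<cdot>\<^bsub>D\<^esub> e = e"
      using F.cod.comp_assoc[OF e g(1) kap] g(2) n(2) by simp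
    ultimately show ?thesis
      using F.cod.comp_hom[OF g(1) kap] F.cod.ident_hom[OF d] F.cod.comp_ident_left[OF e] by blast
  qed
  have gk1: "g \<cdot>\<^bsub>D\<^esub> \<kappa> = Ident D (Fo J u)"
  proof -
    obtain q where q: "q \<in> Hom D' u u" "Fm J q = g \<cdot>\<^bsub>D\<^esub> \<kappa>" using J_lift[OF u u gk] .
    have "\<kappa> \<cdot>\<^bsub>D\<^esub> Fm J q = \<kappa> \<cdot>\<^bsub>D\<^esub> Fm J (Ident D' u)"
      unfolding q(2) J.fm_ident[OF u] F.cod.comp_assoc[OF kap g(1) kap, symmetric] kg
        F.cod.comp_ident_left[OF kap] F.cod.comp_ident_right[OF kap] ..
    then have "q = Ident D' u" by (rule J.couniversal_cancel[OF co q(1) F'.cod.ident_hom[OF u]])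
    then show ?thesis using q(2) J.fm_ident[OF u] by simp
  qed
  have cu_n: "couniversal C D F (Fo J u) (Fo I w) (Fm J n)"
  proof (rule F.couniversalI[OF Iw J.fo_obj[OF u] Jn])
    show "\<exists>s. s \<in> Hom C c (Fo I w) \<and> Fm J n \<cdot>\<^bsub>D\<^esub> Fm F s = t"
      if c: "c \<in> Obj C" and t: "t \<in> Hom D (Fo F c) (Fo J u)" for c t
    proof -
      obtain s where s: "s \<in> Hom C c (Fo I w)" "e \<cdot>\<^bsub>D\<^esub> Fm F s = \<kappa> \<cdot>\<^bsub>D\<^esub> t"
        using couniversal_factor[OF cu c F.cod.comp_hom[OF t kap]] .
      have "Fm J n \<cdot>\<^bsub>D\<^esub> Fm F s = g \<cdot>\<^bsub>D\<^esub> (\<kappa> \<cdot>\<^bsub>D\<^esub> t)"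
        unfolding g(2)[symmetric] F.cod.comp_assoc[OF F.fm_hom[OF s(1)] e g(1)] s(2) ..
      then have "Fm J n \<cdot>\<^bsub>D\<^esub> Fm F s = t" unfolding F.cod.comp_ident_extend[OF gk1 kap g(1) t] .
      with s(1) show ?thesis by blast
    qed
    show "s = s'" if s: "s \<in> Hom C c (Fo I w)" "s' \<in> Hom C c (Fo I w)"
      and eq: "Fm J n \<cdot>\<^bsub>D\<^esub> Fm F s = Fm J n \<cdot>\<^bsub>D\<^esub> Fm F s'" for c s s'
      by (rule F.couniversal_cancel[OF cu s])
        (simp only: e_comp[OF F.fm_hom[OF s(1)], symmetric] e_comp[OF F.fm_hom[OF s(2)], symmetric] eq)
  qed
  have "n \<cdot>\<^bsub>D'\<^esub> Fm F' (\<alpha>' w' x) = n \<cdot>\<^bsub>D'\<^esub> x"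
    if w': "w' \<in> Obj C'" and x: "x \<in> Hom D' (Fo F' w') (Fo F' w)" for w' x
  proof (rule J_cancel)
    note ax = A(2)[OF w' x]
    note F'ax = F'.fm_hom[OF ax]
    show "n \<cdot>\<^bsub>D'\<^esub> Fm F' (\<alpha>' w' x) \<in> Hom D' (Fo F' w') u" by (rule F'.cod.comp_hom[OF F'ax n(1)])
    show "n \<cdot>\<^bsub>D'\<^esub> x \<in> Hom D' (Fo F' w') u" by (rule F'.cod.comp_hom[OF x n(1)])
    show "Fm J (n \<cdot>\<^bsub>D'\<^esub> Fm F' (\<alpha>' w' x)) = Fm J (n \<cdot>\<^bsub>D'\<^esub> x)"
      unfolding J.fm_comp[OF F'ax n(1)] J.fm_comp[OF x n(1)] square_hom[OF ax, symmetric] alpha_J[OF x w', symmetric]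
      by (rule n_alpha[OF I.fo_obj[OF w'] JF'[OF x w' w]])
  qed
  with reflects_couniversal[OF w u n(1) cu_n] show ?thesis by blast
qed

theorem restricts_monadic_left:
  assumes m: "monadic_left C D F"
  shows "monadic_left C' D' F'"
  unfolding monadic_left_def
proof (intro conjI ballI allI impI)
  show "\<exists>w e. couniversal C' D' F' u w e \<and> quotient_arrow C' D' F' u w e" if u: "u \<in> Obj D'" for u
    using restricts_couniversal[OF u] restricts_quotient_arrow[OF m _ u] by metis
qed (rule restricts_descent[OF m])

end

section \<open>Effective descent in terms of the push functor on slices\<close>

context category begin

lemma slice_obj: "u \<in> Obj (slice C b) \<longleftrightarrow> u \<in> Hom C (Dom C u) b"
  by (auto simp: slice_def hom_iff)

lemma slice_hom: "f \<in> Hom (slice C b) u v \<longleftrightarrow> (\<exists>h. f = (u, h, v) \<and> u \<in> Obj (slice C b) \<and> v \<in> Obj (slice C b)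
    \<and> h \<in> Hom C (Dom C u) (Dom C v) \<and> v \<cdot> h = u)"
  by (auto simp: slice_def hom_iff)

lemma slice_simps: "(w', k, v) \<cdot>\<^bsub>slice C b\<^esub> (u, h, w) = (u, k \<cdot> h, v)"
  "Ident (slice C b) u = (u, Ident C (Dom C u), u)"
  by (simp_all add: slice_def)

lemma slice_push_simps: "Fo (slice_push C p) u = p \<cdot> u" "Fm (slice_push C p) (u, h, v) = (p \<cdot> u, h, p \<cdot> v)"
  by (simp_all add: slice_push_def)

text \<open>
  An arrow from \<open>p \<cdot> u'\<close> to \<open>g\<close> over the codomain of \<open>p\<close> is a commutative square, so couniversality of such an
  arrow is the universal property of a pullback.
\<close>

lemma pullback_of_couniversal:
  assumes p: "p \<in> Hom C a b"
    and cu: "couniversal (slice C a) (slice C b) (slice_push C p) g u e"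
  shows "\<exists>v. is_pullback C p g u v"
proof -
  note U = couniversalD[OF cu]
  have u: "u \<in> Hom C (Dom C u) a" and g: "g \<in> Hom C (Dom C g) b" using U unfolding slice_obj by auto
  obtain v where e: "e = (p \<cdot> u, v, g)" and v: "v \<in> Hom C (Dom C (p \<cdot> u)) (Dom C g)" and sq: "g \<cdot> v = p \<cdot> u"
    using U(3) unfolding slice_hom slice_push_simps by blast
  have v: "v \<in> Hom C (Dom C u) (Dom C g)" using v u p by (simp add: hom_iff)
  have "\<exists>!w. w \<in> Hom C (Dom C u') (Dom C u) \<and> u \<cdot> w = u' \<and> v \<cdot> w = v'"
    if u': "u' \<in> Arr C" "Cod C u' = a" and v': "v' \<in> Arr C" "Cod C v' = Dom C g" "Dom C u' = Dom C v'"
      and eq: "p \<cdot> u' = g \<cdot> v'" for u' v'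
  proof -
    have ob: "u' \<in> Obj (slice C a)" using u' by (simp add: slice_obj hom_iff)
    have pu': "p \<cdot> u' \<in> Hom C (Dom C u') b" using u' p by (simp add: hom_iff)
    then have "(p \<cdot> u', v', g) \<in> Hom (slice C b) (Fo (slice_push C p) u') g"
      using U(2) v' eq unfolding slice_hom slice_push_simps slice_obj by (auto simp: hom_iff)
    then have ex: "\<exists>!s. s \<in> Hom (slice C a) u' u \<and> e \<cdot>\<^bsub>slice C b\<^esub> Fm (slice_push C p) s = (p \<cdot> u', v', g)"
      using cu ob unfolding couniversal_def by blast
    have iff: "((u', w, u) \<in> Hom (slice C a) u' u \<and> e \<cdot>\<^bsub>slice C b\<^esub> Fm (slice_push C p) (u', w, u) = (p \<cdot> u', v', g))
      \<longleftrightarrow> w \<in> Hom C (Dom C u') (Dom C u) \<and> u \<cdot> w = u' \<and> v \<cdot> w = v'" for w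
      using ob U(1) unfolding slice_hom e slice_push_simps slice_simps by auto
    have form: "\<exists>w. s = (u', w, u)" if "s \<in> Hom (slice C a) u' u" for s
      using that unfolding slice_hom by blast
    show ?thesis
    proof (rule ex_ex1I)
      show "\<exists>w. w \<in> Hom C (Dom C u') (Dom C u) \<and> u \<cdot> w = u' \<and> v \<cdot> w = v'"
        using ex form iff by metis
      show "w = w'" if "w \<in> Hom C (Dom C u') (Dom C u) \<and> u \<cdot> w = u' \<and> v \<cdot> w = v'"
        "w' \<in> Hom C (Dom C u') (Dom C u) \<and> u \<cdot> w' = u' \<and> v \<cdot> w' = v'" for w w'
        using that ex unfolding iff[symmetric] by blast
    qed
  qed
  then have "is_pullback C p g u v"
    using p u g v sq unfolding is_pullback_def by (auto simp: hom_iff)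
  then show ?thesis by blast
qed

lemma effective_descent_iff_monadic_left:
  "effective_descent C p \<longleftrightarrow> p \<in> Arr C \<and> monadic_left (slice C (Dom C p)) (slice C (Cod C p)) (slice_push C p)"
proof
  assume "effective_descent C p"
  then show "p \<in> Arr C \<and> monadic_left (slice C (Dom C p)) (slice C (Cod C p)) (slice_push C p)"
    unfolding effective_descent_def using adjunction.monadic_left_of_comparison by blast
next
  assume "p \<in> Arr C \<and> monadic_left (slice C (Dom C p)) (slice C (Cod C p)) (slice_push C p)"
  then have p: "p \<in> Hom C (Dom C p) (Cod C p)"
    and m: "monadic_left (slice C (Dom C p)) (slice C (Cod C p)) (slice_push C p)" by (auto simp: hom_iff)
  interpret push: cat_functor "slice C (Dom C p)" "slice C (Cod C p)" "slice_push C p"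
    by (rule slice_push_functor[OF p])
  have "has_pullbacks_along C p"
    unfolding has_pullbacks_along_def
  proof (intro ballI impI)
    fix g assume "g \<in> Arr C" "Cod C g = Cod C p"
    then have "g \<in> Obj (slice C (Cod C p))" by (simp add: slice_obj hom_iff)
    then show "\<exists>u v. is_pullback C p g u v"
      using push.monadic_leftD(1)[OF m] pullback_of_couniversal[OF p] by meson
  qed
  moreover obtain G \<eta> \<epsilon> where "adjunction (slice C (Dom C p)) (slice C (Cod C p)) (slice_push C p) G \<eta> \<epsilon>"
    using push.adjunction_of_couniversal[OF push.monadic_leftD(1)[OF m]] by blast
  ultimately show "effective_descent C p"
    using p m adjunction.comparison_of_monadic_left unfolding effective_descent_def hom_iff by blast
qed

end

section \<open>Functors with discrete objects\<close>

text \<open>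
  As for discrete topological spaces over sets: all maps out of the object are continuous.
\<close>

definition discrete :: "('o1, 'm1, 'z1) cat_scheme \<Rightarrow> ('o2, 'm2, 'z2) cat_scheme
    \<Rightarrow> ('o1, 'm1, 'o2, 'm2) fctr \<Rightarrow> 'o1 \<Rightarrow> bool" where
  "discrete E A U X \<longleftrightarrow> X \<in> Obj E
     \<and> (\<forall>Z \<in> Obj E. \<forall>p \<in> Hom A (Fo U X) (Fo U Z). \<exists>!f. f \<in> Hom E X Z \<and> Fm U f = p)"

text \<open>
  The discrete objects provide a left adjoint section of \<open>U\<close>, so that \<open>A\<close> is a full coreflective subcategory of
  \<open>E\<close>; moreover it is a sieve up to isomorphism.
\<close>

locale discrete_objects = cat_functor E A U
  for E :: "('o1, 'm1, 'z1) cat_scheme" and A :: "('o2, 'm2, 'z2) cat_scheme" and U +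
  fixes disc :: "'o2 \<Rightarrow> 'o1"
  assumes discrete_disc: "a \<in> Obj A \<Longrightarrow> discrete E A U (disc a)"
    and proj_disc: "a \<in> Obj A \<Longrightarrow> Fo U (disc a) = a"
    and discrete_sieve: "\<lbrakk>f \<in> Hom E X Y; discrete E A U Y\<rbrakk> \<Longrightarrow> discrete E A U X"
begin

lemma discrete_lift:
  assumes "discrete E A U X" "Z \<in> Obj E" "p \<in> Hom A (Fo U X) (Fo U Z)"
  obtains f where "f \<in> Hom E X Z" "Fm U f = p"
  using assms unfolding discrete_def by metis

lemma discrete_cancel:
  assumes "discrete E A U X" "f \<in> Hom E X Z" "g \<in> Hom E X Z" "Fm U f = Fm U g"
  shows "f = g"
proof -
  have "Z \<in> Obj E" "Fm U f \<in> Hom A (Fo U X) (Fo U Z)" using assms dom.hom_obj fm_hom by blast+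
  then show ?thesis using assms unfolding discrete_def by metis
qed

definition lift :: "'o2 \<Rightarrow> 'o1 \<Rightarrow> 'm2 \<Rightarrow> 'm1" where
  "lift a Z p = (THE f. f \<in> Hom E (disc a) Z \<and> Fm U f = p)"

lemma lift:
  assumes Z: "Z \<in> Obj E" and p: "p \<in> Hom A a (Fo U Z)"
  shows lift_hom: "lift a Z p \<in> Hom E (disc a) Z" and proj_lift: "Fm U (lift a Z p) = p"
proof -
  have a: "a \<in> Obj A" by (rule cod.hom_obj[OF p])
  have "\<exists>!f. f \<in> Hom E (disc a) Z \<and> Fm U f = p"
    using discrete_disc[OF a] Z p unfolding discrete_def proj_disc[OF a] by blast
  from theI'[OF this] show "lift a Z p \<in> Hom E (disc a) Z" "Fm U (lift a Z p) = p"
    unfolding lift_def by auto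
qed

lemma lift_eqI:
  assumes f: "f \<in> Hom E (disc a) Z" and a: "a \<in> Obj A" and p: "Fm U f = p"
  shows "lift a Z p = f"
proof -
  have "p \<in> Hom A a (Fo U Z)" using fm_hom[OF f] p proj_disc[OF a] by simp
  with discrete_cancel[OF discrete_disc[OF a] lift_hom f] proj_lift p dom.hom_obj(2)[OF f]
  show ?thesis by metis
qed

lemma disc_obj: "a \<in> Obj A \<Longrightarrow> disc a \<in> Obj E"
  using discrete_disc by (simp add: discrete_def)

lemma comp_lift:
  assumes Z: "Z \<in> Obj E" and p: "p \<in> Hom A a (Fo U Z)" and f: "f \<in> Hom E Z Y"
  shows "f \<cdot>\<^bsub>E\<^esub> lift a Z p = lift a Y (Fm U f \<cdot>\<^bsub>A\<^esub> p)"
  by (rule lift_eqI[symmetric, OF dom.comp_hom[OF lift_hom[OF Z p] f]])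
    (use cod.hom_obj[OF p] fm_comp[OF lift_hom[OF Z p] f] proj_lift[OF Z p] in auto)

lemma lift_comp:
  assumes Z: "Z \<in> Obj E" and p: "p \<in> Hom A a (Fo U Z)" and h: "h \<in> Hom A b a"
  shows "lift a Z p \<cdot>\<^bsub>E\<^esub> lift b (disc a) h = lift b Z (p \<cdot>\<^bsub>A\<^esub> h)"
proof -
  have ob: "a \<in> Obj A" "b \<in> Obj A" using cod.hom_obj p h by auto
  have h': "h \<in> Hom A b (Fo U (disc a))" using h proj_disc[OF ob(1)] by simp
  show ?thesis
    using comp_lift[OF disc_obj[OF ob(1)] h' lift_hom[OF Z p]] by (simp add: proj_lift[OF Z p])
qed

text \<open>
  The embedding of \<open>A\<close> in \<open>E\<close> induces one of the slice over \<open>U X\<close> in the slice over \<open>X\<close>: an arrow to \<open>U X\<close> lifts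
  to \<open>X\<close> from the discrete object over its source.
\<close>

definition slice_lift :: "'o1 \<Rightarrow> ('m2, 'm2 \<times> 'm2 \<times> 'm2, 'm1, 'm1 \<times> 'm1 \<times> 'm1) fctr" where
  "slice_lift X = \<lparr>Fo = (\<lambda>u. lift (Dom A u) X u),
     Fm = (\<lambda>(u, h, v). (lift (Dom A u) X u, lift (Dom A u) (disc (Dom A v)) h, lift (Dom A v) X v))\<rparr>"

lemma slice_lift_simps:
  "Fo (slice_lift X) u = lift (Dom A u) X u"
  "Fm (slice_lift X) (u, h, v) = (lift (Dom A u) X u, lift (Dom A u) (disc (Dom A v)) h, lift (Dom A v) X v)"
  by (simp_all add: slice_lift_def)

lemma slice_lift_functor:
  assumes X: "X \<in> Obj E"
  shows "cat_functor (slice A (Fo U X)) (slice E X) (slice_lift X)"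
proof -
  interpret S: category "slice A (Fo U X)" by (rule cod.category_slice)
  interpret T: category "slice E X" by (rule dom.category_slice)
  have dl: "Dom E (lift (Dom A u) X u) = disc (Dom A u)" if "u \<in> Hom A (Dom A u) (Fo U X)" for u
    using lift_hom[OF X that] by (simp add: hom_iff)
  have fo: "Fo (slice_lift X) u \<in> Obj (slice E X)" if "u \<in> Obj (slice A (Fo U X))" for u
    using lift_hom[OF X that[unfolded cod.slice_obj]] unfolding slice_lift_simps dom.slice_obj by (simp add: hom_iff)
  show ?thesis
  proof
    show "Fo (slice_lift X) u \<in> Obj (slice E X)" if "u \<in> Obj (slice A (Fo U X))" for u by (rule fo[OF that])
    show "Fm (slice_lift X) f \<in> Hom (slice E X) (Fo (slice_lift X) u) (Fo (slice_lift X) v)"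
      if "f \<in> Hom (slice A (Fo U X)) u v" for f u v
    proof -
      obtain h where f: "f = (u, h, v)" and ob: "u \<in> Obj (slice A (Fo U X))" "v \<in> Obj (slice A (Fo U X))"
        and h: "h \<in> Hom A (Dom A u) (Dom A v)" and uv: "v \<cdot>\<^bsub>A\<^esub> h = u"
        using \<open>f \<in> _\<close> unfolding cod.slice_hom by blast
      note u = ob(1)[unfolded cod.slice_obj] and v = ob(2)[unfolded cod.slice_obj]
      note dob = cod.hom_obj[OF h]
      have "lift (Dom A u) (disc (Dom A v)) h \<in> Hom E (disc (Dom A u)) (disc (Dom A v))"
        by (rule lift_hom[OF disc_obj[OF dob(2)]]) (use h proj_disc dob in simp)
      then show ?thesis using fo[OF ob(1)] fo[OF ob(2)] lift_comp[OF X v h]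
        unfolding dom.slice_hom f slice_lift_simps dl[OF u] dl[OF v] uv by blast
    qed
    show "Fm (slice_lift X) (Ident (slice A (Fo U X)) u) = Ident (slice E X) (Fo (slice_lift X) u)"
      if "u \<in> Obj (slice A (Fo U X))" for u
    proof -
      note u = that[unfolded cod.slice_obj]
      note a = cod.hom_obj(1)[OF u]
      have "lift (Dom A u) (disc (Dom A u)) (Ident A (Dom A u)) = Ident E (disc (Dom A u))"
        by (rule lift_eqI[OF dom.ident_hom[OF disc_obj[OF a]] a])
          (simp add: fm_ident[OF disc_obj[OF a]] proj_disc[OF a])
      then show ?thesis unfolding dom.slice_simps cod.slice_simps slice_lift_simps dl[OF u] by simp
    qed
    show "Fm (slice_lift X) (g \<cdot>\<^bsub>slice A (Fo U X)\<^esub> f) = Fm (slice_lift X) g \<cdot>\<^bsub>slice E X\<^esub> Fm (slice_lift X) f"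
      if f: "f \<in> Hom (slice A (Fo U X)) u v" and g: "g \<in> Hom (slice A (Fo U X)) v w" for f g u v w
    proof -
      obtain h where fh: "f = (u, h, v)" and h: "h \<in> Hom A (Dom A u) (Dom A v)"
        using f unfolding cod.slice_hom by blast
      obtain k where gk: "g = (v, k, w)" and k: "k \<in> Hom A (Dom A v) (Dom A w)"
        using g unfolding cod.slice_hom by blast
      note ob = cod.hom_obj[OF k]
      have k': "k \<in> Hom A (Dom A v) (Fo U (disc (Dom A w)))" using k proj_disc[OF ob(2)] by simp
      show ?thesis unfolding fh gk dom.slice_simps cod.slice_simps slice_lift_simps
        lift_comp[OF disc_obj[OF ob(2)] k' h] ..
    qed
  qed
qed

lemma slice_lift_fully_faithful:
  assumes X: "X \<in> Obj E"
  shows "fully_faithful (slice A (Fo U X)) (slice E X) (slice_lift X)"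
  unfolding fully_faithful_def
proof (intro ballI ex_ex1I)
  fix u v f assume ob: "u \<in> Obj (slice A (Fo U X))" "v \<in> Obj (slice A (Fo U X))"
    and f: "f \<in> Hom (slice E X) (Fo (slice_lift X) u) (Fo (slice_lift X) v)"
  note u = ob(1)[unfolded cod.slice_obj] and v = ob(2)[unfolded cod.slice_obj]
  note a = cod.hom_obj(1)[OF u] and b = cod.hom_obj(1)[OF v]
  note lu = lift_hom[OF X u] and lv = lift_hom[OF X v]
  obtain \<phi> where f_eq: "f = (lift (Dom A u) X u, \<phi>, lift (Dom A v) X v)"
    and phi: "\<phi> \<in> Hom E (disc (Dom A u)) (disc (Dom A v))"
    and tri: "lift (Dom A v) X v \<cdot>\<^bsub>E\<^esub> \<phi> = lift (Dom A u) X u"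
    using f lu lv unfolding dom.slice_hom slice_lift_simps by (auto simp: hom_iff)
  have h: "Fm U \<phi> \<in> Hom A (Dom A u) (Dom A v)" using fm_hom[OF phi] a b by (simp add: proj_disc)
  have "v \<cdot>\<^bsub>A\<^esub> Fm U \<phi> = u" using fm_comp[OF phi lv] tri proj_lift[OF X u] proj_lift[OF X v] by simp
  then have "(u, Fm U \<phi>, v) \<in> Hom (slice A (Fo U X)) u v" using ob h unfolding cod.slice_hom by blast
  moreover have "Fm (slice_lift X) (u, Fm U \<phi>, v) = f"
    unfolding slice_lift_simps f_eq lift_eqI[OF phi a refl] ..
  ultimately show "\<exists>g. g \<in> Hom (slice A (Fo U X)) u v \<and> Fm (slice_lift X) g = f" by blast
next
  fix u v f g g' assume ob: "v \<in> Obj (slice A (Fo U X))"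
    and g: "g \<in> Hom (slice A (Fo U X)) u v \<and> Fm (slice_lift X) g = f"
    and g': "g' \<in> Hom (slice A (Fo U X)) u v \<and> Fm (slice_lift X) g' = f"
  note b = cod.hom_obj(1)[OF ob[unfolded cod.slice_obj]]
  obtain h where gh: "g = (u, h, v)" and h: "h \<in> Hom A (Dom A u) (Dom A v)" using g unfolding cod.slice_hom by blast
  obtain h' where gh': "g' = (u, h', v)" and h': "h' \<in> Hom A (Dom A u) (Dom A v)" using g' unfolding cod.slice_hom by blast
  have "lift (Dom A u) (disc (Dom A v)) h = lift (Dom A u) (disc (Dom A v)) h'"
    using g g' unfolding gh gh' slice_lift_simps by auto
  then have "h = h'"
    using proj_lift[OF disc_obj[OF b]] h h' unfolding proj_disc[OF b] by metis
  then show "g = g'" unfolding gh gh' by simp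
qed

text \<open>
  The coreflection of \<open>d : Z \<rightarrow> X\<close> replaces \<open>Z\<close> by the discrete object over \<open>U Z\<close>.
\<close>

lemma slice_lift_coreflective:
  assumes X: "X \<in> Obj E" and d: "d \<in> Obj (slice E X)"
  shows "\<exists>u \<kappa>. couniversal (slice A (Fo U X)) (slice E X) (slice_lift X) d u \<kappa>"
proof -
  interpret L: cat_functor "slice A (Fo U X)" "slice E X" "slice_lift X" by (rule slice_lift_functor[OF X])
  define Z where "Z = Dom E d"
  have dZ: "d \<in> Hom E Z X" using d unfolding dom.slice_obj Z_def .
  note Z = dom.hom_obj(1)[OF dZ]
  note UZ = fo_obj[OF Z]
  note Ud = fm_hom[OF dZ]
  have DUd: "Dom A (Fm U d) = Fo U Z" using Ud by (simp add: hom_iff)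
  note i = cod.ident_hom[OF UZ]
  define \<kappa> where "\<kappa> = (lift (Fo U Z) X (Fm U d), lift (Fo U Z) Z (Ident A (Fo U Z)), d)"
  have ob: "Fm U d \<in> Obj (slice A (Fo U X))" using Ud DUd unfolding cod.slice_obj by simp
  have dk: "d \<cdot>\<^bsub>E\<^esub> lift (Fo U Z) Z p = lift (Fo U Z) X (Fm U d \<cdot>\<^bsub>A\<^esub> p)" if "p \<in> Hom A (Fo U Z) (Fo U Z)" for p
    by (rule comp_lift[OF Z that dZ])
  have "\<kappa> \<in> Hom (slice E X) (Fo (slice_lift X) (Fm U d)) d"
    using L.fo_obj[OF ob] d lift_hom[OF X Ud] lift_hom[OF Z i] dk[OF i] cod.comp_ident_right[OF Ud]
    unfolding dom.slice_hom slice_lift_simps DUd \<kappa>_def Z_def[symmetric] by (auto simp: hom_iff)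
  then have "couniversal (slice A (Fo U X)) (slice E X) (slice_lift X) d (Fm U d) \<kappa>"
  proof (rule L.couniversalI[OF ob d])
    fix u t assume u: "u \<in> Obj (slice A (Fo U X))" and t: "t \<in> Hom (slice E X) (Fo (slice_lift X) u) d"
    note u' = u[unfolded cod.slice_obj]
    note a = cod.hom_obj(1)[OF u']
    obtain \<phi> where t_eq: "t = (lift (Dom A u) X u, \<phi>, d)" and phi: "\<phi> \<in> Hom E (disc (Dom A u)) Z"
      and tri: "d \<cdot>\<^bsub>E\<^esub> \<phi> = lift (Dom A u) X u"
      using t lift_hom[OF X u'] unfolding dom.slice_hom slice_lift_simps Z_def by (auto simp: hom_iff)
    have h: "Fm U \<phi> \<in> Hom A (Dom A u) (Fo U Z)" using fm_hom[OF phi] proj_disc[OF a] by simp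
    have "Fm U d \<cdot>\<^bsub>A\<^esub> Fm U \<phi> = u" using fm_comp[OF phi dZ] tri proj_lift[OF X u'] by simp
    then have "(u, Fm U \<phi>, Fm U d) \<in> Hom (slice A (Fo U X)) u (Fm U d)"
      using u ob h unfolding cod.slice_hom DUd by blast
    moreover have "\<kappa> \<cdot>\<^bsub>slice E X\<^esub> Fm (slice_lift X) (u, Fm U \<phi>, Fm U d) = t"
      unfolding \<kappa>_def slice_lift_simps dom.slice_simps t_eq DUd lift_comp[OF Z i h]
        cod.comp_ident_left[OF h] lift_eqI[OF phi a refl] ..
    ultimately show "\<exists>s. s \<in> Hom (slice A (Fo U X)) u (Fm U d) \<and> \<kappa> \<cdot>\<^bsub>slice E X\<^esub> Fm (slice_lift X) s = t" by blast
  next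
    fix u s s' assume s: "s \<in> Hom (slice A (Fo U X)) u (Fm U d)" and s': "s' \<in> Hom (slice A (Fo U X)) u (Fm U d)"
      and eq: "\<kappa> \<cdot>\<^bsub>slice E X\<^esub> Fm (slice_lift X) s = \<kappa> \<cdot>\<^bsub>slice E X\<^esub> Fm (slice_lift X) s'"
    obtain h where sh: "s = (u, h, Fm U d)" and h: "h \<in> Hom A (Dom A u) (Fo U Z)"
      using s unfolding cod.slice_hom DUd by blast
    obtain h' where sh': "s' = (u, h', Fm U d)" and h': "h' \<in> Hom A (Dom A u) (Fo U Z)"
      using s' unfolding cod.slice_hom DUd by blast
    have "lift (Dom A u) Z h = lift (Dom A u) Z h'"
      using eq unfolding \<kappa>_def sh sh' slice_lift_simps dom.slice_simps DUd lift_comp[OF Z i h] lift_comp[OF Z i h']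
        cod.comp_ident_left[OF h] cod.comp_ident_left[OF h'] by (simp only: prod.inject)
    then have "h = h'" using proj_lift[OF Z h] proj_lift[OF Z h'] by metis
    then show "s = s'" unfolding sh sh' by simp
  qed
  then show ?thesis by blast
qed

text \<open>
  The pullback along \<open>q\<close> of an arrow with discrete source projects to that source, hence its own source \<open>W\<close> is
  discrete by the sieve property. As \<open>W\<close> is then isomorphic to the chosen discrete object over \<open>U W\<close>, the
  pullback can be taken in the image of the embedding.
\<close>

lemma slice_lift_restrict:
  assumes q: "q \<in> Hom E X Y" and m: "monadic_left (slice E X) (slice E Y) (slice_push E q)"
    and u: "u \<in> Obj (slice A (Fo U Y))"
  shows "\<exists>w e. w \<in> Obj (slice A (Fo U X))
    \<and> e \<in> Hom (slice A (Fo U Y)) (Fo (slice_push A (Fm U q)) w) u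
    \<and> couniversal (slice E X) (slice E Y) (slice_push E q) (Fo (slice_lift Y) u) (Fo (slice_lift X) w)
        (Fm (slice_lift Y) e)"
proof -
  interpret F: cat_functor "slice E X" "slice E Y" "slice_push E q" by (rule dom.slice_push_functor[OF q])
  note XY = dom.hom_obj[OF q] and Uq = fm_hom[OF q]
  interpret LX: cat_functor "slice A (Fo U X)" "slice E X" "slice_lift X" by (rule slice_lift_functor[OF XY(1)])
  interpret LY: cat_functor "slice A (Fo U Y)" "slice E Y" "slice_lift Y" by (rule slice_lift_functor[OF XY(2)])
  note u' = u[unfolded cod.slice_obj]
  note z = cod.hom_obj(1)[OF u']
  define Z where "Z = disc (Dom A u)"
  have lu: "lift (Dom A u) Y u \<in> Hom E Z Y" unfolding Z_def by (rule lift_hom[OF XY(2) u'])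
  obtain c e where cu: "couniversal (slice E X) (slice E Y) (slice_push E q) (Fo (slice_lift Y) u) c e"
    using F.monadic_leftD(1)[OF m LY.fo_obj[OF u]] by blast
  define W where "W = Dom E c"
  have c: "c \<in> Hom E W X" using couniversalD(1)[OF cu] unfolding dom.slice_obj W_def .
  note W = dom.hom_obj(1)[OF c]
  obtain v where e: "e = (q \<cdot>\<^bsub>E\<^esub> c, v, lift (Dom A u) Y u)" and v: "v \<in> Hom E W Z"
    and sq: "lift (Dom A u) Y u \<cdot>\<^bsub>E\<^esub> v = q \<cdot>\<^bsub>E\<^esub> c"
    using couniversalD(3)[OF cu] lu dom.comp_hom[OF c q]
    unfolding dom.slice_hom dom.slice_push_simps slice_lift_simps by (auto simp: hom_iff)
  have Wd: "discrete E A U W" using discrete_sieve[OF v] discrete_disc[OF z] unfolding Z_def by blast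
  note UW = fo_obj[OF W]
  define W' where "W' = disc (Fo U W)"
  note W'd = discrete_disc[OF UW, folded W'_def] and UW' = proj_disc[OF UW, folded W'_def]
  note W' = disc_obj[OF UW, folded W'_def]
  note id = cod.ident_hom[OF UW]
  obtain i where i: "i \<in> Hom E W' W" "Fm U i = Ident A (Fo U W)"
    using discrete_lift[OF W'd W] id unfolding UW' by blast
  obtain j where j: "j \<in> Hom E W W'" "Fm U j = Ident A (Fo U W)"
    using discrete_lift[OF Wd W'] id unfolding UW' by blast
  have ij: "i \<cdot>\<^bsub>E\<^esub> j = Ident E W"
    by (rule discrete_cancel[OF Wd dom.comp_hom[OF j(1) i(1)] dom.ident_hom[OF W]])
      (simp add: fm_comp[OF j(1) i(1)] i j fm_ident[OF W] cod.comp_ident_left[OF id])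
  have ji: "j \<cdot>\<^bsub>E\<^esub> i = Ident E W'"
    by (rule discrete_cancel[OF W'd dom.comp_hom[OF i(1) j(1)] dom.ident_hom[OF W']])
      (simp add: fm_comp[OF i(1) j(1)] i j fm_ident[OF W'] UW' cod.comp_ident_left[OF id])
  note ci = dom.comp_hom[OF i(1) c]
  define w where "w = Fm U c"
  have w: "w \<in> Hom A (Fo U W) (Fo U X)" unfolding w_def by (rule fm_hom[OF c])
  have Dw: "Dom A w = Fo U W" using w by (simp add: hom_iff)
  have w_ob: "w \<in> Obj (slice A (Fo U X))" using w Dw unfolding cod.slice_obj by simp
  have lw: "lift (Fo U W) X w = c \<cdot>\<^bsub>E\<^esub> i"
    by (rule lift_eqI[OF ci[unfolded W'_def] UW])
      (simp add: fm_comp[OF i(1) c] i w_def cod.comp_ident_right[OF fm_hom[OF c]])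
  have Uv: "Fm U v \<in> Hom A (Fo U W) (Dom A u)" using fm_hom[OF v] proj_disc[OF z] unfolding Z_def by simp
  have lv: "lift (Fo U W) Z (Fm U v) = v \<cdot>\<^bsub>E\<^esub> i"
    by (rule lift_eqI[OF dom.comp_hom[OF i(1) v, unfolded W'_def] UW])
      (simp add: fm_comp[OF i(1) v] i cod.comp_ident_right[OF fm_hom[OF v]])
  note qw = cod.comp_hom[OF w Uq]
  define e' where "e' = (Fm U q \<cdot>\<^bsub>A\<^esub> w, Fm U v, u)"
  have "u \<cdot>\<^bsub>A\<^esub> Fm U v = Fm U q \<cdot>\<^bsub>A\<^esub> w"
    using fm_comp[OF v lu] fm_comp[OF c q] sq proj_lift[OF XY(2) u'] unfolding w_def by simp
  then have e': "e' \<in> Hom (slice A (Fo U Y)) (Fo (slice_push A (Fm U q)) w) u"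
    using u qw Uv unfolding cod.slice_hom cod.slice_push_simps e'_def cod.slice_obj by (auto simp: hom_iff)
  have Dci: "Dom E c = W" "Dom E (c \<cdot>\<^bsub>E\<^esub> i) = W'" using c ci by (auto simp: hom_iff)
  have obs: "c \<in> Obj (slice E X)" "c \<cdot>\<^bsub>E\<^esub> i \<in> Obj (slice E X)"
    using c ci unfolding dom.slice_obj Dci by auto
  have "couniversal (slice E X) (slice E Y) (slice_push E q) (Fo (slice_lift Y) u) (c \<cdot>\<^bsub>E\<^esub> i)
      (e \<cdot>\<^bsub>slice E Y\<^esub> Fm (slice_push E q) (c \<cdot>\<^bsub>E\<^esub> i, i, c))"
  proof (rule F.couniversal_precomp_iso[OF cu])
    show "(c \<cdot>\<^bsub>E\<^esub> i, i, c) \<in> Hom (slice E X) (c \<cdot>\<^bsub>E\<^esub> i) c"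
      using obs i(1) unfolding dom.slice_hom Dci by blast
    have "(c \<cdot>\<^bsub>E\<^esub> i) \<cdot>\<^bsub>E\<^esub> j = c"
      unfolding dom.comp_assoc[OF j(1) i(1) c] ij by (rule dom.comp_ident_right[OF c])
    then show "(c, j, c \<cdot>\<^bsub>E\<^esub> i) \<in> Hom (slice E X) c (c \<cdot>\<^bsub>E\<^esub> i)"
      using obs j(1) unfolding dom.slice_hom Dci by blast
  qed (simp_all add: dom.slice_simps Dci ij ji)
  moreover have "e \<cdot>\<^bsub>slice E Y\<^esub> Fm (slice_push E q) (c \<cdot>\<^bsub>E\<^esub> i, i, c) = Fm (slice_lift Y) e'"
  proof -
    have "q \<cdot>\<^bsub>E\<^esub> (c \<cdot>\<^bsub>E\<^esub> i) = lift (Fo U W) Y (Fm U q \<cdot>\<^bsub>A\<^esub> w)"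
      unfolding lw[symmetric] by (rule comp_lift[OF XY(1) w q])
    moreover have "Dom A (Fm U q \<cdot>\<^bsub>A\<^esub> w) = Fo U W" using qw by (simp add: hom_iff)
    ultimately show ?thesis
      unfolding e e'_def slice_lift_simps dom.slice_push_simps dom.slice_simps lv[symmetric] Z_def by simp
  qed
  ultimately have "couniversal (slice E X) (slice E Y) (slice_push E q) (Fo (slice_lift Y) u)
      (Fo (slice_lift X) w) (Fm (slice_lift Y) e')"
    unfolding slice_lift_simps Dw lw by simp
  with w_ob e' show ?thesis by blast
qed

theorem preserves_effective_descent: "preserves_effective_descent E A U"
  unfolding preserves_effective_descent_def
proof (intro allI impI)
  fix q assume "effective_descent E q"
  then have qa: "q \<in> Arr E" and m: "monadic_left (slice E (Dom E q)) (slice E (Cod E q)) (slice_push E q)"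
    unfolding dom.effective_descent_iff_monadic_left by auto
  define X Y where "X = Dom E q" and "Y = Cod E q"
  have q: "q \<in> Hom E X Y" using qa by (simp add: hom_iff X_def Y_def)
  note m = m[folded X_def Y_def]
  note XY = dom.hom_obj[OF q] and Uq = fm_hom[OF q]
  interpret coreflective_restriction "slice E X" "slice E Y" "slice_push E q"
    "slice A (Fo U X)" "slice A (Fo U Y)" "slice_push A (Fm U q)" "slice_lift X" "slice_lift Y"
  proof (intro coreflective_restriction.intro coreflective_restriction_axioms.intro)
    show "cat_functor (slice E X) (slice E Y) (slice_push E q)" by (rule dom.slice_push_functor[OF q])
    show "cat_functor (slice A (Fo U X)) (slice A (Fo U Y)) (slice_push A (Fm U q))"
      by (rule cod.slice_push_functor[OF Uq])
    have push: "q \<cdot>\<^bsub>E\<^esub> lift (Dom A u) X u = lift (Dom A (Fm U q \<cdot>\<^bsub>A\<^esub> u)) Y (Fm U q \<cdot>\<^bsub>A\<^esub> u)"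
      "Dom A (Fm U q \<cdot>\<^bsub>A\<^esub> u) = Dom A u"
      if "u \<in> Obj (slice A (Fo U X))" for u
    proof -
      note u = that[unfolded cod.slice_obj]
      show D: "Dom A (Fm U q \<cdot>\<^bsub>A\<^esub> u) = Dom A u" using cod.comp_hom[OF u Uq] by (simp add: hom_iff)
      show "q \<cdot>\<^bsub>E\<^esub> lift (Dom A u) X u = lift (Dom A (Fm U q \<cdot>\<^bsub>A\<^esub> u)) Y (Fm U q \<cdot>\<^bsub>A\<^esub> u)"
        unfolding D by (rule comp_lift[OF XY(1) u q])
    qed
    show "Fo (slice_push E q) (Fo (slice_lift X) u) = Fo (slice_lift Y) (Fo (slice_push A (Fm U q)) u)"
      if "u \<in> Obj (slice A (Fo U X))" for u
      unfolding slice_lift_simps dom.slice_push_simps cod.slice_push_simps by (rule push(1)[OF that])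
    show "Fm (slice_push E q) (Fm (slice_lift X) f) = Fm (slice_lift Y) (Fm (slice_push A (Fm U q)) f)"
      if fa: "f \<in> Arr (slice A (Fo U X))" for f
    proof -
      obtain u h v where f: "f = (u, h, v)" "u \<in> Obj (slice A (Fo U X))" "v \<in> Obj (slice A (Fo U X))"
        using fa by (auto simp: slice_def)
      show ?thesis
        unfolding f(1) slice_lift_simps dom.slice_push_simps cod.slice_push_simps
          push(1)[OF f(2)] push(1)[OF f(3)] push(2)[OF f(2)] push(2)[OF f(3)] ..
    qed
  qed (fact slice_lift_functor[OF XY(1)] slice_lift_functor[OF XY(2)] slice_lift_fully_faithful[OF XY(1)]
      slice_lift_fully_faithful[OF XY(2)] slice_lift_coreflective[OF XY(2)] slice_lift_restrict[OF q m])+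
  have "Dom A (Fm U q) = Fo U X" "Cod A (Fm U q) = Fo U Y" "Fm U q \<in> Arr A" using Uq by (auto simp: hom_iff)
  with restricts_monadic_left[OF m] show "effective_descent A (Fm U q)"
    unfolding cod.effective_descent_iff_monadic_left by simp
qed

end

section \<open>Lax comma categories over a 2-category with a strict initial object\<close>

context two_category begin

text \<open>
  The uniqueness of cells includes that of arrows, since an arrow is determined by its identity cell. In this
  form the property passes along isomorphisms by whiskering.
\<close>

definition two_initial :: "'o \<Rightarrow> bool" where
  "two_initial a \<longleftrightarrow> a \<in> Obj A \<and> (\<forall>x \<in> Obj A. Hom A a x \<noteq> {}
     \<and> (\<forall>\<alpha> \<in> Cell A. \<forall>\<beta> \<in> Cell A. Src A \<alpha> \<in> Hom A a x \<and> Src A \<beta> \<in> Hom A a x \<longrightarrow> \<alpha> = \<beta>))"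

lemma two_initial_strict_initial:
  assumes "strict_initial A i"
  shows "two_initial i"
  unfolding two_initial_def
proof (intro conjI ballI impI)
  show "i \<in> Obj A" using assms by (simp add: strict_initial_def)
  fix x assume "x \<in> Obj A"
  then have "isomorphic_cats (hom_cat A i x) one_cat" using assms by (simp add: strict_initial_def)
  note one = isomorphic_one_cat[OF this]
  show "Hom A i x \<noteq> {}" using one(1) by (auto simp: hom_cat_def)
  fix \<alpha> \<beta> assume "\<alpha> \<in> Cell A" "\<beta> \<in> Cell A" "Src A \<alpha> \<in> Hom A i x \<and> Src A \<beta> \<in> Hom A i x"
  then have "\<alpha> \<in> Arr (hom_cat A i x)" "\<beta> \<in> Arr (hom_cat A i x)"
    by (auto simp: hom_cat_def hom_iff)
  with one(2) show "\<alpha> = \<beta>" by blast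
qed

lemma two_initial_arr_unique:
  assumes a: "two_initial a" and f: "f \<in> Hom A a x" "g \<in> Hom A a x"
  shows "f = g"
proof -
  have "x \<in> Obj A" by (rule hom_obj[OF f(1)])
  moreover have "Vid A f \<in> Cell A" "Vid A g \<in> Cell A" "Src A (Vid A f) = f" "Src A (Vid A g) = g"
    using f by (auto simp: hom_iff)
  ultimately show ?thesis using a f unfolding two_initial_def by metis
qed

lemma two_initial_iso:
  assumes a: "two_initial a" and k: "k \<in> Hom A b a" and l: "l \<in> Hom A a b" and lk: "l \<cdot> k = Ident A b"
  shows "two_initial b"
  unfolding two_initial_def
proof (intro conjI ballI impI)
  show "b \<in> Obj A" by (rule hom_obj[OF k])
  fix x assume x: "x \<in> Obj A"
  then obtain f where "f \<in> Hom A a x" using a unfolding two_initial_def by blast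
  then show "Hom A b x \<noteq> {}" using comp_hom[OF k] by blast
  have factor: "\<alpha> = (\<alpha> \<star> Vid A l) \<star> Vid A k" "\<alpha> \<star> Vid A l \<in> Cell A" "Src A (\<alpha> \<star> Vid A l) \<in> Hom A a x"
    if "\<alpha> \<in> Cell A" "Src A \<alpha> \<in> Hom A b x" for \<alpha>
    using that k l lk by (auto simp: hom_iff)
  fix \<alpha> \<beta> assume "\<alpha> \<in> Cell A" "\<beta> \<in> Cell A" "Src A \<alpha> \<in> Hom A b x \<and> Src A \<beta> \<in> Hom A b x"
  then show "\<alpha> = \<beta>" using factor[of \<alpha>] factor[of \<beta>] a x unfolding two_initial_def by metis
qed

abbreviation (input) E where "E \<equiv> op_grothendieck A (lax_comma_pseudofun A)"

lemma grothendieck_obj_iff: "(x, f) \<in> Obj E \<longleftrightarrow> f \<in> Hom A (Dom A f) x"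
  by (auto simp: op_grothendieck_def lax_comma_pseudofun_def lax_comma_def hom_iff)

lemma grothendieck_hom_iff: "u \<in> Hom E (x, f) (y, g) \<longleftrightarrow> (\<exists>p h \<pi>. u = ((x, f), (p, (p \<cdot> f, (h, \<pi>), g)), (y, g))
    \<and> (x, f) \<in> Obj E \<and> (y, g) \<in> Obj E \<and> p \<in> Hom A x y \<and> h \<in> Hom A (Dom A f) (Dom A g) \<and> \<pi> \<in> Cells A (p \<cdot> f) (g \<cdot> h))"
  (is "?L \<longleftrightarrow> ?R")
proof
  assume L: ?L
  then obtain p f' h \<pi> g' where u: "u = ((x, f), (p, (f', (h, \<pi>), g')), (y, g))"
    by (cases u) (auto simp: op_grothendieck_def hom_iff)
  show ?R using L lax_comma_grothendieck_arr[OF two_category_axioms, of x f p f' h \<pi> g' y g]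
    unfolding u grothendieck_obj_iff by (auto simp: hom_iff)
next
  assume ?R
  then show ?L unfolding grothendieck_obj_iff
    by (auto simp: hom_iff op_grothendieck_def lax_comma_pseudofun_def lax_comma_def lax_comma_push_def)
qed

lemma proj_simps: "Fo op_grothendieck_proj (x, f) = x" "Fm op_grothendieck_proj (X, (p, \<phi>), Y) = p"
  by (simp_all add: op_grothendieck_proj_def)

text \<open>
  Over \<open>p\<close>, an arrow out of \<open>f\<close> consists of an arrow \<open>h\<close> out of the source of \<open>f\<close> and a cell between arrows out of
  that source; both exist uniquely.
\<close>

lemma discrete_of_two_initial_dom:
  assumes ob: "(x, f) \<in> Obj E" and init: "two_initial (Dom A f)"
  shows "discrete E A op_grothendieck_proj (x, f)"
  unfolding discrete_def
proof (intro conjI ballI)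
  show "(x, f) \<in> Obj E" by (rule ob)
  fix Z p assume Z: "Z \<in> Obj E" and p: "p \<in> Hom A (Fo op_grothendieck_proj (x, f)) (Fo op_grothendieck_proj Z)"
  obtain y g where Zyg: "Z = (y, g)" by fastforce
  note f = ob[unfolded grothendieck_obj_iff] and g = Z[unfolded Zyg grothendieck_obj_iff]
  have p: "p \<in> Hom A x y" using p by (simp add: Zyg proj_simps)
  have y: "y \<in> Obj A" by (rule hom_obj[OF g])
  obtain h where h: "h \<in> Hom A (Dom A f) (Dom A g)"
    using init hom_obj(1)[OF g] unfolding two_initial_def by blast
  note pf = comp_hom[OF f p] and gh = comp_hom[OF h g]
  have "Vid A (p \<cdot> f) \<in> Cells A (p \<cdot> f) (g \<cdot> h)"
    using two_initial_arr_unique[OF init pf gh] pf by (simp add: cells_iff hom_iff)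
  then have ex: "((x, f), (p, (p \<cdot> f, (h, Vid A (p \<cdot> f)), g)), (y, g)) \<in> Hom E (x, f) Z"
    using ob Z[unfolded Zyg] p h unfolding Zyg grothendieck_hom_iff by simp
  show "\<exists>!u. u \<in> Hom E (x, f) Z \<and> Fm op_grothendieck_proj u = p"
  proof (rule ex_ex1I)
    show "\<exists>u. u \<in> Hom E (x, f) Z \<and> Fm op_grothendieck_proj u = p"
      by (intro exI conjI, rule ex) (rule proj_simps)
    fix u v assume u: "u \<in> Hom E (x, f) Z \<and> Fm op_grothendieck_proj u = p"
      and v: "v \<in> Hom E (x, f) Z \<and> Fm op_grothendieck_proj v = p"
    obtain h1 \<pi>1 where u: "u = ((x, f), (p, (p \<cdot> f, (h1, \<pi>1), g)), (y, g))" and h1: "h1 \<in> Hom A (Dom A f) (Dom A g)"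
      and \<pi>1: "\<pi>1 \<in> Cells A (p \<cdot> f) (g \<cdot> h1)"
      using u unfolding Zyg grothendieck_hom_iff by (auto simp: proj_simps)
    obtain h2 \<pi>2 where v: "v = ((x, f), (p, (p \<cdot> f, (h2, \<pi>2), g)), (y, g))" and h2: "h2 \<in> Hom A (Dom A f) (Dom A g)"
      and \<pi>2: "\<pi>2 \<in> Cells A (p \<cdot> f) (g \<cdot> h2)"
      using v unfolding Zyg grothendieck_hom_iff by (auto simp: proj_simps)
    have "\<pi>1 = \<pi>2" using \<pi>1 \<pi>2 pf init y unfolding two_initial_def cells_iff by metis
    then show "u = v" unfolding u v using two_initial_arr_unique[OF init h1 h2] by simp
  qed
qed

text \<open>
  The discrete object over \<open>x\<close> is the arrow \<open>i \<rightarrow> x\<close>. If \<open>g\<close> is discrete, the identity of its target lifts to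
  an arrow from \<open>g\<close> to the chosen discrete object, so the source of \<open>g\<close> maps to \<open>i\<close>; this is inherited by every
  object with an arrow to \<open>g\<close>, and strictness makes its source initial.
\<close>

lemma grothendieck_proj_discrete_objects:
  assumes i: "strict_initial A i"
  shows "discrete_objects E A op_grothendieck_proj (\<lambda>x. (x, SOME f. f \<in> Hom A i x))"
proof -
  note init = two_initial_strict_initial[OF i]
  define bang where "bang x = (SOME f. f \<in> Hom A i x)" for x
  have bang: "bang x \<in> Hom A i x" if "x \<in> Obj A" for x
    using that init unfolding two_initial_def bang_def by (auto intro: someI)
  have db: "discrete E A op_grothendieck_proj (x, bang x)" if x: "x \<in> Obj A" for x
  proof (rule discrete_of_two_initial_dom)
    have D: "Dom A (bang x) = i" using bang[OF x] by (simp add: hom_iff)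
    show "(x, bang x) \<in> Obj E" unfolding grothendieck_obj_iff D by (rule bang[OF x])
    show "two_initial (Dom A (bang x))" unfolding D by (rule init)
  qed
  have strict: "two_initial a" if m: "m \<in> Hom A a i" for a m
  proof -
    obtain k where k: "k \<in> Hom A a i" "is_iso A k"
      using i m hom_obj(1)[OF m] unfolding strict_initial_def isomorphic_objs_def by blast
    obtain l where "l \<in> Hom A i a" "l \<cdot> k = Ident A a" using is_isoE[OF k(2,1)] by blast
    then show ?thesis by (rule two_initial_iso[OF init k(1)])
  qed
  show ?thesis
    unfolding bang_def[symmetric]
  proof (intro discrete_objects.intro discrete_objects_axioms.intro)
    show "cat_functor E A op_grothendieck_proj"
      by (rule pseudofunctor.op_grothendieck_proj_functor[OF pseudofunctor_lax_comma])
    show "discrete E A op_grothendieck_proj (x, bang x)" if "x \<in> Obj A" for x by (rule db[OF that])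
    show "Fo op_grothendieck_proj (x, bang x) = x" for x by (rule proj_simps)
    fix u X Y assume u: "u \<in> Hom E X Y" and Y: "discrete E A op_grothendieck_proj Y"
    obtain x f y g where XY: "X = (x, f)" "Y = (y, g)" by fastforce
    have Yo: "(y, g) \<in> Obj E" using Y unfolding XY discrete_def by blast
    have y: "y \<in> Obj A" by (rule hom_obj[OF Yo[unfolded grothendieck_obj_iff]])
    have D: "Dom A (bang y) = i" using bang[OF y] by (simp add: hom_iff)
    have "(y, bang y) \<in> Obj E" "Ident A y \<in> Hom A (Fo op_grothendieck_proj (y, g)) (Fo op_grothendieck_proj (y, bang y))"
      using db[OF y] ident_hom[OF y] by (auto simp: discrete_def proj_simps)
    then obtain v where "v \<in> Hom E (y, g) (y, bang y)" using Y unfolding XY discrete_def by blast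
    then obtain k where k: "k \<in> Hom A (Dom A g) i" unfolding grothendieck_hom_iff D by blast
    obtain h where h: "h \<in> Hom A (Dom A f) (Dom A g)" and Xo: "(x, f) \<in> Obj E"
      using u unfolding XY grothendieck_hom_iff by blast
    show "discrete E A op_grothendieck_proj X"
      unfolding XY by (rule discrete_of_two_initial_dom[OF Xo strict[OF comp_hom[OF h k]]])
  qed
qed

end

theorem lemma30:
  fixes A :: "('o, 'm, 'c) two_cat" and i :: 'o
  assumes "two_category A"
    and "strict_initial A i"
  shows "preserves_effective_descent
           (op_grothendieck A (lax_comma_pseudofun A)) A op_grothendieck_proj"
  using discrete_objects.preserves_effective_descent[OF
      two_category.grothendieck_proj_discrete_objects[OF assms]] .

end
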